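(* For any graph $G$ (with base vertex $v_0$) and any positive integer $n$, the map $\psi:A_n(G)\to H^{\square}_n(G)$, $\psi([f])=\overline{\phi(f)}$, is a well-defined group homomorphism which is natural in $G$ (i.e. for every graph map $F:G\to G'$ with $F(v_0)=v_0'$, $\psi\circ F_*=F_*\circ\psi$, where $F_*$ denotes the maps induced by composition with $F$). Moreover, for each $n\geq 1$ there is an infinite family of graphs $G$ for which $\psi:A_n(G)\to H^{\square}_n(G)$ is surjective and $H^{\square}_n(G)$ is nontrivial.
   Context: All graphs are simple, connected and undirected. For vertices $u,v$ write $u\simeq v$ if $u=v$ or $u,v$ are adjacent; a graph map $f:G_1\to G_2$ is a function between vertex sets with $f(u)\simeq f(v)$ whenever $u\simeq v$. $\mathbb{Z}$ is the graph on the integers with $i\sim j$ iff $|i-j|=1$, $I_m$ its induced subgraph on $\{0,\dots,m\}$, $\times$ is the Cartesian product of graphs, and $I_m^n$ is the $n$-fold product (a subgraph of $\mathbb{Z}^n$). Discrete homotopy group: for $r\ge0$ let $\mathbb{Z}^n_{\geq r}=\{x:|x_i|\geq r\text{ for some }i\}$. A based map is a graph map $f:\mathbb{Z}^n\to G$ with $f\equiv v_0$ on $\mathbb{Z}^n_{\geq r}$ for some $r\ge 0$ (least such $r$ = radius). Based maps $f,g$ are based homotopic if there is a graph map $h:\mathbb{Z}^n\times I_m\to G$ with $h(-,0)=f$, $h(-,m)=g$, each $h(-,i)$ a based map. $A_n(G)$ is the set of based homotopy classes with product $[f][g]=[p]$, $p(x)=f(x)$ if $x_1\le r_f$, $p(x)=g(x_1-(r_f+r_g),x_2,\dots,x_n)$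 if $x_1>r_f$. Every class in $A_n(G)$ is represented by a graph map $f:I_m^n\to G$ (some $m$) with $f\equiv v_0$ on the boundary $\partial I_m^n$ (vertices having some coordinate $0$ or $m$), identified with its extension by $v_0$ to $\mathbb{Z}^n$. Discrete cubical homology: $Q_0$ is a single vertex and $Q_n=I_1^n$ for $n\ge1$. An $n$-cube of $G$ is a graph map $\sigma:Q_n\to G$; for $1\le i\le n$ let $D_i^{-}\sigma(a_1,\dots,a_{n-1})=\sigma(a_1,\dots,a_{i-1},0,a_i,\dots,a_{n-1})$ and $D_i^{+}\sigma$ likewise with $1$ inserted. $\sigma$ is degenerate if $D_i^-\sigma=D_i^+\sigma$ for some $i$. $C_n(G)$ is the free abelian group on $n$-cubes modulo the subgroup generated by degenerate $n$-cubes, $\partial_n\sigma=\sum_{i=1}^n(-1)^i(D_i^-\sigma-D_i^+\sigma)$ extended linearly, and $H^{\square}_n(G)=\ker\partial_n/\operatorname{im}\partial_{n+1}$; $\overline{z}$ denotes the class of a cycle $z$. For a graph map $f:I_{m_1}\times\cdots\times I_{m_n}\to G$ ($m_i\ge1$), let $f^x:Q_n\to G$, $f^x(y)=f(x+y)$, for $x\in I_{m_1-1}\times\cdots\times I_{m_n-1}$, and $\phi(f)=\sum_x f^x\in C_n(G)$. *)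

theory Defs
  imports Complex_Main "HOL-Library.FuncSet" "HOL-Algebra.Free_Abelian_Groups" "HOL-Algebra.Coset"
begin

section \<open>Graphs and graph maps\<close>

record 'v ugraph =
  verts :: "'v set"
  edges :: "('v \<times> 'v) set"

text \<open>Simple connected undirected graphs; an undirected edge is stored in both orientations.\<close>

definition is_graph :: "'v ugraph \<Rightarrow> bool" where
  "is_graph G \<longleftrightarrow> verts G \<noteq> {} \<and> edges G \<subseteq> verts G \<times> verts G \<and> sym (edges G) \<and> irrefl (edges G) \<and>
     (\<forall>u\<in>verts G. \<forall>v\<in>verts G. (u, v) \<in> (edges G)\<^sup>*)"

definition is_pointed_graph :: "'v ugraph \<Rightarrow> 'v \<Rightarrow> bool" where
  "is_pointed_graph G v0 \<longleftrightarrow> is_graph G \<and> v0 \<in> verts G"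

definition adj_eq :: "'v ugraph \<Rightarrow> 'v \<Rightarrow> 'v \<Rightarrow> bool" where
  "adj_eq G u v \<longleftrightarrow> u = v \<or> (u, v) \<in> edges G"

text \<open>Graph maps are extensional (undefined off the vertex set), so that equality in HOL is
  equality of maps on vertices.\<close>

definition graph_maps :: "'v ugraph \<Rightarrow> 'w ugraph \<Rightarrow> ('v \<Rightarrow> 'w) set" where
  "graph_maps G H = {f \<in> verts G \<rightarrow>\<^sub>E verts H.
     \<forall>u\<in>verts G. \<forall>v\<in>verts G. adj_eq G u v \<longrightarrow> adj_eq H (f u) (f v)}"

definition graph_isomorphic :: "'v ugraph \<Rightarrow> 'w ugraph \<Rightarrow> bool" where
  "graph_isomorphic G H \<longleftrightarrow> (\<exists>f. bij_betw f (verts G) (verts H) \<and>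
     (\<forall>u\<in>verts G. \<forall>v\<in>verts G. (u, v) \<in> edges G \<longleftrightarrow> (f u, f v) \<in> edges H))"

definition induced :: "'v ugraph \<Rightarrow> 'v set \<Rightarrow> 'v ugraph" where
  "induced G S = \<lparr>verts = verts G \<inter> S, edges = edges G \<inter> S \<times> S\<rparr>"

definition int_line :: "int ugraph" where
  "int_line = \<lparr>verts = UNIV, edges = {(i, j). \<bar>i - j\<bar> = 1}\<rparr>"

definition int_path :: "nat \<Rightarrow> int ugraph" where
  "int_path m = induced int_line {0..int m}"

definition cart_prod :: "'v ugraph \<Rightarrow> 'w ugraph \<Rightarrow> ('v \<times> 'w) ugraph" where
  "cart_prod G H = \<lparr>verts = verts G \<times> verts H,
     edges = {((u, u'), (v, v')).
       u \<in> verts G \<and> v \<in> verts G \<and> u' \<in> verts H \<and> v' \<in> verts H \<and>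
       (u = v \<and> (u', v') \<in> edges H \<or> (u, v) \<in> edges G \<and> u' = v')}\<rparr>"

text \<open>Cartesian product of a list of graphs.  The vertices are lists, the \<open>i\<close>-th coordinate (counted
  from 1) of \<open>x\<close> being \<open>x ! (i - 1)\<close>; the empty product is the single vertex \<open>[]\<close>.\<close>

definition cart_prod_list :: "'v ugraph list \<Rightarrow> 'v list ugraph" where
  "cart_prod_list Gs =
     (let V = {x. length x = length Gs \<and> (\<forall>i<length Gs. x ! i \<in> verts (Gs ! i))}
      in \<lparr>verts = V,
          edges = {(x, y). x \<in> V \<and> y \<in> V \<and>
            (\<exists>i<length Gs. (x ! i, y ! i) \<in> edges (Gs ! i) \<and>
               (\<forall>j<length Gs. j \<noteq> i \<longrightarrow> x ! j = y ! j))}\<rparr>)"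

definition int_lattice :: "nat \<Rightarrow> int list ugraph" where
  "int_lattice n = cart_prod_list (replicate n int_line)"

definition int_box :: "nat list \<Rightarrow> int list ugraph" where
  "int_box ms = cart_prod_list (map int_path ms)"

section \<open>Discrete homotopy groups\<close>

definition vanishes_beyond :: "nat \<Rightarrow> 'v \<Rightarrow> (int list \<Rightarrow> 'v) \<Rightarrow> nat \<Rightarrow> bool" where
  "vanishes_beyond n v0 f r \<longleftrightarrow>
     (\<forall>x\<in>verts (int_lattice n). (\<exists>i<n. \<bar>x ! i\<bar> \<ge> int r) \<longrightarrow> f x = v0)"

definition based_maps :: "nat \<Rightarrow> 'v ugraph \<Rightarrow> 'v \<Rightarrow> (int list \<Rightarrow> 'v) set" where
  "based_maps n G v0 = {f \<in> graph_maps (int_lattice n) G. \<exists>r. vanishes_beyond n v0 f r}"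

definition radius :: "nat \<Rightarrow> 'v \<Rightarrow> (int list \<Rightarrow> 'v) \<Rightarrow> nat" where
  "radius n v0 f = (LEAST r. vanishes_beyond n v0 f r)"

definition homotopy_slice :: "nat \<Rightarrow> (int list \<times> int \<Rightarrow> 'v) \<Rightarrow> int \<Rightarrow> int list \<Rightarrow> 'v" where
  "homotopy_slice n h i = (\<lambda>x\<in>verts (int_lattice n). h (x, i))"

definition based_homotopy_rel ::
  "nat \<Rightarrow> 'v ugraph \<Rightarrow> 'v \<Rightarrow> ((int list \<Rightarrow> 'v) \<times> (int list \<Rightarrow> 'v)) set" where
  "based_homotopy_rel n G v0 =
     {(f, g). f \<in> based_maps n G v0 \<and> g \<in> based_maps n G v0 \<and>
       (\<exists>m. \<exists>h\<in>graph_maps (cart_prod (int_lattice n) (int_path m)) G.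
          homotopy_slice n h 0 = f \<and> homotopy_slice n h (int m) = g \<and>
          (\<forall>i\<in>{0..int m}. homotopy_slice n h i \<in> based_maps n G v0))}"

definition htpy_class :: "nat \<Rightarrow> 'v ugraph \<Rightarrow> 'v \<Rightarrow> (int list \<Rightarrow> 'v) \<Rightarrow> (int list \<Rightarrow> 'v) set" where
  "htpy_class n G v0 f = based_homotopy_rel n G v0 `` {f}"

text \<open>For \<open>n \<ge> 1\<close> the first coordinate of \<open>x\<close> is \<open>hd x\<close>.\<close>

definition based_concat ::
  "nat \<Rightarrow> 'v \<Rightarrow> (int list \<Rightarrow> 'v) \<Rightarrow> (int list \<Rightarrow> 'v) \<Rightarrow> (int list \<Rightarrow> 'v)" where
  "based_concat n v0 f g = (\<lambda>x\<in>verts (int_lattice n).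
     if hd x \<le> int (radius n v0 f) then f x
     else g ((hd x - (int (radius n v0 f) + int (radius n v0 g))) # tl x))"

definition homotopy_gp :: "nat \<Rightarrow> 'v ugraph \<Rightarrow> 'v \<Rightarrow> (int list \<Rightarrow> 'v) set monoid" where
  "homotopy_gp n G v0 =
     \<lparr>carrier = based_maps n G v0 // based_homotopy_rel n G v0,
      monoid.mult = (\<lambda>X Y. \<Union>f\<in>X. \<Union>g\<in>Y. htpy_class n G v0 (based_concat n v0 f g)),
      one = htpy_class n G v0 (\<lambda>x\<in>verts (int_lattice n). v0)\<rparr>"

definition homotopy_gp_map ::
  "nat \<Rightarrow> 'w ugraph \<Rightarrow> 'w \<Rightarrow> ('v \<Rightarrow> 'w) \<Rightarrow> (int list \<Rightarrow> 'v) set \<Rightarrow> (int list \<Rightarrow> 'w) set" where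
  "homotopy_gp_map n G' v0' F X =
     (\<Union>f\<in>X. htpy_class n G' v0' (compose (verts (int_lattice n)) F f))"

text \<open>Graph maps from the \<open>n\<close>-fold product of the path \<open>int_path m\<close> that are constantly \<open>v0\<close> on the
  boundary, and their extensions by \<open>v0\<close> to the whole lattice.\<close>

definition cube_based_maps :: "nat \<Rightarrow> nat \<Rightarrow> 'v ugraph \<Rightarrow> 'v \<Rightarrow> (int list \<Rightarrow> 'v) set" where
  "cube_based_maps n m G v0 = {f \<in> graph_maps (int_box (replicate n m)) G.
     \<forall>x\<in>verts (int_box (replicate n m)). (\<exists>i<n. x ! i = 0 \<or> x ! i = int m) \<longrightarrow> f x = v0}"

definition extend_const :: "nat \<Rightarrow> nat \<Rightarrow> 'v \<Rightarrow> (int list \<Rightarrow> 'v) \<Rightarrow> (int list \<Rightarrow> 'v)" where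
  "extend_const n m v0 f = (\<lambda>x\<in>verts (int_lattice n).
     if x \<in> verts (int_box (replicate n m)) then f x else v0)"

section \<open>Discrete cubical homology\<close>

definition std_cube :: "nat \<Rightarrow> int list ugraph" where
  "std_cube n = int_box (replicate n 1)"

definition cubes :: "nat \<Rightarrow> 'v ugraph \<Rightarrow> (int list \<Rightarrow> 'v) set" where
  "cubes n G = graph_maps (std_cube n) G"

text \<open>\<open>cube_face n i e s\<close> is the face of the \<open>n\<close>-cube \<open>s\<close> obtained by inserting \<open>e\<close> as the \<open>i\<close>-th
  coordinate, where \<open>1 \<le> i \<le> n\<close>; the negative face has \<open>e = 0\<close>, the positive one \<open>e = 1\<close>.\<close>

definition cube_face :: "nat \<Rightarrow> nat \<Rightarrow> int \<Rightarrow> (int list \<Rightarrow> 'v) \<Rightarrow> (int list \<Rightarrow> 'v)" where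
  "cube_face n i e s = (\<lambda>a\<in>verts (std_cube (n - 1)). s (take (i - 1) a @ e # drop (i - 1) a))"

definition degenerate_cubes :: "nat \<Rightarrow> 'v ugraph \<Rightarrow> (int list \<Rightarrow> 'v) set" where
  "degenerate_cubes n G = {s \<in> cubes n G. \<exists>i\<in>{1..n}. cube_face n i 0 s = cube_face n i 1 s}"

definition free_chains :: "nat \<Rightarrow> 'v ugraph \<Rightarrow> ((int list \<Rightarrow> 'v) \<Rightarrow>\<^sub>0 int) monoid" where
  "free_chains n G = free_Abelian_group (cubes n G)"

definition degenerate_chains :: "nat \<Rightarrow> 'v ugraph \<Rightarrow> ((int list \<Rightarrow> 'v) \<Rightarrow>\<^sub>0 int) set" where
  "degenerate_chains n G = generate (free_chains n G) (frag_of ` degenerate_cubes n G)"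

definition chain_gp :: "nat \<Rightarrow> 'v ugraph \<Rightarrow> ((int list \<Rightarrow> 'v) \<Rightarrow>\<^sub>0 int) set monoid" where
  "chain_gp n G = free_chains n G Mod degenerate_chains n G"

definition chain_class ::
  "nat \<Rightarrow> 'v ugraph \<Rightarrow> ((int list \<Rightarrow> 'v) \<Rightarrow>\<^sub>0 int) \<Rightarrow> ((int list \<Rightarrow> 'v) \<Rightarrow>\<^sub>0 int) set" where
  "chain_class n G c = degenerate_chains n G #>\<^bsub>free_chains n G\<^esub> c"

definition free_boundary ::
  "nat \<Rightarrow> ((int list \<Rightarrow> 'v) \<Rightarrow>\<^sub>0 int) \<Rightarrow> ((int list \<Rightarrow> 'v) \<Rightarrow>\<^sub>0 int)" where
  "free_boundary n = frag_extend (\<lambda>s. \<Sum>i = 1..n.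
     frag_cmul ((-1) ^ i) (frag_of (cube_face n i 0 s) - frag_of (cube_face n i 1 s)))"

text \<open>Maps out of quotient groups are given on a coset as the union of the cosets of the images of
  its elements; this union is a single coset when the map descends to the quotient.
  In degree \<open>0\<close> the boundary is zero and \<open>n - 1\<close> is \<open>0\<close>, so every element is a cycle.\<close>

definition boundary ::
  "nat \<Rightarrow> 'v ugraph \<Rightarrow> ((int list \<Rightarrow> 'v) \<Rightarrow>\<^sub>0 int) set \<Rightarrow> ((int list \<Rightarrow> 'v) \<Rightarrow>\<^sub>0 int) set" where
  "boundary n G X = (\<Union>c\<in>X. chain_class (n - 1) G (free_boundary n c))"

definition cycle_gp :: "nat \<Rightarrow> 'v ugraph \<Rightarrow> ((int list \<Rightarrow> 'v) \<Rightarrow>\<^sub>0 int) set monoid" where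
  "cycle_gp n G =
     (chain_gp n G)\<lparr>carrier := kernel (chain_gp n G) (chain_gp (n - 1) G) (boundary n G)\<rparr>"

definition boundaries :: "nat \<Rightarrow> 'v ugraph \<Rightarrow> ((int list \<Rightarrow> 'v) \<Rightarrow>\<^sub>0 int) set set" where
  "boundaries n G = boundary (Suc n) G ` carrier (chain_gp (Suc n) G)"

definition homology_gp :: "nat \<Rightarrow> 'v ugraph \<Rightarrow> ((int list \<Rightarrow> 'v) \<Rightarrow>\<^sub>0 int) set set monoid" where
  "homology_gp n G = cycle_gp n G Mod boundaries n G"

definition homology_class ::
  "nat \<Rightarrow> 'v ugraph \<Rightarrow> ((int list \<Rightarrow> 'v) \<Rightarrow>\<^sub>0 int) set \<Rightarrow> ((int list \<Rightarrow> 'v) \<Rightarrow>\<^sub>0 int) set set" where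
  "homology_class n G z = boundaries n G #>\<^bsub>cycle_gp n G\<^esub> z"

definition chain_gp_map ::
  "nat \<Rightarrow> 'w ugraph \<Rightarrow> ('v \<Rightarrow> 'w) \<Rightarrow>
     ((int list \<Rightarrow> 'v) \<Rightarrow>\<^sub>0 int) set \<Rightarrow> ((int list \<Rightarrow> 'w) \<Rightarrow>\<^sub>0 int) set" where
  "chain_gp_map n G' F X =
     (\<Union>c\<in>X. chain_class n G'
        (frag_extend (\<lambda>s. frag_of (compose (verts (std_cube n)) F s)) c))"

definition homology_gp_map ::
  "nat \<Rightarrow> 'w ugraph \<Rightarrow> ('v \<Rightarrow> 'w) \<Rightarrow>
     ((int list \<Rightarrow> 'v) \<Rightarrow>\<^sub>0 int) set set \<Rightarrow> ((int list \<Rightarrow> 'w) \<Rightarrow>\<^sub>0 int) set set" where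
  "homology_gp_map n G' F Z = (\<Union>z\<in>Z. homology_class n G' (chain_gp_map n G' F z))"

section \<open>The Hurewicz map\<close>

definition subcube :: "nat \<Rightarrow> (int list \<Rightarrow> 'v) \<Rightarrow> int list \<Rightarrow> (int list \<Rightarrow> 'v)" where
  "subcube n f x = (\<lambda>y\<in>verts (std_cube n). f (map2 (+) x y))"

text \<open>Used only for lists \<open>ms\<close> of positive side lengths.\<close>

definition phi ::
  "nat list \<Rightarrow> 'v ugraph \<Rightarrow> (int list \<Rightarrow> 'v) \<Rightarrow> ((int list \<Rightarrow> 'v) \<Rightarrow>\<^sub>0 int) set" where
  "phi ms G f = chain_class (length ms) G
     (\<Sum>x\<in>verts (int_box (map (\<lambda>m. m - 1) ms)). frag_of (subcube (length ms) f x))"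

text \<open>The value of \<open>psi\<close> at a class is the common homology class of \<open>phi f\<close> over all representatives
  \<open>f\<close> that are defined on some \<open>n\<close>-fold product of paths.\<close>

definition psi ::
  "nat \<Rightarrow> 'v ugraph \<Rightarrow> 'v \<Rightarrow> (int list \<Rightarrow> 'v) set \<Rightarrow> ((int list \<Rightarrow> 'v) \<Rightarrow>\<^sub>0 int) set set" where
  "psi n G v0 X = (THE Z. \<exists>m\<ge>1. \<exists>f\<in>cube_based_maps n m G v0.
     X = htpy_class n G v0 (extend_const n m v0 f) \<and>
     Z = homology_class n G (phi (replicate n m) G f))"

end

theory Submission
  imports Defs
begin

text \<open>
  Two based maps are homotopic iff they are joined by finitely many based maps, consecutive ones being
  pointwise equal or adjacent. One such step from \<open>f\<close> to \<open>g\<close> is a graph map on a lattice of one dimension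
  more, and the sum of its cubes over a large box has boundary \<open>\<plusminus>(\<phi>(g) - \<phi>(f))\<close>: the sum over a box
  telescopes in each direction, and the faces on which everything is constant cancel in pairs. The same
  telescoping shows that \<open>\<phi>(f)\<close> is a cycle.

  For the second part, \<open>n\<close>-spheres are obtained from two points by iterated suspension. A suspension of
  length \<open>M\<close> is the union of the two cones obtained by removing a pole. A cube of dimension less than \<open>M\<close>
  cannot meet both poles, so the Mayer--Vietoris argument works without subdivision and reduces the
  degree of an \<open>(n + 1)\<close>-cycle on the suspension to the degree of an \<open>n\<close>-cycle. The suspension of a based
  map of degree \<open>\<plusminus>1\<close> has degree \<open>\<plusminus>1\<close>, so every cycle is homologous to a multiple of a spherical one. Varying
  the length of the last suspension gives infinitely many graphs.
\<close>

section \<open>Lattices and cubes\<close>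

text \<open>The induction over spheres has to start in degree 0, where no cube is degenerate and a
  single vertex is not acyclic. Hence the chain of a based map is normalised by constant cubes, and
  the degree is asked to detect homology on reduced cycles only. The starting graph, two isolated
  points, is not connected, so \<open>graph_suspension\<close> asks for less than
  \<open>is_graph\<close>; a suspension is connected through its poles.

  The product of homotopy classes is written with radii, and these jump in the course of a homotopy.
  It is therefore compared with a join whose cut and translation are free and do not affect the
  class.

  Along the suspensions not the homology groups are carried but a degree: an additive function on
  chains that detects bounding, together with one based map of degree 1 or -1. Surjectivity and
  nontriviality follow from this, and it passes from \<open>n\<close> to \<open>Suc n\<close> if the
  length exceeds \<open>n + 2\<close>: a chain bounding an (n + 1)-cycle consists of (n + 2)-cubes
  and must be split at the poles as well.\<close>

fun lattice_adj :: "int list \<Rightarrow> int list \<Rightarrow> bool" where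
  "lattice_adj (a # x) (b # y) \<longleftrightarrow> \<bar>a - b\<bar> = 1 \<and> x = y \<or> a = b \<and> lattice_adj x y"
| "lattice_adj _ _ \<longleftrightarrow> False"

lemma lattice_adj_Nil [simp]: "\<not> lattice_adj x []"
  by (cases x) auto

lemma lattice_adj_length: "lattice_adj x y \<Longrightarrow> length x = length y"
  by (induction x y rule: lattice_adj.induct) auto

lemma lattice_adj_sym: "lattice_adj x y \<Longrightarrow> lattice_adj y x"
  by (induction x y rule: lattice_adj.induct) auto

text \<open>The recursive form lets later facts about coordinates go by induction on lists; this is
  the bridge to the coordinatewise edges of \<open>cart_prod_list\<close>.\<close>

lemma lattice_adj_conv_nth:
  assumes "length x = length y"
  shows "lattice_adj x y \<longleftrightarrow>
    (\<exists>i<length x. \<bar>x ! i - y ! i\<bar> = 1 \<and> (\<forall>j<length x. j \<noteq> i \<longrightarrow> x ! j = y ! j))"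
  using assms
proof (induction x y rule: list_induct2)
  case (Cons a x b y)
  define P where "P i \<longleftrightarrow> \<bar>(a # x) ! i - (b # y) ! i\<bar> = 1 \<and>
     (\<forall>j<length (a # x). j \<noteq> i \<longrightarrow> (a # x) ! j = (b # y) ! j)" for i
  have "(\<forall>j<length x. x ! j = y ! j) \<longleftrightarrow> x = y"
    using Cons.hyps nth_equalityI by blast
  then have 0: "P 0 \<longleftrightarrow> \<bar>a - b\<bar> = 1 \<and> x = y"
    unfolding P_def length_Cons All_less_Suc2 by simp
  have S: "P (Suc i) \<longleftrightarrow> a = b \<and> \<bar>x ! i - y ! i\<bar> = 1 \<and> (\<forall>j<length x. j \<noteq> i \<longrightarrow> x ! j = y ! j)" for i
    unfolding P_def length_Cons All_less_Suc2 by (simp only: nth_Cons_0 nth_Cons_Suc) blast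
  have "(\<exists>i<length (a # x). P i) \<longleftrightarrow> P 0 \<or> (\<exists>i<length x. P (Suc i))"
    unfolding length_Cons by (rule Ex_less_Suc2)
  also have "\<dots> \<longleftrightarrow> lattice_adj (a # x) (b # y)"
    unfolding 0 S lattice_adj.simps Cons.IH by blast
  finally show ?case unfolding P_def by (rule sym)
qed auto

lemma verts_int_lattice: "verts (int_lattice n) = {x. length x = n}"
  by (auto simp: int_lattice_def cart_prod_list_def int_line_def)

lemma verts_int_box:
  "verts (int_box ms) = {x. length x = length ms \<and> (\<forall>i<length ms. 0 \<le> x ! i \<and> x ! i \<le> int (ms ! i))}"
  by (auto simp: int_box_def int_path_def induced_def cart_prod_list_def int_line_def)

lemma adj_eq_int_lattice:
  "length x = n \<Longrightarrow> length y = n \<Longrightarrow> adj_eq (int_lattice n) x y \<longleftrightarrow> x = y \<or> lattice_adj x y"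
  by (auto simp: adj_eq_def int_lattice_def cart_prod_list_def int_line_def lattice_adj_conv_nth)

lemma adj_eq_int_box:
  assumes "x \<in> verts (int_box ms)" "y \<in> verts (int_box ms)"
  shows "adj_eq (int_box ms) x y \<longleftrightarrow> x = y \<or> lattice_adj x y"
proof -
  have "(x, y) \<in> edges (int_box ms) \<longleftrightarrow> lattice_adj x y"
    using assms
    by (auto simp: verts_int_box int_box_def int_path_def induced_def
        cart_prod_list_def int_line_def lattice_adj_conv_nth)
  then show ?thesis by (simp add: adj_eq_def)
qed

lemma graph_maps_int_box:
  "f \<in> graph_maps (int_box ms) G \<longleftrightarrow> f \<in> extensional (verts (int_box ms)) \<and>
     (\<forall>x\<in>verts (int_box ms). f x \<in> verts G) \<and>
     (\<forall>x\<in>verts (int_box ms). \<forall>y\<in>verts (int_box ms). lattice_adj x y \<longrightarrow> adj_eq G (f x) (f y))"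
  unfolding graph_maps_def PiE_iff
  by (auto simp: adj_eq_int_box) (auto simp: adj_eq_def)

section \<open>Cubes and their faces\<close>

abbreviation cube_verts :: "nat \<Rightarrow> int list set" where
  "cube_verts n \<equiv> verts (std_cube n)"

lemma cube_verts_eq: "cube_verts n = {a. length a = n \<and> set a \<subseteq> {0, 1}}"
proof -
  have "(0 \<le> b \<and> b \<le> 1) \<longleftrightarrow> b \<in> {0, 1}" for b :: int by auto
  then show ?thesis
    by (auto simp: std_cube_def verts_int_box subset_iff in_set_conv_nth)
qed

lemma cube_verts_0 [simp]: "cube_verts 0 = {[]}"
  by (auto simp: cube_verts_eq)

lemma Cons_in_cube_verts [simp]:
  "b # a \<in> cube_verts (Suc n) \<longleftrightarrow> b \<in> {0, 1} \<and> a \<in> cube_verts n"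
  by (auto simp: cube_verts_eq)

lemma length_cube_verts: "a \<in> cube_verts n \<Longrightarrow> length a = n"
  by (simp add: cube_verts_eq)

lemma cube_verts_SucE:
  assumes "a \<in> cube_verts (Suc n)"
  obtains b c where "a = b # c" "b = 0 \<or> b = 1" "c \<in> cube_verts n"
  using assms by (cases a) (auto simp: cube_verts_eq)

lemma cubes_iff:
  "s \<in> cubes n G \<longleftrightarrow> s \<in> extensional (cube_verts n) \<and> (\<forall>a\<in>cube_verts n. s a \<in> verts G) \<and>
     (\<forall>a\<in>cube_verts n. \<forall>b\<in>cube_verts n. lattice_adj a b \<longrightarrow> adj_eq G (s a) (s b))"
  unfolding cubes_def std_cube_def by (rule graph_maps_int_box)

lemma cube_eqI:
  "s \<in> extensional (cube_verts n) \<Longrightarrow> t \<in> extensional (cube_verts n) \<Longrightarrow>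
    (\<And>a. a \<in> cube_verts n \<Longrightarrow> s a = t a) \<Longrightarrow> s = t"
  by (rule extensionalityI)

text \<open>Positions are counted from 0, so inserting at \<open>k\<close> belongs to the face with
  index \<open>Suc k\<close>.\<close>

definition insert_at :: "nat \<Rightarrow> 'a \<Rightarrow> 'a list \<Rightarrow> 'a list" where
  "insert_at k t a = take k a @ t # drop k a"

lemma insert_at_0 [simp]: "insert_at 0 t a = t # a"
  by (simp add: insert_at_def)

lemma insert_at_Suc [simp]: "insert_at (Suc k) t (b # a) = b # insert_at k t a"
  by (simp add: insert_at_def)

lemma length_insert_at [simp]: "length (insert_at k t a) = Suc (length a)"
  by (simp add: insert_at_def)

lemma set_insert_at [simp]: "set (insert_at k t a) = insert t (set a)"
  by (metis append_take_drop_id insert_at_def list.simps(15) set_append Un_insert_right)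

lemma insert_at_in_cube_verts [simp]:
  "insert_at k t a \<in> cube_verts (Suc n) \<longleftrightarrow> t \<in> {0, 1} \<and> a \<in> cube_verts n"
  by (auto simp: cube_verts_eq)

lemma lattice_adj_insert_at:
  "lattice_adj a b \<Longrightarrow> k \<le> length a \<Longrightarrow> lattice_adj (insert_at k t a) (insert_at k t b)"
proof (induction k arbitrary: a b)
  case (Suc k)
  then show ?case by (cases a; cases b) auto
qed auto

lemma insert_at_commute:
  "j \<le> k \<Longrightarrow> k \<le> length a \<Longrightarrow>
    insert_at j t (insert_at k u a) = insert_at (Suc k) u (insert_at j t a)"
proof (induction j arbitrary: k a)
  case (Suc j)
  then show ?case by (cases k; cases a) auto
qed auto

lemma cube_face_eq: "cube_face (Suc n) (Suc k) e s = (\<lambda>a\<in>cube_verts n. s (insert_at k e a))"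
  by (simp add: cube_face_def insert_at_def)

lemma cube_face_extensional: "cube_face (Suc n) (Suc k) e s \<in> extensional (cube_verts n)"
  by (simp add: cube_face_eq)

lemma cube_face_apply:
  "a \<in> cube_verts n \<Longrightarrow> cube_face (Suc n) (Suc k) e s a = s (insert_at k e a)"
  by (simp add: cube_face_eq)

lemma cube_face_in_cubes:
  assumes "s \<in> cubes (Suc n) G" "k \<le> n" "e \<in> {0, 1}"
  shows "cube_face (Suc n) (Suc k) e s \<in> cubes n G"
  using assms by (auto simp: cubes_iff cube_face_eq length_cube_verts lattice_adj_insert_at)

text \<open>The cubical identities. They are equations between arbitrary functions on cubes; the
  vanishing of the squared boundary and the degeneracy of faces of degenerate cubes rest on
  them.\<close>

lemma cube_face_commute:
  assumes "j \<le> k" "k \<le> n" "t \<in> {0, 1}" "u \<in> {0, 1}"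
  shows "cube_face (Suc n) (Suc j) t (cube_face (Suc (Suc n)) (Suc (Suc k)) u s)
       = cube_face (Suc n) (Suc k) u (cube_face (Suc (Suc n)) (Suc j) t s)"
  using assms
  by (intro cube_eqI[OF cube_face_extensional cube_face_extensional])
    (auto simp: cube_face_apply insert_at_commute length_cube_verts)

section \<open>The cubical boundary operator\<close>

type_synonym 'v cube_chain = "(int list \<Rightarrow> 'v) \<Rightarrow>\<^sub>0 int"

definition cube_boundary :: "nat \<Rightarrow> (int list \<Rightarrow> 'v) \<Rightarrow> 'v cube_chain" where
  "cube_boundary n s = (\<Sum>k<n. frag_cmul ((-1) ^ Suc k)
     (frag_of (cube_face n (Suc k) 0 s) - frag_of (cube_face n (Suc k) 1 s)))"

lemma free_boundary_eq:
  "free_boundary n = frag_extend (cube_boundary n :: (int list \<Rightarrow> 'v) \<Rightarrow> _)"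
proof -
  have "(\<lambda>s :: int list \<Rightarrow> 'v. \<Sum>i = 1..n. frag_cmul ((-1) ^ i)
      (frag_of (cube_face n i 0 s) - frag_of (cube_face n i 1 s))) = cube_boundary n"
    unfolding cube_boundary_def
  proof
    fix s :: "int list \<Rightarrow> 'v"
    show "(\<Sum>i = 1..n. frag_cmul ((-1) ^ i)
        (frag_of (cube_face n i 0 s) - frag_of (cube_face n i 1 s))) =
      (\<Sum>k<n. frag_cmul ((-1) ^ Suc k)
        (frag_of (cube_face n (Suc k) 0 s) - frag_of (cube_face n (Suc k) 1 s)))"
      unfolding One_nat_def by (rule sum.atLeast1_atMost_eq)
  qed
  then show ?thesis unfolding free_boundary_def by (simp only:)
qed

lemma free_boundary_0 [simp]: "free_boundary 0 c = 0"
  unfolding free_boundary_eq by (rule frag_extend_eq_0) (simp add: cube_boundary_def)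

lemma free_boundary_zero [simp]: "free_boundary n 0 = 0"
  by (simp add: free_boundary_eq)

lemma free_boundary_of: "free_boundary n (frag_of s) = cube_boundary n s"
  by (simp add: free_boundary_eq)

lemma free_boundary_diff: "free_boundary n (c - d) = free_boundary n c - free_boundary n d"
  by (simp add: free_boundary_eq frag_extend_diff)

lemma free_boundary_add: "free_boundary n (c + d) = free_boundary n c + free_boundary n d"
  by (simp add: free_boundary_eq frag_extend_add)

lemma free_boundary_minus: "free_boundary n (- c) = - free_boundary n c"
  by (simp add: free_boundary_eq frag_extend_minus)

lemma free_boundary_cmul: "free_boundary n (frag_cmul k c) = frag_cmul k (free_boundary n c)"
  by (simp add: free_boundary_eq frag_extend_cmul)

lemma free_boundary_sum:
  "free_boundary n (\<Sum>i\<in>I. c i) = (\<Sum>i\<in>I. free_boundary n (c i))"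
  by (induction I rule: infinite_finite_induct) (auto simp: free_boundary_add)

text \<open>The pairs \<open>k \<le> j\<close> cancel against the pairs \<open>j < k\<close> via \<open>(k, j) \<mapsto> (Suc j, k)\<close>.\<close>

lemma alternating_face_sum:
  fixes B :: "nat \<Rightarrow> nat \<Rightarrow> 'x \<Rightarrow>\<^sub>0 int"
  assumes "\<And>j k. j \<le> k \<Longrightarrow> k < n \<Longrightarrow> B (Suc k) j = B j k"
  shows "(\<Sum>k<Suc n. \<Sum>j<n. frag_cmul ((-1) ^ (k + j)) (B k j)) = 0"
proof -
  define g where "g = (\<lambda>(k, j). frag_cmul ((-1) ^ (k + j)) (B k j))"
  define L where "L = {(k, j). k \<le> j \<and> j < n}"
  define U where "U = (\<lambda>(k, j). (Suc j, k)) ` L"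
  have LU: "{..<Suc n} \<times> {..<n} = L \<union> U" "L \<inter> U = {}"
  proof -
    have "(k, j) \<in> U \<longleftrightarrow> j < k \<and> k < Suc n" for k j
      unfolding U_def L_def image_iff by (cases k) auto
    then show "{..<Suc n} \<times> {..<n} = L \<union> U" "L \<inter> U = {}"
      unfolding L_def by auto
  qed
  have "finite (L \<union> U)"
    unfolding LU(1)[symmetric] by (intro finite_cartesian_product finite_lessThan)
  then have fin: "finite L" "finite U" by blast+
  have "sum g U = (\<Sum>p\<in>L. g (case p of (k, j) \<Rightarrow> (Suc j, k)))"
    unfolding U_def by (rule sum.reindex_cong[OF _ refl refl]) (auto simp: inj_on_def)
  also have "\<dots> = (\<Sum>p\<in>L. - g p)"
  proof (rule sum.cong[OF refl])
    fix p assume "p \<in> L"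
    then obtain k j where p: "p = (k, j)" "k \<le> j" "j < n" by (auto simp: L_def)
    then show "g (case p of (k, j) \<Rightarrow> (Suc j, k)) = - g p"
      using assms[of k j] by (simp add: g_def add.commute)
  qed
  finally have "sum g L + sum g U = 0" by (simp add: sum_negf)
  moreover have "(\<Sum>k<Suc n. \<Sum>j<n. frag_cmul ((-1) ^ (k + j)) (B k j)) = sum g ({..<Suc n} \<times> {..<n})"
    unfolding g_def by (rule sum.cartesian_product)
  ultimately show ?thesis
    unfolding LU(1) sum.union_disjoint[OF fin LU(2)] by (simp only:)
qed

text \<open>The cancellation takes place in the free group, before degenerate cubes are divided out,
  since it uses nothing but the cubical identities.\<close>

lemma free_boundary_cube_boundary: "free_boundary n (cube_boundary (Suc n) s) = 0"
proof -
  define F where "F k e = cube_face (Suc n) (Suc k) e s" for k e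
  define A where "A k j e e' = frag_of (cube_face n (Suc j) e' (F k e))" for k j e e'
  \<comment> \<open>The four double faces in the directions \<open>k\<close> and \<open>j\<close>.
    The signs of the ends go into \<open>B\<close>, those of the directions stay outside, as
    \<open>alternating_face_sum\<close> expects.\<close>
  define B where "B k j = A k j 0 0 - A k j 0 1 - A k j 1 0 + A k j 1 1" for k j
  have sgn: "frag_cmul ((-1) ^ Suc k) (frag_cmul ((-1) ^ Suc j) (a - b) - frag_cmul ((-1) ^ Suc j) (c - d))
      = frag_cmul ((-1) ^ (k + j)) (a - b - c + d)" for k j and a b c d :: "'a cube_chain"
    by (rule poly_mapping_eqI) (simp add: lookup_minus lookup_add power_add algebra_simps)
  have "free_boundary n (cube_boundary (Suc n) s)
      = (\<Sum>k<Suc n. \<Sum>j<n. frag_cmul ((-1) ^ (k + j)) (B k j))"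
    unfolding cube_boundary_def[of "Suc n"] free_boundary_sum
  proof (intro sum.cong refl)
    fix k
    have "free_boundary n (frag_cmul ((- 1) ^ Suc k) (frag_of (F k 0) - frag_of (F k 1)))
      = frag_cmul ((- 1) ^ Suc k)
         ((\<Sum>j<n. frag_cmul ((- 1) ^ Suc j) (A k j 0 0 - A k j 0 1))
        - (\<Sum>j<n. frag_cmul ((- 1) ^ Suc j) (A k j 1 0 - A k j 1 1)))"
      unfolding free_boundary_cmul free_boundary_diff free_boundary_of cube_boundary_def A_def by (rule refl)
    also have "\<dots> = (\<Sum>j<n. frag_cmul ((-1) ^ (k + j)) (B k j))"
      unfolding B_def sgn[symmetric] frag_cmul_sum sum_subtractf[symmetric] by (rule refl)
    finally show "free_boundary n (frag_cmul ((- 1) ^ Suc k) (frag_of (cube_face (Suc n) (Suc k) 0 s) -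
            frag_of (cube_face (Suc n) (Suc k) 1 s)))
        = (\<Sum>j<n. frag_cmul ((-1) ^ (k + j)) (B k j))"
      unfolding F_def .
  qed
  also have "\<dots> = 0"
  proof (rule alternating_face_sum)
    fix j k assume jk: "j \<le> k" "k < n"
    then obtain m where m: "n = Suc m" "k \<le> m" by (cases n) auto
    have "A (Suc k) j e e' = A j k e' e" if "e \<in> {0, 1}" "e' \<in> {0, 1}" for e e'
      unfolding A_def F_def m(1) by (simp only: cube_face_commute[OF jk(1) m(2) that(2,1)])
    \<comment> \<open>Exchanging the two faces swaps \<open>e\<close> and \<open>e'\<close>; the two
      mixed terms of \<open>B\<close> have the same sign, so \<open>B\<close> does not
      notice.\<close>
    then show "B (Suc k) j = B j k" by (simp add: B_def)
  qed
  finally show ?thesis .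
qed

lemma free_boundary_boundary: "free_boundary n (free_boundary (Suc n) c) = 0"
  using subset_UNIV
proof (induction c rule: frag_induction)
  case (one s)
  then show ?case by (simp only: free_boundary_of free_boundary_cube_boundary)
next
  case (diff a b)
  then show ?case by (simp only: free_boundary_diff diff_self)
qed simp

section \<open>Chains, degenerate chains and homotopy invariance\<close>

definition frags :: "'a set \<Rightarrow> ('a \<Rightarrow>\<^sub>0 int) set" where
  "frags S = {c. Poly_Mapping.keys c \<subseteq> S}"

lemma frags_zero [simp]: "0 \<in> frags S"
  by (simp add: frags_def)

lemma frags_diff: "a \<in> frags S \<Longrightarrow> b \<in> frags S \<Longrightarrow> a - b \<in> frags S"
  unfolding frags_def using keys_diff[of a b] by blast

lemma frags_add: "a \<in> frags S \<Longrightarrow> b \<in> frags S \<Longrightarrow> a + b \<in> frags S"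
  unfolding frags_def using keys_add[of a b] by blast

lemma frags_minus [simp]: "- a \<in> frags S \<longleftrightarrow> a \<in> frags S"
  by (simp add: frags_def)

lemma frags_cmul: "a \<in> frags S \<Longrightarrow> frag_cmul k a \<in> frags S"
  unfolding frags_def using keys_cmul[of k a] by blast

lemma frags_sum: "(\<And>i. i \<in> I \<Longrightarrow> c i \<in> frags S) \<Longrightarrow> (\<Sum>i\<in>I. c i) \<in> frags S"
  unfolding frags_def using keys_sum[of c I] by blast

lemma frags_of [simp]: "frag_of s \<in> frags S \<longleftrightarrow> s \<in> S"
  by (simp add: frags_def)

lemma frags_mono: "S \<subseteq> T \<Longrightarrow> c \<in> frags S \<Longrightarrow> c \<in> frags T"
  by (auto simp: frags_def)

lemma frags_extend:
  "c \<in> frags S \<Longrightarrow> (\<And>s. s \<in> S \<Longrightarrow> f s \<in> frags T) \<Longrightarrow> frag_extend f c \<in> frags T"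
  unfolding frags_def using keys_frag_extend[of f c] by blast

text \<open>Additivity is asked in the form of differences because \<open>frag_induction\<close>
  builds chains from generators by differences.\<close>

lemma frag_eqI:
  assumes "c \<in> frags S" "f 0 = (0 :: 'b :: ab_group_add)" "g 0 = 0"
    and "\<And>s. s \<in> S \<Longrightarrow> f (frag_of s) = g (frag_of s)"
    and "\<And>a b. f (a - b) = f a - f b" "\<And>a b. g (a - b) = g a - g b"
  shows "f c = g c"
proof -
  have "Poly_Mapping.keys c \<subseteq> S" using assms(1) by (simp add: frags_def)
  then show ?thesis
    by (induction c rule: frag_induction) (simp_all only: assms(2-6))
qed

text \<open>No graph occurs: degeneracy is a property of the function alone. One group of degenerate
  chains thus serves a graph and all its subgraphs.\<close>

definition degenerate :: "nat \<Rightarrow> (int list \<Rightarrow> 'v) \<Rightarrow> bool" where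
  "degenerate n s \<longleftrightarrow> (\<exists>k<n. cube_face n (Suc k) 0 s = cube_face n (Suc k) 1 s)"

abbreviation cube_chains :: "nat \<Rightarrow> 'v ugraph \<Rightarrow> 'v cube_chain set" where
  "cube_chains n G \<equiv> frags (cubes n G)"

abbreviation degens :: "nat \<Rightarrow> 'v cube_chain set" where
  "degens n \<equiv> frags (Collect (degenerate n))"

lemma degens_0: "(c :: 'a cube_chain) \<in> degens 0 \<longleftrightarrow> c = 0"
proof -
  have "Collect (degenerate 0 :: (int list \<Rightarrow> 'a) \<Rightarrow> bool) = {}" by (simp add: degenerate_def)
  then show ?thesis by (simp only: frags_def mem_Collect_eq subset_empty keys_eq_empty)
qed

lemma free_boundary_chains:
  assumes "c \<in> cube_chains (Suc n) G"
  shows "free_boundary (Suc n) c \<in> cube_chains n G"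
  unfolding free_boundary_eq using assms
proof (rule frags_extend)
  fix s assume "s \<in> cubes (Suc n) G"
  then show "cube_boundary (Suc n) s \<in> cube_chains n G"
    unfolding cube_boundary_def
    by (intro frags_sum frags_cmul frags_diff) (auto intro: cube_face_in_cubes)
qed

text \<open>Removing another coordinate keeps the degenerate direction; its index drops by one
  exactly when it comes after the removed one.\<close>

lemma degenerate_cube_face:
  assumes k: "k \<le> Suc m" "cube_face (Suc (Suc m)) (Suc k) 0 s = cube_face (Suc (Suc m)) (Suc k) 1 s"
    and j: "j \<le> Suc m" "j \<noteq> k" "e \<in> {0, 1}"
  shows "degenerate (Suc m) (cube_face (Suc (Suc m)) (Suc j) e s)"
proof (cases "j < k")
  case True
  then obtain k' where k': "k = Suc k'" "j \<le> k'" "k' \<le> m" using k by (cases k) auto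
  have "cube_face (Suc m) (Suc k') t (cube_face (Suc (Suc m)) (Suc j) e s)
      = cube_face (Suc m) (Suc j) e (cube_face (Suc (Suc m)) (Suc k) t s)" if "t \<in> {0, 1}" for t
    unfolding k' using k' j that by (intro cube_face_commute[symmetric]) auto
  then show ?thesis unfolding degenerate_def using k' k(2) by (intro exI[of _ k']) auto
next
  case False
  then obtain j' where j': "j = Suc j'" "k \<le> j'" "j' \<le> m" using j by (cases j) auto
  have "cube_face (Suc m) (Suc k) t (cube_face (Suc (Suc m)) (Suc j) e s)
      = cube_face (Suc m) (Suc j') e (cube_face (Suc (Suc m)) (Suc k) t s)" if "t \<in> {0, 1}" for t
    unfolding j' using j' j that by (intro cube_face_commute) auto
  then show ?thesis unfolding degenerate_def using j' k(2) by (intro exI[of _ k]) auto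
qed

text \<open>In the degenerate direction the two faces cancel; in the other directions they are
  degenerate themselves.\<close>

lemma free_boundary_degens:
  assumes "c \<in> degens (Suc n)"
  shows "free_boundary (Suc n) c \<in> degens n"
  unfolding free_boundary_eq using assms
proof (rule frags_extend)
  fix s :: "int list \<Rightarrow> 'a" assume "s \<in> Collect (degenerate (Suc n))"
  then obtain k where k: "k \<le> n" "cube_face (Suc n) (Suc k) 0 s = cube_face (Suc n) (Suc k) 1 s"
    by (auto simp: degenerate_def less_Suc_eq_le)
  show "cube_boundary (Suc n) s \<in> degens n"
    unfolding cube_boundary_def
  proof (intro frags_sum frags_cmul)
    fix j assume "j \<in> {..<Suc n}"
    then have j: "j \<le> n" by simp
    show "frag_of (cube_face (Suc n) (Suc j) 0 s) - frag_of (cube_face (Suc n) (Suc j) 1 s) \<in> degens n"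
    proof (cases "j = k")
      case False
      then obtain m where "n = Suc m" using k j by (cases n) auto
      then show ?thesis
        using k j False by (intro frags_diff) (auto intro: degenerate_cube_face)
    qed (simp add: k)
  qed
qed

lemma free_boundary_degens': "c \<in> degens n \<Longrightarrow> free_boundary n c \<in> degens (n - 1)"
  by (cases n) (auto intro: free_boundary_degens)

text \<open>Homology on the level of representatives: chains stay in the free group and are compared
  modulo \<open>degens\<close>. Quotient groups return only when the results are
  transferred.\<close>

definition null_homologous :: "nat \<Rightarrow> 'v ugraph \<Rightarrow> 'v cube_chain \<Rightarrow> bool" where
  "null_homologous n G c \<longleftrightarrow> (\<exists>u\<in>cube_chains (Suc n) G. c - free_boundary (Suc n) u \<in> degens n)"

definition cycles :: "nat \<Rightarrow> 'v ugraph \<Rightarrow> 'v cube_chain set" where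
  "cycles n G = {c \<in> cube_chains n G. free_boundary n c \<in> degens (n - 1)}"

lemma cycles_0: "cycles 0 G = cube_chains 0 G"
  by (simp add: cycles_def)

lemma cycles_diff: "a \<in> cycles n G \<Longrightarrow> b \<in> cycles n G \<Longrightarrow> a - b \<in> cycles n G"
  by (simp add: cycles_def frags_diff free_boundary_diff)

lemma cycles_add: "a \<in> cycles n G \<Longrightarrow> b \<in> cycles n G \<Longrightarrow> a + b \<in> cycles n G"
  by (simp add: cycles_def frags_add free_boundary_add)

lemma degens_cycles: "c \<in> cube_chains n G \<Longrightarrow> c \<in> degens n \<Longrightarrow> c \<in> cycles n G"
  unfolding cycles_def by (blast intro: free_boundary_degens')

lemma boundary_cycles: "c \<in> cube_chains (Suc n) G \<Longrightarrow> free_boundary (Suc n) c \<in> cycles n G"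
proof (cases n)
  case (Suc m)
  then show "c \<in> cube_chains (Suc n) G \<Longrightarrow> free_boundary (Suc n) c \<in> cycles n G"
    by (simp add: cycles_def free_boundary_chains free_boundary_boundary)
qed (simp add: cycles_def free_boundary_chains)

lemma null_homologous_degens: "c \<in> degens n \<Longrightarrow> null_homologous n G c"
  unfolding null_homologous_def by (intro bexI[of _ 0]) auto

lemma null_homologous_boundary: "u \<in> cube_chains (Suc n) G \<Longrightarrow> null_homologous n G (free_boundary (Suc n) u)"
  unfolding null_homologous_def by (intro bexI[of _ u]) auto

lemma null_homologous_diff:
  assumes "null_homologous n G a" "null_homologous n G b"
  shows "null_homologous n G (a - b)"
proof -
  obtain u v where "u \<in> cube_chains (Suc n) G" "a - free_boundary (Suc n) u \<in> degens n"
    "v \<in> cube_chains (Suc n) G" "b - free_boundary (Suc n) v \<in> degens n"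
    using assms unfolding null_homologous_def by blast
  moreover have "a - b - free_boundary (Suc n) (u - v) =
      (a - free_boundary (Suc n) u) - (b - free_boundary (Suc n) v)"
    by (simp add: free_boundary_diff)
  ultimately show ?thesis
    unfolding null_homologous_def by (intro bexI[of _ "u - v"]) (simp_all only: frags_diff)
qed

lemma null_homologous_zero [simp]: "null_homologous n G 0"
  by (simp add: null_homologous_degens)

lemma null_homologous_minus: "null_homologous n G a \<Longrightarrow> null_homologous n G (- a)"
  using null_homologous_diff[of n G 0 a] by simp

lemma null_homologous_add:
  "null_homologous n G a \<Longrightarrow> null_homologous n G b \<Longrightarrow> null_homologous n G (a + b)"
  using null_homologous_diff[of n G a "- b"] null_homologous_minus by fastforce

lemma null_homologous_diff_trans:
  "null_homologous n G (a - b) \<Longrightarrow> null_homologous n G (b - c) \<Longrightarrow> null_homologous n G (a - c)"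
  using null_homologous_add[of n G "a - b" "b - c"] by simp

lemma null_homologous_diff_sym:
  "null_homologous n G (a - b) \<Longrightarrow> null_homologous n G (b - a)"
  using null_homologous_minus[of n G "a - b"] by simp

lemma null_homologous_cong:
  "null_homologous n G (a - b) \<Longrightarrow> null_homologous n G a \<longleftrightarrow> null_homologous n G b"
  using null_homologous_diff[of n G a "a - b"] null_homologous_add[of n G "a - b" b] by auto

lemma null_homologous_mono:
  "cubes (Suc n) G \<subseteq> cubes (Suc n) H \<Longrightarrow> null_homologous n G c \<Longrightarrow> null_homologous n H c"
  unfolding null_homologous_def using frags_mono by blast

text \<open>Graph maps without the extensionality built into \<open>graph_maps\<close>, so that
  homotopies can be given by plain lambda terms.\<close>

definition graph_hom :: "('v \<Rightarrow> 'w) \<Rightarrow> 'v ugraph \<Rightarrow> 'w ugraph \<Rightarrow> bool" where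
  "graph_hom F G H \<longleftrightarrow> (\<forall>v\<in>verts G. F v \<in> verts H) \<and>
     (\<forall>u\<in>verts G. \<forall>v\<in>verts G. adj_eq G u v \<longrightarrow> adj_eq H (F u) (F v))"

lemma graph_hom_graph_maps: "F \<in> graph_maps G H \<Longrightarrow> graph_hom F G H"
  by (auto simp: graph_maps_def graph_hom_def)

definition push_chain :: "nat \<Rightarrow> ('v \<Rightarrow> 'w) \<Rightarrow> 'v cube_chain \<Rightarrow> 'w cube_chain" where
  "push_chain n F = frag_extend (\<lambda>s. frag_of (compose (cube_verts n) F s))"

lemma push_chain_zero [simp]: "push_chain n F 0 = 0"
  by (simp add: push_chain_def)

lemma push_chain_of: "push_chain n F (frag_of s) = frag_of (compose (cube_verts n) F s)"
  by (simp add: push_chain_def)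

lemma push_chain_diff: "push_chain n F (c - d) = push_chain n F c - push_chain n F d"
  by (simp add: push_chain_def frag_extend_diff)

lemma push_chain_add: "push_chain n F (c + d) = push_chain n F c + push_chain n F d"
  by (simp add: push_chain_def frag_extend_add)

lemma push_chain_minus: "push_chain n F (- c) = - push_chain n F c"
  by (simp add: push_chain_def frag_extend_minus)

lemma push_chain_cmul: "push_chain n F (frag_cmul k c) = frag_cmul k (push_chain n F c)"
  by (simp add: push_chain_def frag_extend_cmul)

lemma push_chain_sum: "push_chain n F (\<Sum>i\<in>I. c i) = (\<Sum>i\<in>I. push_chain n F (c i))"
  by (induction I rule: infinite_finite_induct) (auto simp: push_chain_add)

lemma compose_in_cubes: "graph_hom F G H \<Longrightarrow> s \<in> cubes n G \<Longrightarrow> compose (cube_verts n) F s \<in> cubes n H"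
  unfolding cubes_iff graph_hom_def by (auto simp: compose_def)

lemma push_chain_chains: "graph_hom F G H \<Longrightarrow> c \<in> cube_chains n G \<Longrightarrow> push_chain n F c \<in> cube_chains n H"
  unfolding push_chain_def by (rule frags_extend) (auto intro: compose_in_cubes)

lemma cube_face_compose:
  assumes "e \<in> {0, 1}"
  shows "cube_face (Suc n) (Suc k) e (compose (cube_verts (Suc n)) F s)
    = compose (cube_verts n) F (cube_face (Suc n) (Suc k) e s)"
  using assms by (intro extensionalityI[of _ "cube_verts n"])
    (auto simp: cube_face_eq compose_def)

lemma degenerate_compose: "degenerate n s \<Longrightarrow> degenerate n (compose (cube_verts n) F s)"
  by (cases n) (auto simp: degenerate_def cube_face_compose)

lemma push_chain_degens: "c \<in> degens n \<Longrightarrow> push_chain n F c \<in> degens n"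
  unfolding push_chain_def by (rule frags_extend) (auto intro: degenerate_compose)

lemma free_boundary_push_chain:
  "free_boundary (Suc n) (push_chain (Suc n) F c) = push_chain n F (free_boundary (Suc n) c)"
proof (rule frag_eqI[of c UNIV])
  fix s
  show "free_boundary (Suc n) (push_chain (Suc n) F (frag_of s))
      = push_chain n F (free_boundary (Suc n) (frag_of s))"
    unfolding push_chain_of free_boundary_of cube_boundary_def push_chain_sum push_chain_cmul push_chain_diff
    by (simp only: cube_face_compose insertI1 insertI2)
qed (simp_all only: frags_def subset_UNIV mem_Collect_eq free_boundary_diff push_chain_diff
    push_chain_zero free_boundary_zero)

lemma push_chain_cycles: 
  assumes "graph_hom F G H" "c \<in> cycles n G"
  shows "push_chain n F c \<in> cycles n H"
proof (cases n)
  case (Suc m)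
  then show ?thesis using assms
    by (simp add: cycles_def push_chain_chains free_boundary_push_chain push_chain_degens)
qed (use assms in \<open>auto simp: cycles_0 push_chain_chains\<close>)

lemma null_homologous_push_chain:
  assumes "graph_hom F G H" "null_homologous n G c"
  shows "null_homologous n H (push_chain n F c)"
proof -
  obtain u where u: "u \<in> cube_chains (Suc n) G" "c - free_boundary (Suc n) u \<in> degens n"
    using assms(2) unfolding null_homologous_def by blast
  then show ?thesis
    unfolding null_homologous_def using push_chain_degens[OF u(2), of F]
    by (intro bexI[of _ "push_chain (Suc n) F u"] push_chain_chains[OF assms(1)])
      (simp_all add: push_chain_diff free_boundary_push_chain)
qed

lemma push_chain_cong:
  assumes "c \<in> cube_chains n G" "\<And>v. v \<in> verts G \<Longrightarrow> F v = F' v"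
  shows "push_chain n F c = push_chain n F' c"
  unfolding push_chain_def
proof (rule frag_extend_eq)
  fix s assume "s \<in> Poly_Mapping.keys c"
  then have "s \<in> cubes n G" using assms(1) by (auto simp: frags_def)
  then show "frag_of (compose (cube_verts n) F s) = frag_of (compose (cube_verts n) F' s)"
    using assms(2) by (auto simp: cubes_iff compose_def intro!: arg_cong[of _ _ frag_of] restrict_ext)
qed

lemma push_chain_id:
  assumes "c \<in> cube_chains n G" "\<And>v. v \<in> verts G \<Longrightarrow> F v = v"
  shows "push_chain n F c = c"
proof -
  have "push_chain n F c = frag_extend frag_of c"
    unfolding push_chain_def
  proof (rule frag_extend_eq)
    fix s assume "s \<in> Poly_Mapping.keys c"
    then have "s \<in> cubes n G" using assms(1) by (auto simp: frags_def)
    then have "compose (cube_verts n) F s = s"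
      using assms(2) by (intro extensionalityI[of _ "cube_verts n"]) (auto simp: cubes_iff compose_def)
    then show "frag_of (compose (cube_verts n) F s) = frag_of s" by simp
  qed
  then show ?thesis by (simp flip: frag_expansion)
qed

lemma push_chain_push_chain: "push_chain n F (push_chain n F' c) = push_chain n (F \<circ> F') c"
proof (rule frag_eqI[of c UNIV])
  fix s
  have "compose (cube_verts n) F (compose (cube_verts n) F' s) = compose (cube_verts n) (F \<circ> F') s"
    by (auto simp: compose_def)
  then show "push_chain n F (push_chain n F' (frag_of s)) = push_chain n (F \<circ> F') (frag_of s)"
    by (simp only: push_chain_of)
qed (simp_all only: frags_def subset_UNIV mem_Collect_eq push_chain_diff push_chain_zero)

section \<open>The prism operator\<close>

definition prism_cube :: "nat \<Rightarrow> ('v \<Rightarrow> 'w) \<Rightarrow> ('v \<Rightarrow> 'w) \<Rightarrow> (int list \<Rightarrow> 'v) \<Rightarrow> (int list \<Rightarrow> 'w)" where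
  "prism_cube n F F' s = (\<lambda>a\<in>cube_verts (Suc n). if hd a = 0 then F (s (tl a)) else F' (s (tl a)))"

definition prism :: "nat \<Rightarrow> ('v \<Rightarrow> 'w) \<Rightarrow> ('v \<Rightarrow> 'w) \<Rightarrow> 'v cube_chain \<Rightarrow> 'w cube_chain" where
  "prism n F F' = frag_extend (\<lambda>s. frag_of (prism_cube n F F' s))"

lemma prism_cube_in_cubes:
  assumes F: "graph_hom F G H" "graph_hom F' G H" and sym: "sym (edges H)"
    and adj: "\<And>v. v \<in> verts G \<Longrightarrow> adj_eq H (F v) (F' v)" and s: "s \<in> cubes n G"
  shows "prism_cube n F F' s \<in> cubes (Suc n) H"
proof -
  have sy: "adj_eq H u v \<Longrightarrow> adj_eq H v u" for u v
    using sym by (auto simp: adj_eq_def sym_def)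
  show ?thesis
    unfolding cubes_iff
  proof (intro conjI ballI impI)
    fix a b assume ab: "a \<in> cube_verts (Suc n)" "b \<in> cube_verts (Suc n)" "lattice_adj a b"
    obtain t a' where a: "a = t # a'" "t = 0 \<or> t = 1" "a' \<in> cube_verts n" by (rule cube_verts_SucE[OF ab(1)])
    obtain u b' where b: "b = u # b'" "u = 0 \<or> u = 1" "b' \<in> cube_verts n" by (rule cube_verts_SucE[OF ab(2)])
    have sa: "s a' \<in> verts G" "s b' \<in> verts G" using s a b by (auto simp: cubes_iff)
    have "t \<noteq> u \<and> a' = b' \<or> t = u \<and> adj_eq G (s a') (s b')"
      using ab(3) s a b by (auto simp: cubes_iff)
    then show "adj_eq H (prism_cube n F F' s a) (prism_cube n F F' s b)"
      using F adj[of "s a'"] sy[OF adj[of "s a'"]] a b sa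
      by (auto simp: prism_cube_def graph_hom_def)
  qed (use F s in \<open>auto simp: prism_cube_def graph_hom_def cubes_iff elim!: cube_verts_SucE\<close>)
qed

lemma prism_cube_face_0:
  "cube_face (Suc n) (Suc 0) 0 (prism_cube n F F' s) = compose (cube_verts n) F s"
  "cube_face (Suc n) (Suc 0) 1 (prism_cube n F F' s) = compose (cube_verts n) F' s"
  by (auto simp: cube_face_eq prism_cube_def compose_def intro!: restrict_ext)

lemma prism_cube_face_Suc:
  "e \<in> {0, 1} \<Longrightarrow> cube_face (Suc (Suc n)) (Suc (Suc k)) e (prism_cube (Suc n) F F' s)
    = prism_cube n F F' (cube_face (Suc n) (Suc k) e s)"
  unfolding cube_face_eq prism_cube_def
  by (intro restrict_ext) (auto elim!: cube_verts_SucE)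

lemma degenerate_prism_cube: "degenerate n s \<Longrightarrow> degenerate (Suc n) (prism_cube n F F' s)"
proof (cases n)
  case (Suc m)
  assume "degenerate n s"
  then obtain k where k: "k \<le> m" "cube_face (Suc m) (Suc k) 0 s = cube_face (Suc m) (Suc k) 1 s"
    by (auto simp: degenerate_def Suc less_Suc_eq_le)
  then show ?thesis
    unfolding degenerate_def Suc by (intro exI[of _ "Suc k"]) (simp add: prism_cube_face_Suc)
qed (simp add: degenerate_def)

lemma prism_degens: "c \<in> degens n \<Longrightarrow> prism n F F' c \<in> degens (Suc n)"
  unfolding prism_def by (rule frags_extend) (auto intro: degenerate_prism_cube)

lemma prism_zero [simp]: "prism n F F' 0 = 0"
  by (simp add: prism_def)

lemma prism_diff: "prism n F F' (c - d) = prism n F F' c - prism n F F' d"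
  by (simp add: prism_def frag_extend_diff)

lemma prism_add: "prism n F F' (c + d) = prism n F F' c + prism n F F' d"
  by (simp add: prism_def frag_extend_add)

lemma prism_of: "prism n F F' (frag_of s) = frag_of (prism_cube n F F' s)"
  by (simp add: prism_def)

lemma prism_cmul: "prism n F F' (frag_cmul k c) = frag_cmul k (prism n F F' c)"
  by (simp add: prism_def frag_extend_cmul)

lemma prism_sum: "prism n F F' (\<Sum>i\<in>I. c i) = (\<Sum>i\<in>I. prism n F F' (c i))"
  by (induction I rule: infinite_finite_induct) (auto simp: prism_add)

text \<open>The chain homotopy formula. The homotopy parameter is the first coordinate, so the first
  direction contributes the two ends, and the other directions have their index raised by one, which
  flips the sign of the prism over the boundary. For \<open>n = 0\<close> that last term is
  \<open>0\<close>, as \<open>free_boundary 0 c\<close> is.\<close>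

lemma free_boundary_prism:
  "free_boundary (Suc n) (prism n F F' c)
    = push_chain n F' c - push_chain n F c - prism (n - 1) F F' (free_boundary n c)"
proof (rule frag_eqI[of c UNIV])
  fix s
  have "cube_boundary (Suc n) (prism_cube n F F' s)
      = (frag_of (compose (cube_verts n) F' s) - frag_of (compose (cube_verts n) F s))
      + (\<Sum>k<n. frag_cmul ((-1) ^ k) (frag_of (cube_face (Suc n) (Suc (Suc k)) 0 (prism_cube n F F' s))
           - frag_of (cube_face (Suc n) (Suc (Suc k)) 1 (prism_cube n F F' s))))"
    unfolding cube_boundary_def sum.lessThan_Suc_shift prism_cube_face_0
    by simp
  also have "(\<Sum>k<n. frag_cmul ((-1) ^ k) (frag_of (cube_face (Suc n) (Suc (Suc k)) 0 (prism_cube n F F' s))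
           - frag_of (cube_face (Suc n) (Suc (Suc k)) 1 (prism_cube n F F' s))))
       = - prism (n - 1) F F' (cube_boundary n s)"
  proof (cases n)
    case (Suc m)
    have "frag_cmul ((-1) ^ k) (frag_of (cube_face (Suc n) (Suc (Suc k)) 0 (prism_cube n F F' s))
           - frag_of (cube_face (Suc n) (Suc (Suc k)) 1 (prism_cube n F F' s)))
      = - prism m F F' (frag_cmul ((-1) ^ Suc k) (frag_of (cube_face n (Suc k) 0 s)
          - frag_of (cube_face n (Suc k) 1 s)))" for k
      unfolding Suc by (simp add: prism_cube_face_Suc prism_cmul prism_diff prism_of)
    then show ?thesis
      unfolding cube_boundary_def[of n] prism_sum by (simp add: Suc sum_negf)
  qed (simp add: cube_boundary_def)
  finally show "free_boundary (Suc n) (prism n F F' (frag_of s))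
     = push_chain n F' (frag_of s) - push_chain n F (frag_of s) - prism (n - 1) F F' (free_boundary n (frag_of s))"
    unfolding push_chain_of free_boundary_of prism_of by simp
next
  fix a b
  show "push_chain n F' (a - b) - push_chain n F (a - b) - prism (n - 1) F F' (free_boundary n (a - b))
    = push_chain n F' a - push_chain n F a - prism (n - 1) F F' (free_boundary n a) -
      (push_chain n F' b - push_chain n F b - prism (n - 1) F F' (free_boundary n b))"
    by (simp add: push_chain_diff free_boundary_diff prism_diff)
qed (simp_all only: frags_def subset_UNIV mem_Collect_eq free_boundary_diff prism_diff
    push_chain_zero free_boundary_zero prism_zero diff_self)

text \<open>\<open>prism n F F' c\<close> bounds the difference up to the prism over the boundary of
  \<open>c\<close>. The latter is degenerate: a cycle has degenerate boundary, and prisms over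
  degenerate cubes are degenerate.\<close>

lemma null_homologous_homotopy_step:
  assumes "graph_hom F G H" "graph_hom F' G H" "sym (edges H)"
    and "\<And>v. v \<in> verts G \<Longrightarrow> adj_eq H (F v) (F' v)" and c: "c \<in> cycles n G"
  shows "null_homologous n H (push_chain n F' c - push_chain n F c)"
proof -
  have "prism n F F' c \<in> cube_chains (Suc n) H"
    unfolding prism_def
    using c assms(1-4) by (intro frags_extend[of c "cubes n G"]) (auto simp: cycles_def intro: prism_cube_in_cubes)
  moreover have "prism (n - 1) F F' (free_boundary n c) \<in> degens n"
    using c prism_degens[of "free_boundary n c" "n - 1" F F'] by (cases n) (auto simp: cycles_def)
  ultimately show ?thesis
    unfolding null_homologous_def
    by (intro bexI[of _ "prism n F F' c"]) (simp_all add: free_boundary_prism)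
qed

lemma null_homologous_homotopy:
  assumes "\<And>i. i \<le> (m::nat) \<Longrightarrow> graph_hom (F i) G H" "sym (edges H)"
    and "\<And>i v. i < m \<Longrightarrow> v \<in> verts G \<Longrightarrow> adj_eq H (F i v) (F (Suc i) v)" and c: "c \<in> cycles n G"
  shows "null_homologous n H (push_chain n (F m) c - push_chain n (F 0) c)"
  using assms
proof (induction m)
  case (Suc m)
  have "null_homologous n H (push_chain n (F (Suc m)) c - push_chain n (F m) c)"
    using Suc.prems by (intro null_homologous_homotopy_step[OF _ _ _ _ c]) auto
  moreover have "null_homologous n H (push_chain n (F m) c - push_chain n (F 0) c)"
    using Suc by simp
  ultimately show ?case by (rule null_homologous_diff_trans)
qed simp

section \<open>Chains of cubes in a lattice box\<close>

text \<open>A point of the half-open box is the lowest corner of a unit cube inside the closed box.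
  The sides may differ, since layers of thickness one and translated boxes occur.\<close>

fun lattice_box :: "(int \<times> int) list \<Rightarrow> int list set" where
  "lattice_box [] = {[]}"
| "lattice_box (b # bs) = (\<lambda>(t, x). t # x) ` ({fst b..<snd b} \<times> lattice_box bs)"

lemma finite_lattice_box [simp]: "finite (lattice_box bs)"
  by (induction bs) auto

lemma lattice_box_iff:
  "x \<in> lattice_box bs \<longleftrightarrow> length x = length bs \<and> (\<forall>i<length bs. fst (bs ! i) \<le> x ! i \<and> x ! i < snd (bs ! i))"
proof (induction bs arbitrary: x)
  case (Cons b bs)
  show ?case
  proof (cases x)
    case (Cons t y)
    have "x \<in> lattice_box (b # bs) \<longleftrightarrow> fst b \<le> t \<and> t < snd b \<and> y \<in> lattice_box bs"
      using Cons by auto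
    also have "\<dots> \<longleftrightarrow> length x = length (b # bs) \<and>
        (\<forall>i<length (b # bs). fst ((b # bs) ! i) \<le> x ! i \<and> x ! i < snd ((b # bs) ! i))"
      unfolding Cons.IH \<open>x = t # y\<close> length_Cons All_less_Suc2 by auto
    finally show ?thesis .
  qed auto
qed auto

lemma length_lattice_box: "x \<in> lattice_box bs \<Longrightarrow> length x = length bs"
  by (simp add: lattice_box_iff)

lemma lattice_box_replicate:
  "x \<in> lattice_box (replicate n (l, h)) \<longleftrightarrow> length x = n \<and> (\<forall>t\<in>set x. l \<le> t \<and> t < h)"
  by (auto simp: lattice_box_iff all_set_conv_all_nth)

lemma sum_lattice_box_Cons:
  "sum g (lattice_box (b # bs)) = (\<Sum>t\<in>{fst b..<snd b}. \<Sum>x\<in>lattice_box bs. g (t # x))"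
proof -
  have "sum g (lattice_box (b # bs)) = (\<Sum>(t, x)\<in>{fst b..<snd b} \<times> lattice_box bs. g (t # x))"
    unfolding lattice_box.simps by (subst sum.reindex) (auto simp: inj_on_def intro!: sum.cong)
  then show ?thesis by (simp add: sum.cartesian_product)
qed

lemma sum_telescope_int:
  fixes g :: "int \<Rightarrow> 'a :: ab_group_add"
  assumes "l \<le> h"
  shows "(\<Sum>t\<in>{l..<h}. g t - g (t + 1)) = g l - g h"
  using assms
proof (induction h rule: int_ge_induct)
  case (step i)
  then have "{l..<i + 1} = insert i {l..<i}" by auto
  then show ?case using step by simp
qed simp

text \<open>The sum telescopes along each line in direction \<open>k\<close>. The induction strips
  leading coordinates until \<open>k\<close> is the first, where the two sums can be
  exchanged.\<close>

lemma sum_lattice_box_telescope: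
  fixes g :: "int list \<Rightarrow> 'a :: ab_group_add"
  assumes "k < length bs" "fst (bs ! k) \<le> snd (bs ! k)"
  shows "(\<Sum>x\<in>lattice_box bs. g x - g (x[k := x ! k + 1]))
    = (\<Sum>y\<in>lattice_box (take k bs @ drop (Suc k) bs).
        g (insert_at k (fst (bs ! k)) y) - g (insert_at k (snd (bs ! k)) y))"
  using assms
proof (induction k arbitrary: bs g)
  case 0
  then obtain b cs where bs: "bs = b # cs" by (cases bs) auto
  have "(\<Sum>x\<in>lattice_box bs. g x - g (x[0 := x ! 0 + 1]))
      = (\<Sum>t\<in>{fst b..<snd b}. \<Sum>x\<in>lattice_box cs. g (t # x) - g ((t + 1) # x))"
    unfolding bs sum_lattice_box_Cons by simp
  also have "\<dots> = (\<Sum>x\<in>lattice_box cs. \<Sum>t\<in>{fst b..<snd b}. g (t # x) - g ((t + 1) # x))"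
    by (rule sum.swap)
  also have "\<dots> = (\<Sum>x\<in>lattice_box cs. g (fst b # x) - g (snd b # x))"
    using 0 by (intro sum.cong refl sum_telescope_int[of "fst b" "snd b" "\<lambda>t. g (t # _)"]) (simp add: bs)
  finally show ?case by (simp add: bs)
next
  case (Suc k)
  then obtain b cs where bs: "bs = b # cs" by (cases bs) auto
  have "(\<Sum>x\<in>lattice_box bs. g x - g (x[Suc k := x ! Suc k + 1]))
      = (\<Sum>t\<in>{fst b..<snd b}. \<Sum>x\<in>lattice_box cs. g (t # x) - g (t # x[k := x ! k + 1]))"
    unfolding bs sum_lattice_box_Cons by simp
  also have "\<dots> = (\<Sum>t\<in>{fst b..<snd b}. \<Sum>y\<in>lattice_box (take k cs @ drop (Suc k) cs).
        g (t # insert_at k (fst (cs ! k)) y) - g (t # insert_at k (snd (cs ! k)) y))"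
    using Suc.prems bs by (intro sum.cong refl Suc.IH[of cs "\<lambda>x. g (_ # x)"]) auto
  finally show ?case by (simp add: bs sum_lattice_box_Cons del: lattice_box.simps)
qed

lemma subcube_cong:
  "(\<And>a. a \<in> cube_verts n \<Longrightarrow> f (map2 (+) x a) = g (map2 (+) y a)) \<Longrightarrow> subcube n f x = subcube n g y"
  by (auto simp: subcube_def)

lemma map2_add_insert_at:
  "k \<le> length a \<Longrightarrow> length x = length a \<Longrightarrow>
    map2 (+) (insert_at k t x) (insert_at k u a) = insert_at k (t + u) (map2 (+) x (a :: int list))"
proof (induction k arbitrary: x a)
  case (Suc k)
  then show ?case by (cases a; cases x) auto
qed auto

lemma map2_add_insert_at_1:
  "k \<le> length a \<Longrightarrow> length x = Suc (length a) \<Longrightarrow>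
    map2 (+) x (insert_at k 1 a) = map2 (+) (x[k := x ! k + 1]) (insert_at k 0 (a :: int list))"
proof (induction k arbitrary: x a)
  case 0
  then show ?case by (cases x) auto
next
  case (Suc k)
  then show ?case by (cases a; cases x) auto
qed

lemma lattice_adj_map2_add:
  "lattice_adj a b \<Longrightarrow> length x = length a \<Longrightarrow> lattice_adj (map2 (+) x a) (map2 (+) x b)"
proof (induction a b arbitrary: x rule: lattice_adj.induct)
  case (1 a x b y xs)
  then show ?case by (cases xs) auto
qed auto

lemma cube_face_subcube:
  "k \<le> m \<Longrightarrow> length y = m \<Longrightarrow>
    cube_face (Suc m) (Suc k) 0 (subcube (Suc m) f (insert_at k t y)) = subcube m (f \<circ> insert_at k t) y"
  by (auto simp: cube_face_eq subcube_def map2_add_insert_at length_cube_verts intro!: restrict_ext)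

text \<open>Neighbouring unit cubes share a face; this is what makes the boundary telescope.\<close>

lemma cube_face_subcube_1:
  "k \<le> m \<Longrightarrow> length x = Suc m \<Longrightarrow> cube_face (Suc m) (Suc k) 1 (subcube (Suc m) f x)
    = cube_face (Suc m) (Suc k) 0 (subcube (Suc m) f (x[k := x ! k + 1]))"
  by (auto simp: cube_face_eq subcube_def map2_add_insert_at_1 length_cube_verts intro!: restrict_ext)

definition box_face :: "nat \<Rightarrow> (int list \<Rightarrow> 'v) \<Rightarrow> (int \<times> int) list \<Rightarrow> nat \<Rightarrow> 'v cube_chain" where
  "box_face m f bs k = (\<Sum>y\<in>lattice_box (take k bs @ drop (Suc k) bs).
     frag_of (subcube m (f \<circ> insert_at k (fst (bs ! k))) y) - frag_of (subcube m (f \<circ> insert_at k (snd (bs ! k))) y))"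

text \<open>A discrete Stokes formula: inner faces cancel between neighbouring cubes and the faces
  of the box survive, with the signs of a single cube. It yields the cycle property, homotopy
  invariance and the connecting chain of a suspended map.\<close>

lemma free_boundary_lattice_box:
  assumes len: "length bs = Suc m" and le: "\<And>k. k \<le> m \<Longrightarrow> fst (bs ! k) \<le> snd (bs ! k)"
  shows "free_boundary (Suc m) (\<Sum>x\<in>lattice_box bs. frag_of (subcube (Suc m) f x))
    = (\<Sum>k<Suc m. frag_cmul ((-1) ^ Suc k) (box_face m f bs k))"
proof -
  \<comment> \<open>Only lower faces are named, as an upper face is the lower face of the next
    cube.\<close>
  define T where "T k x = frag_of (cube_face (Suc m) (Suc k) 0 (subcube (Suc m) f x))" for k x
  have "free_boundary (Suc m) (\<Sum>x\<in>lattice_box bs. frag_of (subcube (Suc m) f x))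
    = (\<Sum>x\<in>lattice_box bs. \<Sum>k<Suc m. frag_cmul ((-1) ^ Suc k) (T k x - T k (x[k := x ! k + 1])))"
    unfolding free_boundary_sum free_boundary_of cube_boundary_def T_def
    by (intro sum.cong refl) (simp only: lessThan_iff less_Suc_eq_le cube_face_subcube_1 length_lattice_box len)
  also have "\<dots> = (\<Sum>k<Suc m. frag_cmul ((-1) ^ Suc k) (\<Sum>x\<in>lattice_box bs. T k x - T k (x[k := x ! k + 1])))"
    unfolding frag_cmul_sum by (rule sum.swap)
  also have "\<dots> = (\<Sum>k<Suc m. frag_cmul ((-1) ^ Suc k) (box_face m f bs k))"
  proof (rule sum.cong[OF refl])
    fix k assume "k \<in> {..<Suc m}"
    then have k: "k \<le> m" by simp
    have "(\<Sum>x\<in>lattice_box bs. T k x - T k (x[k := x ! k + 1]))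
      = (\<Sum>y\<in>lattice_box (take k bs @ drop (Suc k) bs).
           T k (insert_at k (fst (bs ! k)) y) - T k (insert_at k (snd (bs ! k)) y))"
      using k le len by (intro sum_lattice_box_telescope) auto
    also have "\<dots> = box_face m f bs k"
      unfolding box_face_def
    proof (rule sum.cong[OF refl])
      fix y assume "y \<in> lattice_box (take k bs @ drop (Suc k) bs)"
      then have "length y = m" using k len by (simp add: length_lattice_box)
      then show "T k (insert_at k (fst (bs ! k)) y) - T k (insert_at k (snd (bs ! k)) y)
        = frag_of (subcube m (f \<circ> insert_at k (fst (bs ! k))) y)
        - frag_of (subcube m (f \<circ> insert_at k (snd (bs ! k))) y)"
        unfolding T_def using k by (simp only: cube_face_subcube)
    qed
    finally show "frag_cmul ((-1) ^ Suc k) (\<Sum>x\<in>lattice_box bs. T k x - T k (x[k := x ! k + 1]))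
      = frag_cmul ((-1) ^ Suc k) (box_face m f bs k)"
      by (rule arg_cong)
  qed
  finally show ?thesis .
qed

text \<open>Only equal values on opposite sides are asked for, not constant ones: a suspended map is
  not constant on the sides of the box around its peak.\<close>

lemma box_face_eq_0:
  assumes "length bs = Suc m" "k \<le> m"
    and eq: "\<And>z. length z = m \<Longrightarrow> f (insert_at k (fst (bs ! k)) z) = f (insert_at k (snd (bs ! k)) z)"
  shows "box_face m f bs k = 0"
  unfolding box_face_def
proof (intro sum.neutral ballI)
  fix y assume "y \<in> lattice_box (take k bs @ drop (Suc k) bs)"
  from length_lattice_box[OF this] have "length y = m" using assms by simp
  then have "subcube m (f \<circ> insert_at k (fst (bs ! k))) y = subcube m (f \<circ> insert_at k (snd (bs ! k))) y"
    using eq by (intro subcube_cong) (simp add: length_cube_verts)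
  then show "frag_of (subcube m (f \<circ> insert_at k (fst (bs ! k))) y)
      - frag_of (subcube m (f \<circ> insert_at k (snd (bs ! k))) y) = 0" by simp
qed

section \<open>Constant cubes and the normalised chain of a based map\<close>

abbreviation const_cube :: "nat \<Rightarrow> 'v \<Rightarrow> int list \<Rightarrow> 'v" where
  "const_cube n v \<equiv> (\<lambda>a\<in>cube_verts n. v)"

lemma free_boundary_const_cube: "free_boundary n (frag_of (const_cube n v)) = 0"
proof -
  have "cube_face n (Suc k) 0 (const_cube n v) = cube_face n (Suc k) 1 (const_cube n v)" if "k < n" for k
  proof -
    obtain m where "n = Suc m" using \<open>k < n\<close> by (cases n) auto
    then show ?thesis by (auto simp: cube_face_eq intro!: restrict_ext)
  qed
  then show ?thesis unfolding free_boundary_of cube_boundary_def by (intro sum.neutral ballI) simp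
qed

lemma degenerate_const_cube: "degenerate (Suc n) (const_cube (Suc n) v)"
  unfolding degenerate_def by (intro exI[of _ 0]) (auto simp: cube_face_eq intro!: restrict_ext)

lemma const_cube_in_cubes: "v \<in> verts G \<Longrightarrow> const_cube n v \<in> cubes n G"
  by (auto simp: cubes_iff adj_eq_def)

text \<open>The chain of all subcubes of a based map, every cube being normalised by the constant one.
  This only changes the chain by degenerate cubes if \<open>n > 0\<close>, makes it independent of the finite set
  over which the sum extends, and gives a reduced cycle if \<open>n = 0\<close>.\<close>

definition cube_support :: "nat \<Rightarrow> 'v \<Rightarrow> (int list \<Rightarrow> 'v) \<Rightarrow> int list set" where
  "cube_support n v0 f = {x. length x = n \<and> subcube n f x \<noteq> const_cube n v0}"

definition hurewicz_chain :: "nat \<Rightarrow> 'v \<Rightarrow> (int list \<Rightarrow> 'v) \<Rightarrow> 'v cube_chain" where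
  "hurewicz_chain n v0 f =
     (\<Sum>x\<in>cube_support n v0 f. frag_of (subcube n f x) - frag_of (const_cube n v0))"

lemma hurewicz_chain_eq:
  assumes "finite B" "cube_support n v0 f \<subseteq> B" "\<And>x. x \<in> B \<Longrightarrow> length x = n"
  shows "hurewicz_chain n v0 f = (\<Sum>x\<in>B. frag_of (subcube n f x) - frag_of (const_cube n v0))"
  unfolding hurewicz_chain_def using assms(1,2)
  by (rule sum.mono_neutral_left) (use assms(3) in \<open>auto simp: cube_support_def\<close>)

lemma vanishes_beyond_mono: "vanishes_beyond n v0 f r \<Longrightarrow> r \<le> r' \<Longrightarrow> vanishes_beyond n v0 f r'"
  unfolding vanishes_beyond_def by (meson of_nat_mono order_trans)

lemma vanishes_beyondD:
  "vanishes_beyond n v0 f r \<Longrightarrow> length x = n \<Longrightarrow> t \<in> set x \<Longrightarrow> int r \<le> \<bar>t\<bar> \<Longrightarrow> f x = v0"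
  unfolding vanishes_beyond_def verts_int_lattice by (metis in_set_conv_nth mem_Collect_eq)

lemma vanishes_beyondI:
  "(\<And>x t. length x = n \<Longrightarrow> t \<in> set x \<Longrightarrow> int r \<le> \<bar>t\<bar> \<Longrightarrow> f x = v0) \<Longrightarrow> vanishes_beyond n v0 f r"
  unfolding vanishes_beyond_def verts_int_lattice by (metis mem_Collect_eq nth_mem)

lemma cube_support_subset:
  assumes "vanishes_beyond n v0 f r"
  shows "cube_support n v0 f \<subseteq> lattice_box (replicate n (- int r, int r))"
proof (rule ccontr)
  assume "\<not> ?thesis"
  then obtain x where x: "length x = n" "subcube n f x \<noteq> const_cube n v0"
      "x \<notin> lattice_box (replicate n (- int r, int r))"
    by (auto simp: cube_support_def)
  then obtain i where i: "i < n" "x ! i < - int r \<or> int r \<le> x ! i"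
    by (auto simp: lattice_box_iff not_le)
  have "f (map2 (+) x a) = v0" if a: "a \<in> cube_verts n" for a
  proof (rule vanishes_beyondD[OF assms])
    show "map2 (+) x a ! i \<in> set (map2 (+) x a)"
      using a i x(1) by (intro nth_mem) (simp add: length_cube_verts)
    \<comment> \<open>A coordinate \<open>x ! i\<close> below \<open>- int r\<close> is at most
      \<open>- int r - 1\<close>, so adding 0 or 1 leaves an absolute value of at least
      \<open>r\<close>. Hence the half-open interval.\<close>
    have "a ! i \<in> {0, 1}" using a i by (auto simp: cube_verts_eq subset_iff)
    then show "int r \<le> \<bar>map2 (+) x a ! i\<bar>" using i x(1) a by (auto simp: length_cube_verts)
  qed (use x i a in \<open>auto simp: length_cube_verts\<close>)
  then have "subcube n f x = const_cube n v0" by (auto simp: subcube_def)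
  then show False using x by simp
qed

lemma hurewicz_chain_box:
  assumes "vanishes_beyond n v0 f r" "r \<le> r'"
  shows "hurewicz_chain n v0 f = (\<Sum>x\<in>lattice_box (replicate n (- int r', int r')).
    frag_of (subcube n f x) - frag_of (const_cube n v0))"
  using cube_support_subset[OF vanishes_beyond_mono[OF assms]]
  by (rule hurewicz_chain_eq[OF finite_lattice_box]) (simp add: lattice_box_replicate)

text \<open>Opposite faces of the box carry only the base point and cancel, and constant cubes have
  boundary \<open>0\<close>. So the boundary vanishes in the free group, not merely modulo
  degenerate cubes.\<close>

lemma free_boundary_hurewicz_chain:
  assumes "vanishes_beyond n v0 f r"
  shows "free_boundary n (hurewicz_chain n v0 f) = 0"
proof (cases n)
  case (Suc m)
  define bs where "bs = replicate (Suc m) (- int r, int r)"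
  have "free_boundary (Suc m) (\<Sum>x\<in>lattice_box bs. frag_of (subcube (Suc m) f x))
    = (\<Sum>k<Suc m. frag_cmul ((-1) ^ Suc k) (box_face m f bs k))"
    by (rule free_boundary_lattice_box) (auto simp: bs_def simp del: replicate_Suc)
  also have "\<dots> = 0"
  proof (intro sum.neutral ballI)
    fix k assume "k \<in> {..<Suc m}"
    then have k: "k < Suc m" by simp
    have "f (insert_at k t z) = v0" if "length z = m" "\<bar>t\<bar> = int r" for t z
      using that by (intro vanishes_beyondD[OF assms, of _ t]) (auto simp: Suc)
    then have "box_face m f bs k = 0"
      using k by (intro box_face_eq_0) (simp_all add: bs_def del: replicate_Suc)
    then show "frag_cmul ((-1) ^ Suc k) (box_face m f bs k) = 0"
      by (simp only: frag_cmul_zero2)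
  qed
  finally show ?thesis
    using hurewicz_chain_box[OF assms order_refl]
    by (simp add: Suc bs_def sum_subtractf free_boundary_diff free_boundary_cmul free_boundary_const_cube
        free_boundary_sum del: replicate_Suc)
qed simp

lemma subcube_in_cubes:
  assumes "graph_hom f (int_lattice n) G" "length x = n"
  shows "subcube n f x \<in> cubes n G"
  using assms unfolding graph_hom_def verts_int_lattice
  by (auto simp: cubes_iff subcube_def length_cube_verts adj_eq_int_lattice lattice_adj_map2_add)

lemma hurewicz_chain_chains:
  assumes "graph_hom f (int_lattice n) G" "v0 \<in> verts G"
  shows "hurewicz_chain n v0 f \<in> cube_chains n G"
  unfolding hurewicz_chain_def using assms
  by (intro frags_sum frags_diff) (auto simp: cube_support_def subcube_in_cubes const_cube_in_cubes)

lemma hurewicz_chain_cycles: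
  assumes "graph_hom f (int_lattice n) G" "v0 \<in> verts G" "vanishes_beyond n v0 f r"
  shows "hurewicz_chain n v0 f \<in> cycles n G"
  using assms by (simp add: cycles_def hurewicz_chain_chains free_boundary_hurewicz_chain)

text \<open>A single layer of cubes lies between a slice carrying \<open>f\<close> and a slice
  carrying \<open>g\<close>. Its boundary is the difference of the two chains, as the remaining
  sides carry only \<open>v0\<close>.\<close>

lemma null_homologous_hurewicz_step:
  assumes f: "graph_hom f (int_lattice n) G" "vanishes_beyond n v0 f r"
    and g: "graph_hom g (int_lattice n) G" "vanishes_beyond n v0 g r"
    and sym: "sym (edges G)" and adj: "\<And>x. length x = n \<Longrightarrow> adj_eq G (f x) (g x)"
  shows "null_homologous n G (hurewicz_chain n v0 g - hurewicz_chain n v0 f)"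
proof -
  \<comment> \<open>Extended constantly in the first coordinate to both sides, so that
    \<open>h\<close> is defined on the whole lattice and all its subcubes are cubes of
    \<open>G\<close>.\<close>
  define h where "h x = (if hd x \<le> 0 then f (tl x) else g (tl x))" for x :: "int list"
  define B where "B = replicate n (- int r, int r)"
  define bs where "bs = (0, 1) # B"
  define u where "u = (\<Sum>x\<in>lattice_box bs. frag_of (subcube (Suc n) h x))"
  have "length bs = Suc n" by (simp add: bs_def B_def)
  have "graph_hom h (int_lattice (Suc n)) G"
  proof -
    have sy: "adj_eq G u v \<Longrightarrow> adj_eq G v u" for u v
      using sym by (auto simp: adj_eq_def sym_def)
    have "adj_eq G (h x) (h y)" if xy: "length x = Suc n" "length y = Suc n" "lattice_adj x y" for x y
    proof -
      obtain t x' s y' where [simp]: "x = t # x'" "y = s # y'" "length x' = n" "length y' = n"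
        using xy by (metis length_Suc_conv)
      have "x' = y' \<or> t = s \<and> lattice_adj x' y'" using xy by auto
      then show ?thesis
        using f(1) g(1) adj[of x'] sy[OF adj[of x']]
        by (auto simp: h_def graph_hom_def verts_int_lattice adj_eq_int_lattice) (auto simp: adj_eq_def)
    qed
    moreover have "h x \<in> verts G" if "length x = Suc n" for x
      using f(1) g(1) that by (auto simp: h_def graph_hom_def verts_int_lattice)
    ultimately show ?thesis
      by (auto simp: graph_hom_def verts_int_lattice adj_eq_int_lattice) (auto simp: adj_eq_def)
  qed
  then have u: "u \<in> cube_chains (Suc n) G"
    unfolding u_def using \<open>length bs = Suc n\<close>
    by (intro frags_sum) (auto intro!: subcube_in_cubes simp: length_lattice_box)
  have "free_boundary (Suc n) u = (\<Sum>k<Suc n. frag_cmul ((-1) ^ Suc k) (box_face n h bs k))"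
    unfolding u_def
    by (rule free_boundary_lattice_box) (auto simp: bs_def B_def nth_Cons split: nat.splits)
  also have "\<dots> = frag_cmul ((-1) ^ Suc 0)
      (\<Sum>y\<in>lattice_box B. frag_of (subcube n (h \<circ> insert_at 0 0) y) - frag_of (subcube n (h \<circ> insert_at 0 1) y))"
  proof -
    have "box_face n h bs (Suc k) = 0" if k: "k < n" for k
    proof (rule box_face_eq_0)
      fix z :: "int list" assume "length z = n"
      then obtain s z' where z: "z = s # z'" "length z' = n - 1" using k by (cases z) auto
      have "h (insert_at (Suc k) t z) = v0" if "\<bar>t\<bar> = int r" for t
        using vanishes_beyondD[OF f(2), of "insert_at k t z'" t] vanishes_beyondD[OF g(2), of "insert_at k t z'" t]
          k z that by (auto simp: h_def)
      then show "h (insert_at (Suc k) (fst (bs ! Suc k)) z) = h (insert_at (Suc k) (snd (bs ! Suc k)) z)"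
        using k by (simp add: bs_def B_def)
    qed (use k \<open>length bs = Suc n\<close> in auto)
    then show ?thesis unfolding sum.lessThan_Suc_shift by (simp add: box_face_def[of _ _ _ 0] bs_def)
  qed
  also have "\<dots> = (\<Sum>y\<in>lattice_box B. frag_of (subcube n g y)) - (\<Sum>y\<in>lattice_box B. frag_of (subcube n f y))"
  proof -
    have "subcube n (h \<circ> insert_at 0 0) y = subcube n f y" "subcube n (h \<circ> insert_at 0 1) y = subcube n g y" for y
      by (auto simp: h_def subcube_def)
    then show ?thesis by (simp add: sum_subtractf)
  qed
  also have "\<dots> = hurewicz_chain n v0 g - hurewicz_chain n v0 f"
    using hurewicz_chain_box[OF f(2) order_refl] hurewicz_chain_box[OF g(2) order_refl]
    by (simp add: B_def sum_subtractf)
  finally show ?thesis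
    using null_homologous_boundary[OF u] by simp
qed

text \<open>\<open>F\<close> maps the normalising cubes along with the others, and the same box
  serves both maps.\<close>

lemma push_chain_hurewicz_chain:
  assumes "vanishes_beyond n v0 f r"
  shows "push_chain n F (hurewicz_chain n v0 f) = hurewicz_chain n (F v0) (compose {x. length x = n} F f)"
proof -
  let ?g = "compose {x. length x = n} F f"
  have "vanishes_beyond n (F v0) ?g r"
    using vanishes_beyondD[OF assms] by (auto intro!: vanishes_beyondI simp: compose_def)
  moreover have "compose (cube_verts n) F (subcube n f x) = subcube n ?g x" if "length x = n" for x
    using that by (auto simp: compose_def subcube_def length_cube_verts intro!: restrict_ext)
  moreover have "compose (cube_verts n) F (const_cube n v0) = const_cube n (F v0)"
    by (auto simp: compose_def)
  ultimately show ?thesis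
    using hurewicz_chain_box[OF assms order_refl]
    by (simp add: hurewicz_chain_box[OF _ order_refl] push_chain_sum push_chain_diff push_chain_of
        lattice_box_replicate)
qed

section \<open>Discrete homotopy groups\<close>

lemma graph_maps_int_lattice_iff:
  "f \<in> graph_maps (int_lattice n) G \<longleftrightarrow> f \<in> extensional {x. length x = n} \<and> graph_hom f (int_lattice n) G"
  by (auto simp: graph_maps_def graph_hom_def verts_int_lattice PiE_iff)

lemma graph_hom_int_lattice:
  "graph_hom f (int_lattice n) G \<longleftrightarrow> (\<forall>x. length x = n \<longrightarrow> f x \<in> verts G) \<and>
     (\<forall>x y. length x = n \<longrightarrow> length y = n \<longrightarrow> lattice_adj x y \<longrightarrow> adj_eq G (f x) (f y))"
  unfolding graph_hom_def verts_int_lattice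
  by (auto simp: adj_eq_int_lattice) (auto simp: adj_eq_def)

lemma based_maps_iff:
  "f \<in> based_maps n G v0 \<longleftrightarrow> f \<in> extensional {x. length x = n} \<and> graph_hom f (int_lattice n) G \<and>
     (\<exists>r. vanishes_beyond n v0 f r)"
  by (auto simp: based_maps_def graph_maps_int_lattice_iff)

lemma based_mapsI:
  assumes "\<And>x. length x = n \<Longrightarrow> p x \<in> verts G"
    and "\<And>x y. length x = n \<Longrightarrow> length y = n \<Longrightarrow> lattice_adj x y \<Longrightarrow> adj_eq G (p x) (p y)"
    and "\<And>x t. length x = n \<Longrightarrow> t \<in> set x \<Longrightarrow> int r \<le> \<bar>t\<bar> \<Longrightarrow> p x = v0"
  shows "(\<lambda>x\<in>{x. length x = n}. p x) \<in> based_maps n G v0"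
  unfolding based_maps_iff using assms
  by (auto simp: graph_hom_int_lattice intro!: exI[of _ r] vanishes_beyondI)

lemma based_maps_vanish: "f \<in> based_maps n G v0 \<Longrightarrow> vanishes_beyond n v0 f (radius n v0 f)"
  unfolding based_maps_def radius_def by (auto intro: LeastI)

lemma adj_eq_refl [simp]: "adj_eq G v v"
  by (simp add: adj_eq_def)

definition based_step :: "nat \<Rightarrow> 'v ugraph \<Rightarrow> 'v \<Rightarrow> (int list \<Rightarrow> 'v) \<Rightarrow> (int list \<Rightarrow> 'v) \<Rightarrow> bool" where
  "based_step n G v0 f g \<longleftrightarrow> f \<in> based_maps n G v0 \<and> g \<in> based_maps n G v0 \<and>
     (\<forall>x. length x = n \<longrightarrow> adj_eq G (f x) (g x))"

lemma adj_eq_cart_prod_path: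
  assumes "length x = n" "length y = n" "0 \<le> i" "i \<le> int m" "0 \<le> j" "j \<le> int m"
  shows "adj_eq (cart_prod (int_lattice n) (int_path m)) (x, i) (y, j) \<longleftrightarrow>
    x = y \<and> \<bar>i - j\<bar> \<le> 1 \<or> i = j \<and> adj_eq (int_lattice n) x y"
proof -
  have "((x, i), (y, j)) \<in> edges (cart_prod (int_lattice n) (int_path m)) \<longleftrightarrow>
      x = y \<and> \<bar>i - j\<bar> = 1 \<or> (x, y) \<in> edges (int_lattice n) \<and> i = j"
    using assms by (auto simp: cart_prod_def verts_int_lattice int_path_def induced_def int_line_def)
  moreover have "\<bar>i - j\<bar> \<le> 1 \<longleftrightarrow> i = j \<or> \<bar>i - j\<bar> = 1" by auto
  ultimately show ?thesis by (auto simp: adj_eq_def)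
qed

text \<open>Along an edge of a Cartesian product only one factor moves, so the condition on a
  homotopy splits into one on each slice and one between consecutive slices. The slices may have
  different radii.\<close>

lemma based_homotopy_rel_iff:
  assumes "sym (edges G)"
  shows "(f, g) \<in> based_homotopy_rel n G v0 \<longleftrightarrow> f \<in> based_maps n G v0 \<and> (based_step n G v0)\<^sup>*\<^sup>* f g"
proof
  assume "(f, g) \<in> based_homotopy_rel n G v0"
  then obtain m h where f: "f \<in> based_maps n G v0"
    and h: "h \<in> graph_maps (cart_prod (int_lattice n) (int_path m)) G"
    and h0: "homotopy_slice n h 0 = f" and hm: "homotopy_slice n h (int m) = g"
    and hb: "\<And>i. i \<in> {0..int m} \<Longrightarrow> homotopy_slice n h i \<in> based_maps n G v0"
    unfolding based_homotopy_rel_def by blast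
  have step: "based_step n G v0 (homotopy_slice n h (int k)) (homotopy_slice n h (int (Suc k)))" if "k < m" for k
    unfolding based_step_def
  proof (intro conjI allI impI)
    fix x :: "int list" assume x: "length x = n"
    have "(x, int k) \<in> verts (cart_prod (int_lattice n) (int_path m))"
      "(x, int (Suc k)) \<in> verts (cart_prod (int_lattice n) (int_path m))"
      using that x by (auto simp: cart_prod_def verts_int_lattice int_path_def induced_def int_line_def)
    moreover have "adj_eq (cart_prod (int_lattice n) (int_path m)) (x, int k) (x, int (Suc k))"
      using that x by (subst adj_eq_cart_prod_path) auto
    ultimately have "adj_eq G (h (x, int k)) (h (x, int (Suc k)))"
      using h unfolding graph_maps_def by blast
    then show "adj_eq G (homotopy_slice n h (int k) x) (homotopy_slice n h (int (Suc k)) x)"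
      using x by (simp add: homotopy_slice_def verts_int_lattice)
  qed (use hb that in auto)
  have "(based_step n G v0)\<^sup>*\<^sup>* f (homotopy_slice n h (int k))" if "k \<le> m" for k
    using that
  proof (induction k)
    case (Suc k)
    then show ?case using step[of k] by (meson Suc_le_lessD less_imp_le rtranclp.rtrancl_into_rtrancl)
  qed (simp add: h0)
  from this[of m] f hm show "f \<in> based_maps n G v0 \<and> (based_step n G v0)\<^sup>*\<^sup>* f g" by simp
next
  assume a: "f \<in> based_maps n G v0 \<and> (based_step n G v0)\<^sup>*\<^sup>* f g"
  then obtain m where "((based_step n G v0) ^^ m) f g" using rtranclp_imp_relpowp by metis
  then obtain F where F: "F 0 = f" "F m = g" "\<And>i. i < m \<Longrightarrow> based_step n G v0 (F i) (F (Suc i))"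
    unfolding relpowp_fun_conv by blast
  have Fb: "F i \<in> based_maps n G v0" if "i \<le> m" for i
    using F(3)[of "i - 1"] F(1) a that by (cases i) (auto simp: based_step_def)
  define V where "V = verts (cart_prod (int_lattice n) (int_path m))"
  have V: "(x, i) \<in> V \<longleftrightarrow> length x = n \<and> 0 \<le> i \<and> i \<le> int m" for x i
    by (auto simp: V_def cart_prod_def verts_int_lattice int_path_def induced_def int_line_def)
  define h where "h = (\<lambda>p\<in>V. F (nat (snd p)) (fst p))"
  have slice: "homotopy_slice n h i = F (nat i)" if "i \<in> {0..int m}" for i
    using that Fb[of "nat i"]
    by (intro extensionalityI[of _ "{x. length x = n}"])
      (auto simp: homotopy_slice_def verts_int_lattice h_def V based_maps_iff)
  have sy: "adj_eq G u v \<Longrightarrow> adj_eq G v u" for u v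
    using assms by (auto simp: adj_eq_def sym_def)
  have "h \<in> graph_maps (cart_prod (int_lattice n) (int_path m)) G"
    unfolding graph_maps_def V_def[symmetric]
  proof (intro CollectI conjI ballI impI)
    show "h \<in> V \<rightarrow>\<^sub>E verts G"
      using Fb by (auto simp: h_def V based_maps_iff graph_hom_int_lattice)
    fix p q assume pq: "p \<in> V" "q \<in> V" and adj: "adj_eq (cart_prod (int_lattice n) (int_path m)) p q"
    obtain x i y j where [simp]: "p = (x, i)" "q = (y, j)" by fastforce
    have ij: "length x = n" "length y = n" "0 \<le> i" "i \<le> int m" "0 \<le> j" "j \<le> int m" using pq by (auto simp: V)
    consider "x = y" "i = j" | "x = y" "j = i + 1" | "x = y" "i = j + 1" | "i = j" "lattice_adj x y"
    proof -
      have "\<bar>i - j\<bar> \<le> 1 \<longleftrightarrow> i = j \<or> j = i + 1 \<or> i = j + 1" by auto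
      then show ?thesis
        using adj ij that by (auto simp: adj_eq_cart_prod_path adj_eq_int_lattice)
    qed
    then have "adj_eq G (F (nat i) x) (F (nat j) y)"
    proof cases
      case 2
      then show ?thesis using F(3)[of "nat i"] ij by (auto simp: based_step_def nat_add_distrib)
    next
      case 3
      then show ?thesis using F(3)[of "nat j"] ij by (auto simp: based_step_def nat_add_distrib intro: sy)
    next
      case 4
      then show ?thesis using Fb[of "nat i"] ij by (auto simp: based_maps_iff graph_hom_int_lattice)
    qed simp
    then show "adj_eq G (h p) (h q)" using pq by (simp add: h_def)
  qed
  moreover have "g \<in> based_maps n G v0" using Fb[of m] F(2) by simp
  ultimately show "(f, g) \<in> based_homotopy_rel n G v0"
    unfolding based_homotopy_rel_def using a slice F(1,2) Fb by (auto intro!: exI[of _ m] bexI[of _ h])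
qed

section \<open>Based homotopy as an equivalence relation\<close>

locale pointed_graph =
  fixes G :: "'v ugraph" and v0 :: 'v
  assumes pointed: "is_pointed_graph G v0"
begin

lemma edges_sym: "sym (edges G)"
  using pointed by (simp add: is_pointed_graph_def is_graph_def)

lemma base_in_verts: "v0 \<in> verts G"
  using pointed by (simp add: is_pointed_graph_def)

lemma adj_sym: "adj_eq G u v \<Longrightarrow> adj_eq G v u"
  using edges_sym by (auto simp: adj_eq_def sym_def)

abbreviation based :: "nat \<Rightarrow> (int list \<Rightarrow> 'v) set" where
  "based n \<equiv> based_maps n G v0"

abbreviation htpy :: "nat \<Rightarrow> (int list \<Rightarrow> 'v) \<Rightarrow> (int list \<Rightarrow> 'v) \<Rightarrow> bool" where
  "htpy n f g \<equiv> (f, g) \<in> based_homotopy_rel n G v0"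

abbreviation hclass :: "nat \<Rightarrow> (int list \<Rightarrow> 'v) \<Rightarrow> (int list \<Rightarrow> 'v) set" where
  "hclass n \<equiv> htpy_class n G v0"

abbreviation hgroup :: "nat \<Rightarrow> (int list \<Rightarrow> 'v) set monoid" where
  "hgroup n \<equiv> homotopy_gp n G v0"

lemmas htpy_iff = based_homotopy_rel_iff[OF edges_sym]

lemma step_sym: "based_step n G v0 f g \<Longrightarrow> based_step n G v0 g f"
  by (auto simp: based_step_def intro: adj_sym)

lemma htpy_based: "htpy n f g \<Longrightarrow> f \<in> based n" "htpy n f g \<Longrightarrow> g \<in> based n"
  by (auto simp: based_homotopy_rel_def)

lemma htpy_refl: "f \<in> based n \<Longrightarrow> htpy n f f"
  by (simp add: htpy_iff)

lemma htpy_step: "based_step n G v0 f g \<Longrightarrow> htpy n f g"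
  by (auto simp: htpy_iff based_step_def)

lemma htpy_trans: "htpy n f g \<Longrightarrow> htpy n g h \<Longrightarrow> htpy n f h"
  by (auto simp: htpy_iff)

lemma htpy_sym: "htpy n f g \<Longrightarrow> htpy n g f"
proof -
  assume fg: "htpy n f g"
  have "symp (based_step n G v0)" by (auto intro: sympI step_sym)
  then have "symp ((based_step n G v0)\<^sup>*\<^sup>*)" by (rule symp_rtranclp)
  then show ?thesis using fg htpy_based[OF fg] by (auto simp: htpy_iff dest: sympD)
qed

lemma equiv_htpy: "equiv (based n) (based_homotopy_rel n G v0)"
  by (rule equivI) (auto intro!: refl_onI symI transI intro: htpy_refl htpy_sym htpy_trans dest: htpy_based)

lemma hclass_eq_iff: "f \<in> based n \<Longrightarrow> g \<in> based n \<Longrightarrow> hclass n f = hclass n g \<longleftrightarrow> htpy n f g"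
  unfolding htpy_class_def using eq_equiv_class_iff[OF equiv_htpy] by blast

lemma hclass_eqI: "htpy n f g \<Longrightarrow> hclass n f = hclass n g"
  using hclass_eq_iff htpy_based by blast

lemma carrier_homotopy_gp: "carrier (hgroup n) = hclass n ` based n"
  by (auto simp: homotopy_gp_def quotient_def htpy_class_def)

lemma mem_hclass: "g \<in> hclass n f \<longleftrightarrow> htpy n f g"
  by (simp add: htpy_class_def)

text \<open>With this rule a homotopy is met only one step at a time.\<close>

lemma htpy_induct [consumes 1, case_names refl step]:
  assumes "htpy n f g" "\<And>f. f \<in> based n \<Longrightarrow> P f f"
    and "\<And>f g h. htpy n f g \<Longrightarrow> P f g \<Longrightarrow> based_step n G v0 g h \<Longrightarrow> P f h"
  shows "P f g"
proof -
  have f: "f \<in> based n" and "(based_step n G v0)\<^sup>*\<^sup>* f g" using assms(1) by (auto simp: htpy_iff)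
  from this(2) have "htpy n f g \<and> P f g"
  proof (induction rule: rtranclp_induct)
    case base
    then show ?case using f assms(2) htpy_refl by blast
  next
    case (step g h)
    then show ?case using assms(3) htpy_trans htpy_step by blast
  qed
  then show ?thesis ..
qed

lemma based_adj_hd:
  assumes "f \<in> based (Suc m)" "length x = m" "\<bar>t - s\<bar> \<le> 1"
  shows "adj_eq G (f (t # x)) (f (s # x))"
proof (cases "t = s")
  case False
  then have "lattice_adj (t # x) (s # x)" using assms by simp
  then show ?thesis using assms by (auto simp: based_maps_iff graph_hom_int_lattice)
qed simp

lemma based_adj_tl:
  assumes "f \<in> based (Suc m)" "length x = m" "lattice_adj x y"
  shows "adj_eq G (f (t # x)) (f (t # y))"
  using assms lattice_adj_length[OF assms(3)] by (auto simp: based_maps_iff graph_hom_int_lattice)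

lemma based_in_verts: "f \<in> based n \<Longrightarrow> length x = n \<Longrightarrow> f x \<in> verts G"
  by (simp add: based_maps_iff graph_hom_int_lattice)

lemma lattice_adj_ConsE:
  assumes "lattice_adj x y" "length x = Suc m"
  obtains t z s w where "x = t # z" "y = s # w" "length z = m" "length w = m"
    "\<bar>t - s\<bar> = 1 \<and> z = w \<or> t = s \<and> lattice_adj z w"
proof -
  obtain t z s w where "x = t # z" "y = s # w"
    using assms by (cases x; cases y) auto
  then show ?thesis using assms that[of t z s w] lattice_adj_length[of z w] by auto
qed

definition reparam :: "nat \<Rightarrow> (int \<Rightarrow> int) \<Rightarrow> (int list \<Rightarrow> 'v) \<Rightarrow> (int list \<Rightarrow> 'v)" where
  "reparam n p f = (\<lambda>x\<in>{x. length x = n}. f (p (hd x) # tl x))"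

text \<open>Neighbours stay neighbours or coincide, and far points stay far. Shifts, the reflection
  and the foldings of the first coordinate are all of this kind.\<close>

lemma reparam_based:
  assumes f: "f \<in> based (Suc m)" "vanishes_beyond (Suc m) v0 f r"
    and p: "\<And>t. \<bar>p (t + 1) - p t\<bar> \<le> 1" "\<And>t. int r' \<le> \<bar>t\<bar> \<Longrightarrow> int r \<le> \<bar>p t\<bar>" "r \<le> r'"
  shows "reparam (Suc m) p f \<in> based (Suc m)"
  unfolding reparam_def
proof (rule based_mapsI[of _ _ _ r'])
  fix x :: "int list" assume x: "length x = Suc m"
  then show "f (p (hd x) # tl x) \<in> verts G" using f by (auto intro: based_in_verts)
  fix t assume "t \<in> set x" "int r' \<le> \<bar>t\<bar>"
  then have "p (hd x) \<in> set (p (hd x) # tl x) \<and> int r \<le> \<bar>p (hd x)\<bar> \<or> t \<in> set (p (hd x) # tl x) \<and> int r \<le> \<bar>t\<bar>"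
    using p x by (cases x) auto
  then show "f (p (hd x) # tl x) = v0" using vanishes_beyondD[OF f(2)] x by (metis length_Cons length_tl diff_Suc_1)
next
  fix x y assume xy: "length x = Suc m" "length y = Suc m" "lattice_adj x y"
  obtain t z s w where *: "x = t # z" "y = s # w" "length z = m" "length w = m"
    "\<bar>t - s\<bar> = 1 \<and> z = w \<or> t = s \<and> lattice_adj z w"
    using lattice_adj_ConsE[OF xy(3,1)] .
  have "\<bar>p t - p s\<bar> \<le> 1" if "\<bar>t - s\<bar> = 1"
  proof -
    have "t = s + 1 \<or> s = t + 1" using that by auto
    then show ?thesis using p(1)[of s] p(1)[of t] by auto
  qed
  then show "adj_eq G (f (p (hd x) # tl x)) (f (p (hd y) # tl y))"
    using * based_adj_hd[OF f(1)] based_adj_tl[OF f(1)] by auto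
qed

lemma reparam_step:
  assumes "f \<in> based (Suc m)" "reparam (Suc m) p f \<in> based (Suc m)" "reparam (Suc m) q f \<in> based (Suc m)"
    and "\<And>t. \<bar>p t - q t\<bar> \<le> 1"
  shows "based_step (Suc m) G v0 (reparam (Suc m) p f) (reparam (Suc m) q f)"
  unfolding based_step_def using assms by (auto simp: reparam_def intro!: based_adj_hd)

lemma reparam_id: "f \<in> based (Suc m) \<Longrightarrow> reparam (Suc m) (\<lambda>t. t) f = f"
proof (rule extensionalityI[of _ "{x. length x = Suc m}"])
  fix x :: "int list" assume "x \<in> {x. length x = Suc m}"
  then show "reparam (Suc m) (\<lambda>t. t) f x = f x" by (cases x) (auto simp: reparam_def)
qed (auto simp: reparam_def based_maps_iff)

text \<open>The product of based maps, with the cut and the translation no longer tied to the radii.\<close>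

definition join :: "nat \<Rightarrow> int \<Rightarrow> int \<Rightarrow> (int list \<Rightarrow> 'v) \<Rightarrow> (int list \<Rightarrow> 'v) \<Rightarrow> (int list \<Rightarrow> 'v)" where
  "join n a c f g = (\<lambda>x\<in>{x. length x = n}. if hd x \<le> a then f x else g ((hd x - c) # tl x))"

text \<open>Both pieces rest at the base point on the cut: \<open>f\<close> from \<open>a\<close>
  on, and the translate of \<open>g\<close> by \<open>c\<close> up to \<open>a\<close>. The
  conditions are one-sided, so a piece may itself be a join reaching far to one side.\<close>

definition joinable :: "nat \<Rightarrow> int \<Rightarrow> int \<Rightarrow> (int list \<Rightarrow> 'v) \<Rightarrow> (int list \<Rightarrow> 'v) \<Rightarrow> bool" where
  "joinable n a c f g \<longleftrightarrow> f \<in> based n \<and> g \<in> based n \<and>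
     (\<forall>t x. length (t # x) = n \<longrightarrow> a \<le> t \<longrightarrow> f (t # x) = v0) \<and>
     (\<forall>t x. length (t # x) = n \<longrightarrow> t \<le> a - c \<longrightarrow> g (t # x) = v0)"

lemma joinableI:
  assumes "f \<in> based n" "g \<in> based n" "vanishes_beyond n v0 f r" "vanishes_beyond n v0 g s"
    and "int r \<le> a" "int s \<le> c - a"
  shows "joinable n a c f g"
  unfolding joinable_def
proof (intro conjI allI impI assms(1,2))
  fix t and x :: "int list" assume x: "length (t # x) = n"
  show "f (t # x) = v0" if "a \<le> t"
    using that assms(5) x by (intro vanishes_beyondD[OF assms(3), of _ t]) auto
  show "g (t # x) = v0" if "t \<le> a - c"
    using that assms(6) x by (intro vanishes_beyondD[OF assms(4), of _ t]) auto
qed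

lemma join_based:
  assumes j: "joinable (Suc m) a c f g"
  shows "join (Suc m) a c f g \<in> based (Suc m)"
proof -
  have f: "f \<in> based (Suc m)" "\<And>t x. length x = m \<Longrightarrow> a \<le> t \<Longrightarrow> f (t # x) = v0"
    and g: "g \<in> based (Suc m)" "\<And>t x. length x = m \<Longrightarrow> t \<le> a - c \<Longrightarrow> g (t # x) = v0"
    using j by (auto simp: joinable_def)
  obtain r s where r: "vanishes_beyond (Suc m) v0 f r" and s: "vanishes_beyond (Suc m) v0 g s"
    using f(1) g(1) by (auto simp: based_maps_iff)
  show ?thesis
    unfolding join_def
  \<comment> \<open>The term \<open>nat \<bar>c\<bar>\<close> keeps a translated first coordinate
    beyond the bound \<open>s\<close> of \<open>g\<close>.\<close>
  proof (rule based_mapsI[of _ _ _ "r + s + nat \<bar>c\<bar>"])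
    fix x :: "int list" assume x: "length x = Suc m"
    then show "(if hd x \<le> a then f x else g ((hd x - c) # tl x)) \<in> verts G"
      using f g by (auto intro: based_in_verts)
    fix t assume t: "t \<in> set x" "int (r + s + nat \<bar>c\<bar>) \<le> \<bar>t\<bar>"
    have "f x = v0" using t x by (intro vanishes_beyondD[OF r]) auto
    moreover have "g ((hd x - c) # tl x) = v0"
      using t x vanishes_beyondD[OF s, of "(hd x - c) # tl x" "hd x - c"]
        vanishes_beyondD[OF s, of "(hd x - c) # tl x" t] by (cases x) auto
    ultimately show "(if hd x \<le> a then f x else g ((hd x - c) # tl x)) = v0" by simp
  next
    fix x y assume xy: "length x = Suc m" "length y = Suc m" "lattice_adj x y"
    obtain t z s w where *: "x = t # z" "y = s # w" "length z = m" "length w = m"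
      "\<bar>t - s\<bar> = 1 \<and> z = w \<or> t = s \<and> lattice_adj z w"
      using lattice_adj_ConsE[OF xy(3,1)] .
    \<comment> \<open>Across the cut one passes from \<open>v0\<close> to the slice of
      \<open>g\<close> at \<open>a + 1 - c\<close>, which is adjacent to the slice of
      \<open>g\<close> at \<open>a - c\<close>, and that one is \<open>v0\<close>.\<close>
    have cut: "adj_eq G v0 (g ((a + 1 - c) # z))"
      using based_adj_hd[OF g(1) *(3), of "a - c" "a + 1 - c"] g(2)[OF *(3), of "a - c"] by simp
    consider "t = s" "lattice_adj z w" | "z = w" "t \<le> a" "s \<le> a" "\<bar>t - s\<bar> = 1" | "z = w" "a < t" "a < s" "\<bar>t - s\<bar> = 1"
      | "z = w" "t = a" "s = a + 1" | "z = w" "s = a" "t = a + 1"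
      using *(5) by linarith
    then show "adj_eq G (if hd x \<le> a then f x else g ((hd x - c) # tl x))
        (if hd y \<le> a then f y else g ((hd y - c) # tl y))"
      by cases (use * cut f(2) based_adj_tl[OF f(1)] based_adj_tl[OF g(1)] based_adj_hd[OF f(1)]
          based_adj_hd[OF g(1)] in \<open>auto intro: adj_sym\<close>)
  qed
qed

lemma join_step_left:
  assumes "joinable (Suc m) a c f g" "joinable (Suc m) a c f' g" "based_step (Suc m) G v0 f f'"
  shows "based_step (Suc m) G v0 (join (Suc m) a c f g) (join (Suc m) a c f' g)"
  using assms(3) join_based[OF assms(1)] join_based[OF assms(2)]
  by (auto simp: based_step_def join_def)

lemma join_step_right:
  assumes "joinable (Suc m) a c f g" "joinable (Suc m) a c f g'" "based_step (Suc m) G v0 g g'"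
  shows "based_step (Suc m) G v0 (join (Suc m) a c f g) (join (Suc m) a c f g')"
  using assms(3) join_based[OF assms(1)] join_based[OF assms(2)]
  by (auto simp: based_step_def join_def)

lemma joinable_Suc: "joinable n a c f g \<Longrightarrow> joinable n a (c + int k) f g"
  by (auto simp: joinable_def)

text \<open>\<open>g\<close> moves away from the cut by one unit per step; the gap is filled with
  the base point.\<close>

lemma htpy_join_translate:
  assumes "joinable (Suc m) a c f g"
  shows "htpy (Suc m) (join (Suc m) a c f g) (join (Suc m) a (c + int k) f g)"
proof (induction k)
  case 0
  then show ?case using htpy_refl join_based[OF assms] by simp
next
  case (Suc k)
  have "based_step (Suc m) G v0 (join (Suc m) a (c + int k) f g) (join (Suc m) a (c + int (Suc k)) f g)"
    unfolding based_step_def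
    using join_based[OF joinable_Suc[OF assms]] assms
    by (auto simp: join_def joinable_def simp del: of_nat_Suc intro!: based_adj_hd)
  then show ?case using Suc htpy_trans htpy_step by blast
qed

text \<open>Between the two cuts \<open>f\<close> and the translate of \<open>g\<close> are both at
  the base point.\<close>

lemma join_cut:
  assumes "joinable (Suc m) a c f g" "joinable (Suc m) a' c f g" "a \<le> a'"
  shows "join (Suc m) a c f g = join (Suc m) a' c f g"
  unfolding join_def
proof (rule restrict_ext)
  fix x :: "int list" assume "x \<in> {x. length x = Suc m}"
  then obtain t z where "x = t # z" "length z = m" by (cases x) auto
  then show "(if hd x \<le> a then f x else g ((hd x - c) # tl x)) = (if hd x \<le> a' then f x else g ((hd x - c) # tl x))"
    using assms by (auto simp: joinable_def)
qed

text \<open>Both joins are moved to the larger of the two translations, and for equal translations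
  the cut does not matter. This frees the product from the radii.\<close>

lemma htpy_join_unique:
  assumes "joinable (Suc m) a c f g" "joinable (Suc m) a' c' f g"
  shows "htpy (Suc m) (join (Suc m) a c f g) (join (Suc m) a' c' f g)"
proof -
  define d where "d = max c c'"
  have d: "c + int (nat (d - c)) = d" "c' + int (nat (d - c')) = d" by (auto simp: d_def)
  have "joinable (Suc m) a d f g" "joinable (Suc m) a' d f g"
    using joinable_Suc[OF assms(1), of "nat (d - c)"] joinable_Suc[OF assms(2), of "nat (d - c')"]
    unfolding d by simp_all
  then have "join (Suc m) a d f g = join (Suc m) a' d f g"
    using join_cut[of m a d f g a'] join_cut[of m a' d f g a] by (metis linear)
  then show ?thesis
    using htpy_join_translate[OF assms(1), of "nat (d - c)"] htpy_join_translate[OF assms(2), of "nat (d - c')"]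
    unfolding d by (metis htpy_trans htpy_sym)
qed

section \<open>The product of homotopy classes\<close>

abbreviation bconcat :: "nat \<Rightarrow> (int list \<Rightarrow> 'v) \<Rightarrow> (int list \<Rightarrow> 'v) \<Rightarrow> (int list \<Rightarrow> 'v)" where
  "bconcat n \<equiv> based_concat n v0"

lemma concat_join:
  assumes "f \<in> based n" "g \<in> based n"
  shows "\<exists>a c. joinable n a c f g \<and> bconcat n f g = join n a c f g"
proof (intro exI conjI)
  show "joinable n (int (radius n v0 f)) (int (radius n v0 f) + int (radius n v0 g)) f g"
    using assms by (intro joinableI[OF _ _ based_maps_vanish based_maps_vanish]) auto
  show "bconcat n f g = join n (int (radius n v0 f)) (int (radius n v0 f) + int (radius n v0 g)) f g"
    by (simp add: based_concat_def join_def verts_int_lattice)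
qed

lemma concat_based: "f \<in> based (Suc m) \<Longrightarrow> g \<in> based (Suc m) \<Longrightarrow> bconcat (Suc m) f g \<in> based (Suc m)"
  using concat_join join_based by metis

lemma htpy_concat_join:
  "joinable (Suc m) a c f g \<Longrightarrow> htpy (Suc m) (bconcat (Suc m) f g) (join (Suc m) a c f g)"
  using concat_join htpy_join_unique joinable_def by metis

lemma common_joinable:
  assumes "f \<in> based n" "f' \<in> based n" "g \<in> based n" "g' \<in> based n"
  obtains a c where "joinable n a c f g" "joinable n a c f' g" "joinable n a c f g'" "joinable n a c f' g'"
proof -
  define r where "r = max (radius n v0 f) (radius n v0 f')"
  define s where "s = max (radius n v0 g) (radius n v0 g')"
  have "vanishes_beyond n v0 f r" "vanishes_beyond n v0 f' r" "vanishes_beyond n v0 g s" "vanishes_beyond n v0 g' s"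
    using assms by (auto simp: r_def s_def intro: vanishes_beyond_mono based_maps_vanish)
  then show ?thesis using assms by (intro that[of "int r" "int r + int s"] joinableI) auto
qed

text \<open>The radius may change along the homotopy, so each step is carried out for joins whose
  cut and translation suit both maps.\<close>

lemma htpy_concat_left:
  assumes "htpy (Suc m) f f'" "g \<in> based (Suc m)"
  shows "htpy (Suc m) (bconcat (Suc m) f g) (bconcat (Suc m) f' g)"
  using assms(1)
proof (induction rule: htpy_induct)
  case (refl f)
  then show ?case using assms(2) by (simp add: concat_based htpy_refl)
next
  case (step f f' f'')
  have "f' \<in> based (Suc m)" "f'' \<in> based (Suc m)" using step(2) by (auto simp: based_step_def)
  then obtain a c where "joinable (Suc m) a c f' g" "joinable (Suc m) a c f'' g"
    using common_joinable assms(2) by metis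
  then have "htpy (Suc m) (bconcat (Suc m) f' g) (bconcat (Suc m) f'' g)"
    using htpy_concat_join join_step_left step(2) by (meson htpy_step htpy_sym htpy_trans)
  with step(3) show ?case by (rule htpy_trans)
qed

lemma htpy_concat_right:
  assumes "htpy (Suc m) g g'" "f \<in> based (Suc m)"
  shows "htpy (Suc m) (bconcat (Suc m) f g) (bconcat (Suc m) f g')"
  using assms(1)
proof (induction rule: htpy_induct)
  case (refl g)
  then show ?case using assms(2) by (simp add: concat_based htpy_refl)
next
  case (step g g' g'')
  have "g' \<in> based (Suc m)" "g'' \<in> based (Suc m)" using step(2) by (auto simp: based_step_def)
  then obtain a c where "joinable (Suc m) a c f g'" "joinable (Suc m) a c f g''"
    using common_joinable assms(2) by metis
  then have "htpy (Suc m) (bconcat (Suc m) f g') (bconcat (Suc m) f g'')"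
    using htpy_concat_join join_step_right step(2) by (meson htpy_step htpy_sym htpy_trans)
  with step(3) show ?case by (rule htpy_trans)
qed

text \<open>The union over all representatives is a single class, since concatenation respects
  homotopy in both arguments.\<close>

lemma mult_hclass:
  assumes "f \<in> based (Suc m)" "g \<in> based (Suc m)"
  shows "hclass (Suc m) f \<otimes>\<^bsub>hgroup (Suc m)\<^esub> hclass (Suc m) g = hclass (Suc m) (bconcat (Suc m) f g)"
proof -
  have "hclass (Suc m) (bconcat (Suc m) f' g') = hclass (Suc m) (bconcat (Suc m) f g)"
    if "f' \<in> hclass (Suc m) f" "g' \<in> hclass (Suc m) g" for f' g'
  proof (rule hclass_eqI)
    have "htpy (Suc m) f f'" "htpy (Suc m) g g'" using that by (auto simp: mem_hclass)
    then show "htpy (Suc m) (bconcat (Suc m) f' g') (bconcat (Suc m) f g)"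
      using assms(2) htpy_based htpy_concat_left htpy_concat_right by (meson htpy_sym htpy_trans)
  qed
  moreover have "f \<in> hclass (Suc m) f" "g \<in> hclass (Suc m) g"
    using assms by (auto simp: mem_hclass htpy_refl)
  moreover have "hclass (Suc m) f \<otimes>\<^bsub>hgroup (Suc m)\<^esub> hclass (Suc m) g
      = (\<Union>f'\<in>hclass (Suc m) f. \<Union>g'\<in>hclass (Suc m) g. hclass (Suc m) (bconcat (Suc m) f' g'))"
    by (simp add: homotopy_gp_def)
  ultimately show ?thesis by blast
qed

section \<open>Group axioms\<close>

abbreviation const_map :: "nat \<Rightarrow> int list \<Rightarrow> 'v" where
  "const_map n \<equiv> (\<lambda>x\<in>verts (int_lattice n). v0)"

lemma const_map_based: "const_map n \<in> based n"
  unfolding verts_int_lattice by (rule based_mapsI) (auto simp: base_in_verts)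

lemma const_map_vanishes: "vanishes_beyond n v0 (const_map n) r"
  by (auto simp: verts_int_lattice intro: vanishes_beyondI)

lemma one_homotopy_gp: "\<one>\<^bsub>hgroup n\<^esub> = hclass n (const_map n)"
  by (simp add: homotopy_gp_def)

lemma vanishes_hd:
  "vanishes_beyond (Suc m) v0 f r \<Longrightarrow> length x = m \<Longrightarrow> int r \<le> \<bar>t\<bar> \<Longrightarrow> f (t # x) = v0"
  by (rule vanishes_beyondD[of "Suc m" v0 f r "t # x" t]) auto

lemma reparam_eqI:
  assumes "f \<in> extensional {x. length x = Suc m}" "\<And>t x. length x = m \<Longrightarrow> f (t # x) = g (p t # x)"
  shows "f = reparam (Suc m) p g"
proof (rule extensionalityI[OF assms(1)])
  fix x :: "int list" assume "x \<in> {x. length x = Suc m}"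
  then obtain t z where "x = t # z" "length z = m" by (cases x) auto
  then show "f x = reparam (Suc m) p g x" using assms(2) by (simp add: reparam_def)
qed (simp add: reparam_def)

lemma htpy_shift:
  assumes f: "f \<in> based (Suc m)"
  shows "htpy (Suc m) f (reparam (Suc m) (\<lambda>t. t - int k) f)"
proof (induction k)
  case 0
  then show ?case using htpy_refl f by (simp add: reparam_id)
next
  case (Suc k)
  obtain r where r: "vanishes_beyond (Suc m) v0 f r" using f by (auto simp: based_maps_iff)
  have "reparam (Suc m) (\<lambda>t. t - int k) f \<in> based (Suc m)" for k
    by (rule reparam_based[OF f r, of _ "r + k"]) auto
  from reparam_step[OF f this this, of k "Suc k"]
  show ?case using Suc htpy_trans htpy_step by fastforce
qed

text \<open>Joining with the constant map on the left amounts to translating \<open>f\<close> by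
  \<open>r + r\<close>.\<close>

lemma htpy_one_concat:
  assumes f: "f \<in> based (Suc m)"
  shows "htpy (Suc m) (bconcat (Suc m) (const_map (Suc m)) f) f"
proof -
  obtain r where r: "vanishes_beyond (Suc m) v0 f r" using f by (auto simp: based_maps_iff)
  have j: "joinable (Suc m) (int r) (int r + int r) (const_map (Suc m)) f"
    using f r const_map_based const_map_vanishes by (intro joinableI) auto
  have "join (Suc m) (int r) (int r + int r) (const_map (Suc m)) f = reparam (Suc m) (\<lambda>t. t - int (r + r)) f"
    using vanishes_hd[OF r] by (intro reparam_eqI) (auto simp: join_def verts_int_lattice)
  then show ?thesis
    using htpy_concat_join[OF j] htpy_shift[OF f, of "r + r"] htpy_sym htpy_trans by metis
qed

text \<open>The join of the reflected map with \<open>f\<close> is \<open>f\<close> precomposed with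
  a folding of the first coordinate, which can be pushed out of the support of
  \<open>f\<close>.\<close>

lemma htpy_inverse_concat:
  assumes f: "f \<in> based (Suc m)"
  shows "reparam (Suc m) uminus f \<in> based (Suc m)"
    and "htpy (Suc m) (bconcat (Suc m) (reparam (Suc m) uminus f) f) (const_map (Suc m))"
proof -
  obtain r where r: "vanishes_beyond (Suc m) v0 f r" using f by (auto simp: based_maps_iff)
  show b: "reparam (Suc m) uminus f \<in> based (Suc m)"
    by (rule reparam_based[OF f r, of _ r]) auto
  have "vanishes_beyond (Suc m) v0 (reparam (Suc m) uminus f) r"
  proof (rule vanishes_beyondI)
    fix x t assume x: "length x = Suc m" "t \<in> set x" "int r \<le> \<bar>t\<bar>"
    then obtain s z where "x = s # z" "length z = m" by (cases x) auto
    then show "reparam (Suc m) uminus f x = v0"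
      using x vanishes_beyondD[OF r, of "- s # z" "- s"] vanishes_beyondD[OF r, of "- s # z" t]
      by (auto simp: reparam_def)
  qed
  then have j: "joinable (Suc m) (int r) (int r + int r) (reparam (Suc m) uminus f) f"
    using f r b by (intro joinableI) auto
  \<comment> \<open>\<open>p 0\<close> is the folding at \<open>int r\<close>: it is
    \<open>- t\<close> before and \<open>t - 2 * int r\<close> after. Increasing \<open>k\<close>
    raises the lowest values; at \<open>k = 2 * r\<close> all values are at least
    \<open>int r\<close>, where \<open>f\<close> is \<open>v0\<close>.\<close>
  define p where "p k t = max (\<bar>t - int r\<bar> - int r) (int k - int r)" for k t
  have pb: "reparam (Suc m) (p k) f \<in> based (Suc m)" for k
    by (rule reparam_based[OF f r, of _ "3 * r"]) (auto simp: p_def)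
  have "join (Suc m) (int r) (int r + int r) (reparam (Suc m) uminus f) f = reparam (Suc m) (p 0) f"
    by (intro reparam_eqI) (auto simp: join_def p_def reparam_def)
  moreover have "htpy (Suc m) (reparam (Suc m) (p 0) f) (reparam (Suc m) (p k) f)" for k
  proof (induction k)
    case (Suc k)
    have "based_step (Suc m) G v0 (reparam (Suc m) (p k) f) (reparam (Suc m) (p (Suc k)) f)"
      by (rule reparam_step[OF f pb pb]) (auto simp: p_def)
    then show ?case using Suc htpy_trans htpy_step by blast
  qed (simp add: htpy_refl pb)
  moreover have "const_map (Suc m) = reparam (Suc m) (p (2 * r)) f"
    using vanishes_hd[OF r] by (intro reparam_eqI) (auto simp: verts_int_lattice p_def)
  ultimately show "htpy (Suc m) (bconcat (Suc m) (reparam (Suc m) uminus f) f) (const_map (Suc m))"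
    using htpy_concat_join[OF j] htpy_trans by metis
qed

text \<open>With a common radius \<open>R\<close> the three pieces are centred at \<open>0\<close>,
  \<open>2 * R\<close> and \<open>4 * R\<close> and cut at \<open>R\<close> and
  \<open>3 * R\<close>; both bracketings are then the same map.\<close>

lemma htpy_concat_assoc:
  assumes f: "f \<in> based (Suc m)" and g: "g \<in> based (Suc m)" and h: "h \<in> based (Suc m)"
  shows "htpy (Suc m) (bconcat (Suc m) (bconcat (Suc m) f g) h) (bconcat (Suc m) f (bconcat (Suc m) g h))"
proof -
  define r where "r = Max {radius (Suc m) v0 f, radius (Suc m) v0 g, radius (Suc m) v0 h}"
  define R where "R = int r"
  have r: "vanishes_beyond (Suc m) v0 f r" "vanishes_beyond (Suc m) v0 g r" "vanishes_beyond (Suc m) v0 h r"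
    using assms by (auto simp: r_def intro: vanishes_beyond_mono based_maps_vanish)
  note van = vanishes_hd[OF r(1)] vanishes_hd[OF r(2)] vanishes_hd[OF r(3)]
  define p where "p = join (Suc m) R (2 * R) f g"
  define q where "q = join (Suc m) R (2 * R) g h"
  have fg: "joinable (Suc m) R (2 * R) f g" and gh: "joinable (Suc m) R (2 * R) g h"
    using assms r by (auto intro!: joinableI simp: R_def)
  have pb: "p \<in> based (Suc m)" and qb: "q \<in> based (Suc m)"
    using join_based fg gh by (auto simp: p_def q_def)
  have ph: "joinable (Suc m) (3 * R) (4 * R) p h"
    unfolding joinable_def using pb h van by (auto simp: p_def join_def R_def)
  have fq: "joinable (Suc m) R (2 * R) f q"
    unfolding joinable_def using qb f van by (auto simp: q_def join_def R_def)
  have "join (Suc m) (3 * R) (4 * R) p h = join (Suc m) R (2 * R) f q"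
    unfolding join_def[of _ "3 * R"] join_def[of _ R _ f q]
  proof (rule restrict_ext)
    fix x :: "int list" assume "x \<in> {x. length x = Suc m}"
    then obtain t z where x: "x = t # z" "length z = m" by (cases x) auto
    show "(if hd x \<le> 3 * R then p x else h ((hd x - 4 * R) # tl x)) =
        (if hd x \<le> R then f x else q ((hd x - 2 * R) # tl x))"
      using x by (auto simp: p_def q_def join_def R_def)
  qed
  moreover have "htpy (Suc m) (bconcat (Suc m) (bconcat (Suc m) f g) h) (bconcat (Suc m) p h)"
    using htpy_concat_left[OF htpy_concat_join[OF fg] h] by (simp add: p_def)
  moreover have "htpy (Suc m) (bconcat (Suc m) f (bconcat (Suc m) g h)) (bconcat (Suc m) f q)"
    using htpy_concat_right[OF htpy_concat_join[OF gh] f] by (simp add: q_def)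
  ultimately show ?thesis
    using htpy_concat_join[OF ph] htpy_concat_join[OF fq] by (metis htpy_sym htpy_trans)
qed

lemma group_homotopy_gp: "group (hgroup (Suc m))"
proof (rule groupI)
  fix X Y Z assume XYZ: "X \<in> carrier (hgroup (Suc m))"
    "Y \<in> carrier (hgroup (Suc m))" "Z \<in> carrier (hgroup (Suc m))"
  show "X \<otimes>\<^bsub>hgroup (Suc m)\<^esub> Y \<in> carrier (hgroup (Suc m))"
    using XYZ by (auto simp: carrier_homotopy_gp mult_hclass concat_based)
  show "X \<otimes>\<^bsub>hgroup (Suc m)\<^esub> Y \<otimes>\<^bsub>hgroup (Suc m)\<^esub> Z =
      X \<otimes>\<^bsub>hgroup (Suc m)\<^esub> (Y \<otimes>\<^bsub>hgroup (Suc m)\<^esub> Z)"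
  proof -
    obtain f g h where fgh: "f \<in> based (Suc m)" "g \<in> based (Suc m)" "h \<in> based (Suc m)"
      and [simp]: "X = hclass (Suc m) f" "Y = hclass (Suc m) g" "Z = hclass (Suc m) h"
      using XYZ unfolding carrier_homotopy_gp by blast
    show ?thesis
      using fgh hclass_eqI[OF htpy_concat_assoc[OF fgh]] by (simp add: mult_hclass concat_based)
  qed
next
  fix X assume X: "X \<in> carrier (hgroup (Suc m))"
  then obtain f where f: "f \<in> based (Suc m)" "X = hclass (Suc m) f" by (auto simp: carrier_homotopy_gp)
  show "\<one>\<^bsub>hgroup (Suc m)\<^esub> \<otimes>\<^bsub>hgroup (Suc m)\<^esub> X = X"
    using f by (simp add: one_homotopy_gp mult_hclass const_map_based hclass_eqI htpy_one_concat)
  show "\<exists>Y\<in>carrier (hgroup (Suc m)).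
      Y \<otimes>\<^bsub>hgroup (Suc m)\<^esub> X = \<one>\<^bsub>hgroup (Suc m)\<^esub>"
    using f htpy_inverse_concat[OF f(1)]
    by (auto simp: carrier_homotopy_gp one_homotopy_gp mult_hclass intro!: hclass_eqI)
qed (auto simp: carrier_homotopy_gp one_homotopy_gp const_map_based)

end

section \<open>Homotopy invariance and additivity of the Hurewicz chain\<close>

lemma Cons_in_lattice_box:
  "t # x \<in> lattice_box (b # bs) \<longleftrightarrow> fst b \<le> t \<and> t < snd b \<and> x \<in> lattice_box bs"
  by auto

context pointed_graph
begin

lemma null_homologous_htpy:
  assumes "htpy n f g"
  shows "null_homologous n G (hurewicz_chain n v0 g - hurewicz_chain n v0 f)"
  using assms
proof (induction rule: htpy_induct)
  case (step f g h)
  define r where "r = max (radius n v0 g) (radius n v0 h)"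
  have "g \<in> based n" "h \<in> based n" using step(2) by (auto simp: based_step_def)
  then have "vanishes_beyond n v0 g r" "vanishes_beyond n v0 h r"
    "graph_hom g (int_lattice n) G" "graph_hom h (int_lattice n) G"
    unfolding r_def by (blast intro: vanishes_beyond_mono[OF based_maps_vanish] max.cobounded1 max.cobounded2,
      blast intro: vanishes_beyond_mono[OF based_maps_vanish] max.cobounded1 max.cobounded2,
      simp_all add: based_maps_iff)
  then have "null_homologous n G (hurewicz_chain n v0 h - hurewicz_chain n v0 g)"
    using step(2) edges_sym by (intro null_homologous_hurewicz_step) (auto simp: based_step_def)
  then show ?case using step(3) by (rule null_homologous_diff_trans)
qed simp

text \<open>Additivity holds cube by cube. The cut is a hyperplane of the lattice on which both maps
  are at the base point, so no unit cube sees more than one of them, and the normalised cube of the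
  other is \<open>0\<close>.\<close>

lemma hurewicz_chain_join:
  assumes j: "joinable (Suc m) a c f g"
  shows "hurewicz_chain (Suc m) v0 (join (Suc m) a c f g) = hurewicz_chain (Suc m) v0 f + hurewicz_chain (Suc m) v0 g"
proof -
  have f: "f \<in> based (Suc m)" "\<And>t x. length x = m \<Longrightarrow> a \<le> t \<Longrightarrow> f (t # x) = v0"
    and g: "g \<in> based (Suc m)" "\<And>t x. length x = m \<Longrightarrow> t \<le> a - c \<Longrightarrow> g (t # x) = v0"
    using j by (auto simp: joinable_def)
  define r where "r = radius (Suc m) v0 f"
  define s where "s = radius (Suc m) v0 g"
  define q where "q = radius (Suc m) v0 (join (Suc m) a c f g)"
  have van: "vanishes_beyond (Suc m) v0 f r" "vanishes_beyond (Suc m) v0 g s"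
    "vanishes_beyond (Suc m) v0 (join (Suc m) a c f g) q"
    using f(1) g(1) join_based[OF j] by (auto simp: r_def s_def q_def intro: based_maps_vanish)
  \<comment> \<open>Large enough for the supports of \<open>f\<close> and of the join, and for the
    support of \<open>g\<close> after a translation by \<open>c\<close>.\<close>
  define N where "N = r + s + q + nat \<bar>c\<bar>"
  define T where "T p x = frag_of (subcube (Suc m) p x) - frag_of (const_cube (Suc m) v0)" for p x
  define B where "B = replicate m (- int N, int N)"
  have T: "T (join (Suc m) a c f g) (t # x) = T f (t # x) + T g ((t - c) # x)" if x: "length x = m" for t x
  proof (cases "t + 1 \<le> a")
    case True
    have "subcube (Suc m) (join (Suc m) a c f g) (t # x) = subcube (Suc m) f (t # x)"
      using True x by (intro subcube_cong) (auto elim!: cube_verts_SucE simp: join_def length_cube_verts)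
    moreover have "subcube (Suc m) g ((t - c) # x) = const_cube (Suc m) v0"
      unfolding subcube_def using True x g(2)
      by (intro restrict_ext) (auto elim!: cube_verts_SucE simp: length_cube_verts)
    ultimately show ?thesis by (simp add: T_def)
  next
    case False
    have cut: "g ((a - c) # z) = v0" "f (a # z) = v0" if "length z = m" for z
      using f(2) g(2) that by auto
    have "subcube (Suc m) (join (Suc m) a c f g) (t # x) = subcube (Suc m) g ((t - c) # x)"
    proof (rule subcube_cong)
      fix b assume "b \<in> cube_verts (Suc m)"
      then obtain u d where b: "b = u # d" "u = 0 \<or> u = 1" "d \<in> cube_verts m" by (rule cube_verts_SucE)
      define z where "z = map2 (+) x d"
      have z: "length z = m" using x b by (simp add: z_def length_cube_verts)
      have sum: "map2 (+) ((t - c) # x) b = (t + u - c) # z" "map2 (+) (t # x) b = (t + u) # z"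
        using b by (auto simp: z_def)
      \<comment> \<open>On the cut itself the join still takes the value of \<open>f\<close>, which
        agrees with that of the translated \<open>g\<close>, both being \<open>v0\<close>.\<close>
      show "join (Suc m) a c f g (map2 (+) (t # x) b) = g (map2 (+) ((t - c) # x) b)"
        unfolding sum using b False z cut[OF z] by (cases "t + u = a") (auto simp: join_def)
    qed
    moreover have "subcube (Suc m) f (t # x) = const_cube (Suc m) v0"
      unfolding subcube_def using False x f(2)
      by (intro restrict_ext) (auto elim!: cube_verts_SucE simp: length_cube_verts)
    ultimately show ?thesis by (simp add: T_def)
  qed
  have "hurewicz_chain (Suc m) v0 (join (Suc m) a c f g) =
      (\<Sum>t\<in>{- int N..<int N}. \<Sum>x\<in>lattice_box B. T (join (Suc m) a c f g) (t # x))"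
    using hurewicz_chain_box[OF van(3), of N]
    by (simp add: N_def T_def B_def sum_lattice_box_Cons del: lattice_box.simps)
  also have "\<dots> = (\<Sum>t\<in>{- int N..<int N}. \<Sum>x\<in>lattice_box B. T f (t # x) + T g ((t - c) # x))"
    using T by (intro sum.cong refl) (simp add: B_def lattice_box_replicate)
  also have "\<dots> = (\<Sum>t\<in>{- int N..<int N}. \<Sum>x\<in>lattice_box B. T f (t # x)) +
      (\<Sum>t\<in>{- int N..<int N}. \<Sum>x\<in>lattice_box B. T g ((t - c) # x))"
    by (simp add: sum.distrib)
  also have "(\<Sum>t\<in>{- int N..<int N}. \<Sum>x\<in>lattice_box B. T f (t # x)) = hurewicz_chain (Suc m) v0 f"
    using hurewicz_chain_box[OF van(1), of N]
    by (simp add: N_def T_def B_def sum_lattice_box_Cons del: lattice_box.simps)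
  also have "(\<Sum>t\<in>{- int N..<int N}. \<Sum>x\<in>lattice_box B. T g ((t - c) # x))
      = (\<Sum>t\<in>{- int N - c..<int N - c}. \<Sum>x\<in>lattice_box B. T g (t # x))"
    by (rule sum.reindex_bij_witness[of _ "\<lambda>t. t + c" "\<lambda>t. t - c"]) auto
  also have "\<dots> = sum (T g) (lattice_box ((- int N - c, int N - c) # B))"
    by (simp add: sum_lattice_box_Cons del: lattice_box.simps)
  also have "\<dots> = hurewicz_chain (Suc m) v0 g"
    unfolding T_def
  proof (rule hurewicz_chain_eq[symmetric])
    have "lattice_box (replicate (Suc m) (- int s, int s)) \<subseteq> lattice_box ((- int N - c, int N - c) # B)"
    proof
      fix x assume "x \<in> lattice_box (replicate (Suc m) (- int s, int s))"
      then obtain t z where x: "x = t # z" "- int s \<le> t" "t < int s" "z \<in> lattice_box (replicate m (- int s, int s))"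
        by auto
      then have "z \<in> lattice_box B" unfolding B_def lattice_box_replicate N_def by auto
      then show "x \<in> lattice_box ((- int N - c, int N - c) # B)" 
        using x unfolding x(1) Cons_in_lattice_box by (auto simp: N_def)
    qed
    then show "cube_support (Suc m) v0 g \<subseteq> lattice_box ((- int N - c, int N - c) # B)"
      using cube_support_subset[OF van(2)] by (rule subset_trans[rotated])
    show "length x = Suc m" if "x \<in> lattice_box ((- int N - c, int N - c) # B)" for x
      using length_lattice_box[OF that] by (simp add: B_def)
  qed simp
  finally show ?thesis .
qed

lemma hurewicz_chain_concat:
  assumes "f \<in> based (Suc m)" "g \<in> based (Suc m)"
  shows "hurewicz_chain (Suc m) v0 (bconcat (Suc m) f g) = hurewicz_chain (Suc m) v0 f + hurewicz_chain (Suc m) v0 g"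
  using concat_join[OF assms] hurewicz_chain_join by metis

section \<open>Translations of based maps\<close>

definition translate :: "nat \<Rightarrow> int list \<Rightarrow> (int list \<Rightarrow> 'v) \<Rightarrow> (int list \<Rightarrow> 'v)" where
  "translate n c f = (\<lambda>x\<in>{x. length x = n}. f (map2 (-) x c))"

end

lemma lattice_adj_map2_minus:
  "lattice_adj a b \<Longrightarrow> length x = length a \<Longrightarrow> lattice_adj (map2 (-) x a) (map2 (-) x b)"
proof (induction a b arbitrary: x rule: lattice_adj.induct)
  case (1 a x b y xs)
  then show ?case by (cases xs) auto
qed auto

lemma lattice_adj_map2_minus':
  "lattice_adj a b \<Longrightarrow> length x = length a \<Longrightarrow> lattice_adj (map2 (-) a x) (map2 (-) b x)"
proof (induction a b arbitrary: x rule: lattice_adj.induct)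
  case (1 a x b y xs)
  then show ?case by (cases xs) auto
qed auto

text \<open>Supplies the path of translation vectors along which a based map is moved.\<close>

lemma lattice_connected:
  assumes "length c = length d"
  shows "lattice_adj\<^sup>*\<^sup>* c d"
  using assms
proof (induction c d rule: list_induct2)
  case (Cons t c s d)
  have hd: "lattice_adj\<^sup>*\<^sup>* (a # c) (b # c)" for a b
  proof -
    have "lattice_adj\<^sup>*\<^sup>* (a # c) ((a + int k) # c)" "lattice_adj\<^sup>*\<^sup>* (a # c) ((a - int k) # c)" for k
    proof (induction k)
      case (Suc k)
      {
        case 1
        show ?case by (rule rtranclp.rtrancl_into_rtrancl[OF Suc(1)]) simp
      next
        case 2
        show ?case by (rule rtranclp.rtrancl_into_rtrancl[OF Suc(2)]) simp
      }
    qed auto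
    from this[of "nat \<bar>b - a\<bar>"] show ?thesis by (cases "a \<le> b") auto
  qed
  have "lattice_adj\<^sup>*\<^sup>* (s # c) (s # d)"
    using Cons.IH by (induction rule: rtranclp_induct) (auto elim!: rtranclp.rtrancl_into_rtrancl)
  with hd[of t s] show ?case by (rule rtranclp_trans)
qed simp

context pointed_graph
begin

lemma translate_based:
  assumes f: "f \<in> based n" and c: "length c = n"
  shows "translate n c f \<in> based n"
proof -
  obtain r where r: "vanishes_beyond n v0 f r" using f by (auto simp: based_maps_iff)
  show ?thesis
    unfolding translate_def
  \<comment> \<open>The sum of the absolute values bounds every coordinate of \<open>c\<close>, so a
    far point is still far after the translation.\<close>
  proof (rule based_mapsI[of _ _ _ "r + nat (\<Sum>t\<leftarrow>c. \<bar>t\<bar>)"])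
    fix x t assume x: "length x = n" "t \<in> set x" "int (r + nat (\<Sum>t\<leftarrow>c. \<bar>t\<bar>)) \<le> \<bar>t\<bar>"
    then obtain i where i: "i < n" "t = x ! i" by (auto simp: in_set_conv_nth)
    have "0 \<le> (\<Sum>t\<leftarrow>c. \<bar>t\<bar>)" by (intro sum_list_nonneg) auto
    moreover have "\<bar>c ! i\<bar> \<in> set (map abs c)" using i c by auto
    then have "\<bar>c ! i\<bar> \<le> (\<Sum>t\<leftarrow>c. \<bar>t\<bar>)"
      by (intro member_le_sum_list) auto
    ultimately have "int r \<le> \<bar>map2 (-) x c ! i\<bar>" using x(1,3) i c by auto
    then show "f (map2 (-) x c) = v0"
      using x i c by (intro vanishes_beyondD[OF r, of _ "map2 (-) x c ! i"] nth_mem) auto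
  qed (use f c in \<open>auto simp: based_maps_iff graph_hom_int_lattice lattice_adj_map2_minus'\<close>)
qed

text \<open>Adjacent translation vectors give maps one step apart, because the shifted arguments are
  adjacent.\<close>

lemma htpy_translate:
  assumes f: "f \<in> based n" and c: "length c = n"
  shows "htpy n f (translate n c f)"
proof -
  have "translate n (replicate n 0) f = f"
  proof (rule extensionalityI[of _ "{x. length x = n}"])
    fix x :: "int list" assume x: "x \<in> {x. length x = n}"
    then have "map2 (-) x (replicate n 0) = x" by (intro nth_equalityI) auto
    then show "translate n (replicate n 0) f x = f x" using x by (simp add: translate_def)
  qed (use f in \<open>auto simp: translate_def based_maps_iff\<close>)
  moreover have "lattice_adj\<^sup>*\<^sup>* (replicate n 0) c" using c by (intro lattice_connected) simp
  then have "length c = n \<and> htpy n (translate n (replicate n 0) f) (translate n c f)"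
  proof (induction rule: rtranclp_induct)
    case base
    then show ?case using translate_based[OF f] htpy_refl by simp
  next
    case (step d e)
    have "length d = n" "length e = n" using step lattice_adj_length by auto
    then have "based_step n G v0 (translate n d f) (translate n e f)"
      unfolding based_step_def using step(2) f
      by (auto simp: translate_based)
        (auto simp: translate_def based_maps_iff graph_hom_int_lattice lattice_adj_map2_minus)
    then show ?case using step htpy_step htpy_trans \<open>length e = n\<close> by blast
  qed
  ultimately show ?thesis by simp
qed

section \<open>Representatives on a box\<close>

lemma verts_box_replicate:
  "x \<in> verts (int_box (replicate n m)) \<longleftrightarrow> length x = n \<and> (\<forall>t\<in>set x. 0 \<le> t \<and> t \<le> int m)"
  by (auto simp: verts_int_box all_set_conv_all_nth)

lemma extend_const_outside:
  assumes f: "f \<in> cube_based_maps n m G v0" and x: "length x = n" "t \<in> set x" "t \<le> 0 \<or> int m \<le> t"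
  shows "extend_const n m v0 f x = v0"
proof (cases "x \<in> verts (int_box (replicate n m))")
  case True
  obtain i where i: "i < n" "t = x ! i" using x by (auto simp: in_set_conv_nth)
  then have "x ! i = 0 \<or> x ! i = int m"
    using True x by (metis antisym mem_Collect_eq verts_box_replicate)
  then have "f x = v0" using f True i by (auto simp: cube_based_maps_def)
  then show ?thesis using True x by (simp add: extend_const_def verts_int_lattice)
qed (use x in \<open>simp add: extend_const_def verts_int_lattice\<close>)

lemma extend_const_based:
  assumes f: "f \<in> cube_based_maps n m G v0"
  shows "extend_const n m v0 f \<in> based n"
proof -
  define e where "e = extend_const n m v0 f"
  have e: "e x = v0" if "length x = n" "x \<notin> verts (int_box (replicate n m))" for x
    using that by (simp add: e_def extend_const_def verts_int_lattice)
  have f': "e x = f x" if "x \<in> verts (int_box (replicate n m))" for x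
    using that by (simp add: e_def extend_const_def verts_int_lattice verts_box_replicate)
  \<comment> \<open>A neighbour outside the box is reached through a boundary face, on which the map
    is \<open>v0\<close>.\<close>
  have cross: "e x = v0"
    if xy: "x \<in> verts (int_box (replicate n m))" "y \<notin> verts (int_box (replicate n m))" "lattice_adj x y" for x y
  proof -
    have len: "length x = n" "length y = n" using xy lattice_adj_length[OF xy(3)] by (auto simp: verts_box_replicate)
    then obtain i where i: "i < n" "\<bar>x ! i - y ! i\<bar> = 1" "\<forall>j<n. j \<noteq> i \<longrightarrow> x ! j = y ! j"
      using xy(3) by (auto simp: lattice_adj_conv_nth)
    have "0 \<le> x ! j \<and> x ! j \<le> int m" if "j < n" for j
      using xy(1) that len by (auto simp: verts_box_replicate)
    moreover obtain k where k: "k < n" "y ! k < 0 \<or> int m < y ! k"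
      using xy(2) len by (auto simp: verts_box_replicate all_set_conv_all_nth not_le)
    ultimately have "x ! i \<le> 0 \<or> int m \<le> x ! i"
      using i by (cases "k = i") force+
    then show ?thesis
      unfolding e_def using i len by (intro extend_const_outside[OF f, of _ "x ! i"]) auto
  qed
  have "(\<lambda>x\<in>{x. length x = n}. e x) \<in> based n"
  proof (rule based_mapsI[of _ _ _ "m"])
    fix x :: "int list" assume "length x = n"
    then show "e x \<in> verts G"
      using e[of x] f'[of x] f base_in_verts
      by (cases "x \<in> verts (int_box (replicate n m))") (auto simp: cube_based_maps_def graph_maps_int_box)
  next
    fix x y assume xy: "length x = n" "length y = n" "lattice_adj x y"
    then show "adj_eq G (e x) (e y)"
      using e[of x] e[of y] f'[of x] f'[of y] f cross[of x y] cross[of y x, OF _ _ lattice_adj_sym]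
      by (cases "x \<in> verts (int_box (replicate n m))"; cases "y \<in> verts (int_box (replicate n m))")
        (auto simp: cube_based_maps_def graph_maps_int_box)
  next
    fix x t assume "length x = n" "t \<in> set x" "int m \<le> \<bar>t\<bar>"
    then show "e x = v0" unfolding e_def by (intro extend_const_outside[OF f, of _ t]) auto
  qed
  moreover have "(\<lambda>x\<in>{x. length x = n}. e x) = e"
    by (auto simp: e_def extend_const_def verts_int_lattice)
  ultimately show ?thesis by (simp add: e_def)
qed

lemma box_representative:
  assumes f: "f \<in> based n"
  shows "\<exists>m\<ge>1. \<exists>g\<in>cube_based_maps n m G v0. htpy n f (extend_const n m v0 g)"
proof -
  \<comment> \<open>The maximum with 1 makes the side length \<open>2 * r\<close> positive;
    translating by \<open>r\<close> in every coordinate moves the support into the box.\<close>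
  define r where "r = max 1 (radius n v0 f)"
  have r: "vanishes_beyond n v0 f r"
    unfolding r_def by (rule vanishes_beyond_mono[OF based_maps_vanish[OF f]]) simp
  define g where "g = translate n (replicate n (int r)) f"
  have g: "g \<in> based n" unfolding g_def by (rule translate_based[OF f]) simp
  have out: "g x = v0" if x: "length x = n" "i < n" "x ! i \<le> 0 \<or> int (2 * r) \<le> x ! i" for x i
  proof -
    have "int r \<le> \<bar>map2 (-) x (replicate n (int r)) ! i\<bar>" using x by auto
    then have "f (map2 (-) x (replicate n (int r))) = v0"
      using x by (intro vanishes_beyondD[OF r, of _ "map2 (-) x (replicate n (int r)) ! i"] nth_mem) auto
    then show ?thesis using x by (simp add: g_def translate_def)
  qed
  define h where "h = restrict g (verts (int_box (replicate n (2 * r))))"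
  have len: "length x = n" if "x \<in> verts (int_box (replicate n (2 * r)))" for x
    using that by (simp add: verts_box_replicate)
  have h: "h \<in> cube_based_maps n (2 * r) G v0"
    unfolding cube_based_maps_def graph_maps_int_box
    using g len out by (auto simp: h_def based_maps_iff graph_hom_int_lattice)
  have "extend_const n (2 * r) v0 h = g"
  proof (rule extensionalityI[of _ "{x. length x = n}"])
    fix x :: "int list" assume x: "x \<in> {x. length x = n}"
    show "extend_const n (2 * r) v0 h x = g x"
    proof (cases "x \<in> verts (int_box (replicate n (2 * r)))")
      case False
      then obtain i where "i < n" "x ! i \<le> 0 \<or> int (2 * r) \<le> x ! i"
        using x by (force simp: verts_box_replicate all_set_conv_all_nth)
      then have "g x = v0" using out x by auto
      then show ?thesis using x False by (simp add: extend_const_def verts_int_lattice)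
    qed (use x in \<open>simp add: extend_const_def verts_int_lattice h_def\<close>)
  qed (use g in \<open>auto simp: extend_const_def verts_int_lattice based_maps_iff\<close>)
  then have "htpy n f (extend_const n (2 * r) v0 h)"
    using htpy_translate[OF f, of "replicate n (int r)"] by (simp add: g_def)
  then show ?thesis using h by (intro exI[of _ "2 * r"] conjI bexI[of _ h]) (auto simp: r_def)
qed

text \<open>The two chains differ by constant cubes, which are degenerate because \<open>n\<close>
  is positive.\<close>

lemma phi_hurewicz_chain:
  assumes f: "f \<in> cube_based_maps n m G v0" and "1 \<le> m" "1 \<le> n"
  shows "(\<Sum>x\<in>verts (int_box (map (\<lambda>m. m - 1) (replicate n m))). frag_of (subcube n f x))
    - hurewicz_chain n v0 (extend_const n m v0 f) \<in> degens n"
    and "(\<Sum>x\<in>verts (int_box (map (\<lambda>m. m - 1) (replicate n m))). frag_of (subcube n f x)) \<in> cube_chains n G"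
proof -
  define e where "e = extend_const n m v0 f"
  define B where "B = lattice_box (replicate n (0, int m))"
  \<comment> \<open>For \<open>1 \<le> m\<close> the subtraction on naturals is exact, and the
    closed interval up to \<open>m - 1\<close> is the half-open one up to \<open>m\<close>.\<close>
  have B: "verts (int_box (map (\<lambda>m. m - 1) (replicate n m))) = B"
    using \<open>1 \<le> m\<close> by (auto simp: B_def verts_box_replicate lattice_box_replicate)
  have len: "length x = n" if "x \<in> B" for x using that by (simp add: B_def lattice_box_replicate)
  have sub: "subcube n f x = subcube n e x" if x: "x \<in> B" for x
  proof (rule subcube_cong)
    fix a assume a: "a \<in> cube_verts n"
    have "0 \<le> map2 (+) x a ! i \<and> map2 (+) x a ! i \<le> int m" if "i < n" for i
    proof -
      have "a ! i \<in> {0, 1}" using a that by (auto simp: cube_verts_eq subset_iff)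
      moreover have "0 \<le> x ! i" "x ! i < int m" using x that len[OF x] by (auto simp: B_def lattice_box_replicate)
      ultimately show ?thesis using that len[OF x] length_cube_verts[OF a] by auto
    qed
    then have "map2 (+) x a \<in> verts (int_box (replicate n m))"
      using len[OF x] length_cube_verts[OF a] by (simp add: verts_int_box)
    then show "f (map2 (+) x a) = e (map2 (+) x a)"
      by (simp add: e_def extend_const_def verts_int_lattice verts_box_replicate)
  qed
  have supp: "cube_support n v0 e \<subseteq> B"
  proof
    fix x assume x: "x \<in> cube_support n v0 e"
    then have "length x = n" by (simp add: cube_support_def)
    show "x \<in> B"
    proof (rule ccontr)
      assume "x \<notin> B"
      then obtain i where i: "i < n" "x ! i < 0 \<or> int m \<le> x ! i"
        using \<open>length x = n\<close> by (force simp: B_def lattice_box_replicate all_set_conv_all_nth)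
      have "e (map2 (+) x a) = v0" if a: "a \<in> cube_verts n" for a
      proof -
        have "a ! i \<in> {0, 1}" using a i by (auto simp: cube_verts_eq subset_iff)
        then show ?thesis
          unfolding e_def using i \<open>length x = n\<close> length_cube_verts[OF a]
          by (intro extend_const_outside[OF f, of _ "map2 (+) x a ! i"] nth_mem) auto
      qed
      then have "subcube n e x = const_cube n v0" by (auto simp: subcube_def)
      then show False using x by (simp add: cube_support_def)
    qed
  qed
  have "hurewicz_chain n v0 e = (\<Sum>x\<in>B. frag_of (subcube n e x) - frag_of (const_cube n v0))"
    using supp len by (intro hurewicz_chain_eq) (auto simp: B_def)
  then have "(\<Sum>x\<in>B. frag_of (subcube n f x)) - hurewicz_chain n v0 e = (\<Sum>x\<in>B. frag_of (const_cube n v0))"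
    using sub by (simp add: sum_subtractf)
  moreover have "frag_of (const_cube n v0) \<in> degens n"
    using degenerate_const_cube[of "n - 1" v0] \<open>1 \<le> n\<close> by simp
  ultimately have "(\<Sum>x\<in>B. frag_of (subcube n f x)) - hurewicz_chain n v0 e \<in> degens n"
    by (simp only: frags_sum)
  then show "(\<Sum>x\<in>verts (int_box (map (\<lambda>m. m - 1) (replicate n m))). frag_of (subcube n f x))
    - hurewicz_chain n v0 (extend_const n m v0 f) \<in> degens n"
    unfolding B e_def .
  show "(\<Sum>x\<in>verts (int_box (map (\<lambda>m. m - 1) (replicate n m))). frag_of (subcube n f x)) \<in> cube_chains n G"
    unfolding B using extend_const_based[OF f] sub len
    by (intro frags_sum) (auto simp: e_def based_maps_iff intro: subcube_in_cubes)
qed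

end

section \<open>Discrete cubical homology and the Hurewicz map\<close>

lemma generate_frag_of:
  assumes "T \<subseteq> S"
  shows "generate (free_Abelian_group S) (frag_of ` T) = frags T"
proof (rule group.generateI[symmetric, OF group_free_Abelian_group])
  show "subgroup (frags T) (free_Abelian_group S)"
    using assms by (intro group.subgroupI) (auto simp: frags_def dest: keys_add[THEN subsetD])
next
  fix K assume K: "subgroup K (free_Abelian_group S)" "frag_of ` T \<subseteq> K"
  show "frags T \<subseteq> K"
  proof
    fix c assume "c \<in> frags T"
    then have "Poly_Mapping.keys c \<subseteq> T" by (simp add: frags_def)
    then show "c \<in> K"
    proof (induction c rule: frag_induction)
      case zero
      show ?case using subgroup.one_closed[OF K(1)] by simp
    next
      case (diff a b)
      have "Poly_Mapping.keys b \<subseteq> S" using subgroup.mem_carrier[OF K(1) diff(2)] by simp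
      then have "- b \<in> K" using subgroup.m_inv_closed[OF K(1) diff(2)] by simp
      then show ?case using subgroup.m_closed[OF K(1) diff(1), of "- b"] by simp
    qed (use K in auto)
  qed
qed (auto simp: frags_def)

lemma degenerate_cubes_eq: "degenerate_cubes n G = {s \<in> cubes n G. degenerate n s}"
proof -
  have "(\<exists>i\<in>{1..n}. P i) \<longleftrightarrow> (\<exists>k<n. P (Suc k))" for P
    by (metis Suc_le_eq atLeastAtMost_iff le_add1 plus_1_eq_Suc not0_implies_Suc not_one_le_zero)
  then show ?thesis by (simp add: degenerate_cubes_def degenerate_def)
qed

text \<open>A generated subgroup turns into a condition on the support, which connects the
  definition with the graph-free \<open>degens\<close>.\<close>

lemma degenerate_chains_eq: "degenerate_chains n G = cube_chains n G \<inter> degens n"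
proof -
  have "degenerate_chains n G = frags (degenerate_cubes n G)"
    unfolding degenerate_chains_def free_chains_def
    by (rule generate_frag_of) (auto simp: degenerate_cubes_eq)
  also have "\<dots> = cube_chains n G \<inter> degens n"
    by (auto simp: degenerate_cubes_eq frags_def)
  finally show ?thesis .
qed

lemma carrier_free_chains: "carrier (free_chains n G) = cube_chains n G"
  by (auto simp: free_chains_def frags_def)

lemma mult_free_chains: "c \<otimes>\<^bsub>free_chains n G\<^esub> d = c + d"
  by (simp add: free_chains_def)

lemma comm_group_free_chains: "comm_group (free_chains n G)"
  by (simp add: free_chains_def abelian_free_Abelian_group)

lemma subgroup_degenerate_chains: "subgroup (degenerate_chains n G) (free_chains n G)"
  unfolding degenerate_chains_def
proof (rule group.generate_is_subgroup)
  show "group (free_chains n G)" by (simp add: free_chains_def)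
  show "frag_of ` degenerate_cubes n G \<subseteq> carrier (free_chains n G)"
    by (auto simp: carrier_free_chains degenerate_cubes_eq)
qed

lemma normal_degenerate_chains: "degenerate_chains n G \<lhd> free_chains n G"
  using comm_group.subgroup_imp_normal[OF comm_group_free_chains subgroup_degenerate_chains] .

lemma mem_chain_class:
  assumes "c \<in> cube_chains n G"
  shows "d \<in> chain_class n G c \<longleftrightarrow> d \<in> cube_chains n G \<and> d - c \<in> degens n"
proof
  assume "d \<in> chain_class n G c"
  then obtain e where "e \<in> degenerate_chains n G" "d = e + c"
    by (auto simp: chain_class_def r_coset_def mult_free_chains)
  then show "d \<in> cube_chains n G \<and> d - c \<in> degens n"
    using assms by (auto simp: degenerate_chains_eq intro: frags_add)
next
  assume "d \<in> cube_chains n G \<and> d - c \<in> degens n"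
  then have "d - c \<in> degenerate_chains n G" "d = (d - c) + c"
    using assms by (auto simp: degenerate_chains_eq intro: frags_diff)
  then show "d \<in> chain_class n G c"
    unfolding chain_class_def r_coset_def mult_free_chains by blast
qed

lemma chain_class_eq_iff:
  assumes "c \<in> cube_chains n G" "d \<in> cube_chains n G"
  shows "chain_class n G c = chain_class n G d \<longleftrightarrow> c - d \<in> degens n"
proof
  assume "chain_class n G c = chain_class n G d"
  then show "c - d \<in> degens n"
    using mem_chain_class[OF assms(1), of c] mem_chain_class[OF assms(2), of c] assms by simp
next
  assume cd: "c - d \<in> degens n"
  have "e - c \<in> degens n \<longleftrightarrow> e - d \<in> degens n" for e
    using frags_add[OF cd, of "e - c"] frags_diff[OF _ cd, of "e - d"] by (auto simp: algebra_simps)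
  then show "chain_class n G c = chain_class n G d"
    using mem_chain_class[OF assms(1)] mem_chain_class[OF assms(2)] by blast
qed

lemma carrier_chain_gp: "carrier (chain_gp n G) = chain_class n G ` cube_chains n G"
  unfolding chain_gp_def carrier_FactGroup carrier_free_chains
  by (auto simp: chain_class_def)

lemma mult_chain_gp:
  assumes "c \<in> cube_chains n G" "d \<in> cube_chains n G"
  shows "chain_class n G c \<otimes>\<^bsub>chain_gp n G\<^esub> chain_class n G d = chain_class n G (c + d)"
  unfolding chain_gp_def mult_FactGroup chain_class_def
  using normal.rcos_sum[OF normal_degenerate_chains] assms by (simp add: carrier_free_chains mult_free_chains)

lemma one_chain_gp: "\<one>\<^bsub>chain_gp n G\<^esub> = chain_class n G 0"
proof -
  have "\<one>\<^bsub>chain_gp n G\<^esub> = degenerate_chains n G" by (simp add: chain_gp_def)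
  also have "\<dots> = chain_class n G 0" by (auto simp: mem_chain_class degenerate_chains_eq)
  finally show ?thesis .
qed

lemma comm_group_chain_gp: "comm_group (chain_gp n G)"
  unfolding chain_gp_def
  by (rule comm_group.abelian_FactGroup[OF comm_group_free_chains subgroup_degenerate_chains])

lemma free_boundary_pred_chains: "c \<in> cube_chains n G \<Longrightarrow> free_boundary n c \<in> cube_chains (n - Suc 0) G"
  by (cases n) (auto intro: free_boundary_chains)

text \<open>The union over the coset collapses to one class because the boundary preserves
  degenerate chains.\<close>

lemma boundary_chain_class:
  assumes "c \<in> cube_chains n G"
  shows "boundary n G (chain_class n G c) = chain_class (n - 1) G (free_boundary n c)"
proof -
  have "chain_class (n - 1) G (free_boundary n d) = chain_class (n - 1) G (free_boundary n c)"
    if "d \<in> chain_class n G c" for d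
  proof -
    have "d \<in> cube_chains n G" "d - c \<in> degens n" using that mem_chain_class[OF assms] by auto
    then show ?thesis
      using assms free_boundary_degens'[of "d - c" n]
      by (subst chain_class_eq_iff) (auto simp: free_boundary_diff intro: free_boundary_pred_chains)
  qed
  moreover have "c \<in> chain_class n G c" using assms by (simp add: mem_chain_class)
  ultimately show ?thesis unfolding boundary_def by blast
qed

lemma group_hom_boundary: "group_hom (chain_gp n G) (chain_gp (n - 1) G) (boundary n G)"
proof -
  have "boundary n G \<in> hom (chain_gp n G) (chain_gp (n - 1) G)"
    by (rule homI) (auto simp: carrier_chain_gp boundary_chain_class mult_chain_gp free_boundary_add
        frags_add free_boundary_pred_chains)
  then show ?thesis
    using comm_group_chain_gp[of n G] comm_group_chain_gp[of "n - 1" G]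
    by (simp add: group_hom_def group_hom_axioms_def comm_group_def)
qed

lemma carrier_cycle_gp: "carrier (cycle_gp n G) = chain_class n G ` cycles n G"
proof -
  have "chain_class (n - 1) G (free_boundary n c) = \<one>\<^bsub>chain_gp (n - 1) G\<^esub> \<longleftrightarrow> c \<in> cycles n G"
    if "c \<in> cube_chains n G" for c
    unfolding one_chain_gp cycles_def
    using that free_boundary_pred_chains[OF that] by (simp add: chain_class_eq_iff)
  then show ?thesis
    unfolding cycle_gp_def kernel_def
    by (auto simp: carrier_chain_gp boundary_chain_class) (auto simp: cycles_def boundary_chain_class)
qed

lemma comm_group_cycle_gp: "comm_group (cycle_gp n G)"
proof -
  interpret chain: comm_group "chain_gp n G" by (rule comm_group_chain_gp)
  have K: "subgroup (kernel (chain_gp n G) (chain_gp (n - 1) G) (boundary n G)) (chain_gp n G)"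
    by (rule group_hom.subgroup_kernel[OF group_hom_boundary])
  show ?thesis
    unfolding cycle_gp_def
    using subgroup.subgroup_is_group[OF K chain.is_group] subgroup.mem_carrier[OF K] chain.m_comm
    by (intro group.group_comm_groupI) auto
qed

lemma mult_cycle_gp:
  assumes "c \<in> cycles n G" "d \<in> cycles n G"
  shows "chain_class n G c \<otimes>\<^bsub>cycle_gp n G\<^esub> chain_class n G d = chain_class n G (c + d)"
  using assms by (simp add: cycle_gp_def mult_chain_gp cycles_def)

lemma boundaries_eq: "boundaries n G = (\<lambda>u. chain_class n G (free_boundary (Suc n) u)) ` cube_chains (Suc n) G"
  unfolding boundaries_def carrier_chain_gp image_image
  by (intro image_cong refl) (simp add: boundary_chain_class)

lemma subgroup_boundaries: "subgroup (boundaries n G) (cycle_gp n G)"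
proof (rule group.subgroupI)
  show "group (cycle_gp n G)" by (rule comm_group.axioms(2)[OF comm_group_cycle_gp])
  then interpret group "cycle_gp n G" .
  show "boundaries n G \<subseteq> carrier (cycle_gp n G)"
    by (auto simp: boundaries_eq carrier_cycle_gp intro: boundary_cycles)
  show "boundaries n G \<noteq> {}"
    unfolding boundaries_eq using frags_zero by blast
  fix X assume "X \<in> boundaries n G"
  then obtain u where u: "u \<in> cube_chains (Suc n) G" "X = chain_class n G (free_boundary (Suc n) u)"
    by (auto simp: boundaries_eq)
  have "chain_class n G (free_boundary (Suc n) (- u)) \<otimes>\<^bsub>cycle_gp n G\<^esub> X = \<one>\<^bsub>cycle_gp n G\<^esub>"
    using u boundary_cycles[of u n G] boundary_cycles[of "- u" n G]
    by (simp add: mult_cycle_gp free_boundary_minus) (simp add: cycle_gp_def one_chain_gp)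
  then have "inv\<^bsub>cycle_gp n G\<^esub> X = chain_class n G (free_boundary (Suc n) (- u))"
    using u by (intro inv_equality) (auto simp: carrier_cycle_gp intro!: imageI boundary_cycles)
  then show "inv\<^bsub>cycle_gp n G\<^esub> X \<in> boundaries n G"
    using u by (auto simp: boundaries_eq)
  fix Y assume "Y \<in> boundaries n G"
  then obtain v where v: "v \<in> cube_chains (Suc n) G" "Y = chain_class n G (free_boundary (Suc n) v)"
    by (auto simp: boundaries_eq)
  show "X \<otimes>\<^bsub>cycle_gp n G\<^esub> Y \<in> boundaries n G"
    unfolding u(2) v(2) boundaries_eq
    using u(1) v(1) by (auto simp: mult_cycle_gp boundary_cycles frags_add simp flip: free_boundary_add)
qed

lemma normal_boundaries: "boundaries n G \<lhd> cycle_gp n G"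
  by (rule comm_group.subgroup_imp_normal[OF comm_group_cycle_gp subgroup_boundaries])

definition cycle_class :: "nat \<Rightarrow> 'v ugraph \<Rightarrow> 'v cube_chain \<Rightarrow> 'v cube_chain set set" where
  "cycle_class n G c = homology_class n G (chain_class n G c)"

lemma cycle_class_eq:
  assumes "c \<in> cycles n G"
  shows "cycle_class n G c = (\<lambda>u. chain_class n G (free_boundary (Suc n) u + c)) ` cube_chains (Suc n) G"
  unfolding cycle_class_def homology_class_def r_coset_def boundaries_eq
  using assms by (auto simp: mult_cycle_gp boundary_cycles)

lemma cycles_chains: "c \<in> cycles n G \<Longrightarrow> c \<in> cube_chains n G"
  by (simp add: cycles_def)

text \<open>The dictionary between the homology group and computations with representatives.\<close>

lemma cycle_class_eq_iff:
  assumes "c \<in> cycles n G" "d \<in> cycles n G"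
  shows "cycle_class n G c = cycle_class n G d \<longleftrightarrow> null_homologous n G (c - d)"
proof
  have "chain_class n G c \<in> cycle_class n G c"
    unfolding cycle_class_eq[OF assms(1)] by (rule image_eqI[of _ _ 0]) auto
  moreover assume "cycle_class n G c = cycle_class n G d"
  ultimately obtain u where u: "u \<in> cube_chains (Suc n) G" "chain_class n G c = chain_class n G (free_boundary (Suc n) u + d)"
    unfolding cycle_class_eq[OF assms(2)] by blast
  then have "c - (free_boundary (Suc n) u + d) \<in> degens n"
    using chain_class_eq_iff[OF cycles_chains[OF assms(1)]
        frags_add[OF free_boundary_chains[OF u(1)] cycles_chains[OF assms(2)]]] by simp
  then show "null_homologous n G (c - d)"
    unfolding null_homologous_def using u(1) by (intro bexI[of _ u]) (simp_all add: algebra_simps)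
next
  have sub: "cycle_class n G c \<subseteq> cycle_class n G d"
    if cd: "c \<in> cycles n G" "d \<in> cycles n G" "null_homologous n G (c - d)" for c d
  proof -
    obtain u where u: "u \<in> cube_chains (Suc n) G" "c - d - free_boundary (Suc n) u \<in> degens n"
      using cd(3) by (auto simp: null_homologous_def)
    show ?thesis
      unfolding cycle_class_eq[OF cd(1)]
    proof (rule image_subsetI)
      fix v assume v: "v \<in> cube_chains (Suc n) G"
      have "chain_class n G (free_boundary (Suc n) v + c) = chain_class n G (free_boundary (Suc n) (v + u) + d)"
      proof (subst chain_class_eq_iff)
        show "free_boundary (Suc n) v + c \<in> cube_chains n G"
          "free_boundary (Suc n) (v + u) + d \<in> cube_chains n G"
          using frags_add[OF free_boundary_chains[OF v] cycles_chains[OF cd(1)]]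
            frags_add[OF free_boundary_chains[OF frags_add[OF v u(1)]] cycles_chains[OF cd(2)]] by auto
        show "free_boundary (Suc n) v + c - (free_boundary (Suc n) (v + u) + d) \<in> degens n"
          using u(2) by (simp add: free_boundary_add algebra_simps)
      qed
      then show "chain_class n G (free_boundary (Suc n) v + c) \<in> cycle_class n G d"
        unfolding cycle_class_eq[OF cd(2)] using u v by (intro image_eqI[of _ _ "v + u"] frags_add) auto
    qed
  qed
  assume "null_homologous n G (c - d)"
  then show "cycle_class n G c = cycle_class n G d"
    using sub assms null_homologous_diff_sym by blast
qed

lemma carrier_homology_gp: "carrier (homology_gp n G) = cycle_class n G ` cycles n G"
  unfolding homology_gp_def carrier_FactGroup carrier_cycle_gp image_image
  by (simp add: cycle_class_def homology_class_def)

lemma mult_homology_gp: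
  assumes "c \<in> cycles n G" "d \<in> cycles n G"
  shows "cycle_class n G c \<otimes>\<^bsub>homology_gp n G\<^esub> cycle_class n G d = cycle_class n G (c + d)"
proof -
  have "chain_class n G c \<in> carrier (cycle_gp n G)" "chain_class n G d \<in> carrier (cycle_gp n G)"
    using assms by (auto simp: carrier_cycle_gp)
  from normal.rcos_sum[OF normal_boundaries this] show ?thesis
    unfolding homology_gp_def mult_FactGroup cycle_class_def homology_class_def mult_cycle_gp[OF assms] .
qed

lemma one_homology_gp: "\<one>\<^bsub>homology_gp n G\<^esub> = cycle_class n G 0"
proof -
  have "0 \<in> cycles n G" by (simp add: cycles_def)
  then have "cycle_class n G 0 = boundaries n G" by (simp add: cycle_class_eq boundaries_eq)
  then show ?thesis by (simp add: homology_gp_def)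
qed

lemma comm_group_homology_gp: "comm_group (homology_gp n G)"
  unfolding homology_gp_def
  by (rule comm_group.abelian_FactGroup[OF comm_group_cycle_gp subgroup_boundaries])

lemma chain_gp_map_chain_class:
  assumes F: "graph_hom F G G'" and c: "c \<in> cube_chains n G"
  shows "chain_gp_map n G' F (chain_class n G c) = chain_class n G' (push_chain n F c)"
proof -
  have "chain_class n G' (push_chain n F d) = chain_class n G' (push_chain n F c)"
    if "d \<in> chain_class n G c" for d
    using that c mem_chain_class[OF c] push_chain_degens[of "d - c" n F]
    by (subst chain_class_eq_iff) (auto simp: push_chain_diff intro: push_chain_chains[OF F])
  moreover have "c \<in> chain_class n G c" using c by (simp add: mem_chain_class)
  ultimately show ?thesis unfolding chain_gp_map_def push_chain_def by blast
qed

text \<open>A homology class is a set of cosets \<open>z\<close>, each a set of chains; another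
  choice of \<open>z\<close> alters the pushed chain by a boundary only.\<close>

lemma homology_gp_map_cycle_class:
  assumes F: "graph_hom F G G'" and c: "c \<in> cycles n G"
  shows "homology_gp_map n G' F (cycle_class n G c) = cycle_class n G' (push_chain n F c)"
proof -
  have "homology_class n G' (chain_gp_map n G' F z) = cycle_class n G' (push_chain n F c)"
    if z: "z \<in> cycle_class n G c" for z
  proof -
    obtain u where u: "u \<in> cube_chains (Suc n) G" "z = chain_class n G (free_boundary (Suc n) u + c)"
      using z unfolding cycle_class_eq[OF c] by blast
    have cyc: "free_boundary (Suc n) u + c \<in> cycles n G"
      using u c by (intro cycles_add boundary_cycles)
    have "homology_class n G' (chain_gp_map n G' F z) = cycle_class n G' (push_chain n F (free_boundary (Suc n) u + c))"
      unfolding u(2) chain_gp_map_chain_class[OF F cycles_chains[OF cyc]] cycle_class_def ..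
    also have "\<dots> = cycle_class n G' (push_chain n F c)"
      using null_homologous_push_chain[OF F null_homologous_boundary[OF u(1)]]
      by (subst cycle_class_eq_iff[OF push_chain_cycles[OF F cyc] push_chain_cycles[OF F c]])
        (simp add: push_chain_add)
    finally show ?thesis .
  qed
  moreover have "chain_class n G c \<in> cycle_class n G c"
    unfolding cycle_class_eq[OF c] by (rule image_eqI[of _ _ 0]) auto
  ultimately show ?thesis unfolding homology_gp_map_def by blast
qed

section \<open>The Hurewicz homomorphism\<close>

context pointed_graph
begin

lemma hurewicz_chain_cycle: "f \<in> based n \<Longrightarrow> hurewicz_chain n v0 f \<in> cycles n G"
  using hurewicz_chain_cycles base_in_verts by (auto simp: based_maps_iff)

lemma phi_cycle:
  assumes f: "f \<in> cube_based_maps n m G v0" and "1 \<le> m" "1 \<le> n"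
  shows "phi (replicate n m) G f \<in> carrier (cycle_gp n G)"
    and "homology_class n G (phi (replicate n m) G f)
      = cycle_class n G (hurewicz_chain n v0 (extend_const n m v0 f))"
proof -
  define c where "c = (\<Sum>x\<in>verts (int_box (map (\<lambda>m. m - 1) (replicate n m))). frag_of (subcube n f x))"
  have phi: "phi (replicate n m) G f = chain_class n G c"
    by (simp add: phi_def c_def)
  define e where "e = hurewicz_chain n v0 (extend_const n m v0 f)"
  have e: "e \<in> cycles n G"
    unfolding e_def using extend_const_based[OF f] by (rule hurewicz_chain_cycle)
  have ce: "c - e \<in> degens n" "c \<in> cube_chains n G"
    using phi_hurewicz_chain[OF assms] by (simp_all add: c_def e_def)
  have "c - e \<in> cycles n G"
    by (rule degens_cycles[OF frags_diff[OF ce(2) cycles_chains[OF e]] ce(1)])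
  then have c: "c \<in> cycles n G" using cycles_add[OF _ e] by fastforce
  show "phi (replicate n m) G f \<in> carrier (cycle_gp n G)"
    unfolding phi carrier_cycle_gp using c by blast
  show "homology_class n G (phi (replicate n m) G f) = cycle_class n G (hurewicz_chain n v0 (extend_const n m v0 f))"
    using c e ce(1) cycle_class_eq_iff[OF c e] null_homologous_degens
    unfolding phi cycle_class_def e_def by blast
qed

text \<open>This is where \<open>psi\<close> is seen to be well defined: a box representative
  exists, and any two are homotopic, hence have homologous chains. On the way \<open>phi\<close> is
  traded for the normalised chain, which uses \<open>1 \<le> n\<close>.\<close>

lemma psi_hclass:
  assumes f: "f \<in> based n" and n: "1 \<le> n"
  shows "psi n G v0 (hclass n f) = cycle_class n G (hurewicz_chain n v0 f)"
  unfolding psi_def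
proof (rule the_equality)
  have *: "homology_class n G (phi (replicate n m) G g) = cycle_class n G (hurewicz_chain n v0 f)"
    if "1 \<le> m" "g \<in> cube_based_maps n m G v0" "htpy n f (extend_const n m v0 g)" for m g
    unfolding phi_cycle(2)[OF that(2,1) n]
    using that extend_const_based[OF that(2)] f
    by (subst cycle_class_eq_iff) (auto intro: hurewicz_chain_cycle null_homologous_htpy)
  show "\<exists>m\<ge>1. \<exists>g\<in>cube_based_maps n m G v0. hclass n f = hclass n (extend_const n m v0 g) \<and>
      cycle_class n G (hurewicz_chain n v0 f) = homology_class n G (phi (replicate n m) G g)"
  proof -
    obtain m g where mg: "m \<ge> 1" "g \<in> cube_based_maps n m G v0" "htpy n f (extend_const n m v0 g)"
      using box_representative[OF f] by blast
    then show ?thesis using *[OF mg] hclass_eqI[OF mg(3)] by metis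
  qed
  fix Z assume "\<exists>m\<ge>1. \<exists>g\<in>cube_based_maps n m G v0. hclass n f = hclass n (extend_const n m v0 g) \<and>
      Z = homology_class n G (phi (replicate n m) G g)"
  then show "Z = cycle_class n G (hurewicz_chain n v0 f)"
    using * hclass_eq_iff[OF f extend_const_based] by blast
qed

lemma hclass_box_representative:
  assumes "X \<in> carrier (homotopy_gp n G v0)"
  shows "\<exists>m\<ge>1. \<exists>f\<in>cube_based_maps n m G v0. X = hclass n (extend_const n m v0 f)"
  using assms box_representative hclass_eqI unfolding carrier_homotopy_gp by blast

lemma psi_box:
  assumes "f \<in> cube_based_maps n m G v0" "1 \<le> m" "1 \<le> n"
  shows "psi n G v0 (hclass n (extend_const n m v0 f)) = homology_class n G (phi (replicate n m) G f)"
  using assms phi_cycle(2) psi_hclass extend_const_based by metis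

lemma group_hom_psi:
  assumes n: "1 \<le> n"
  shows "group_hom (homotopy_gp n G v0) (homology_gp n G) (psi n G v0)"
proof -
  obtain m where m: "n = Suc m" using n by (cases n) auto
  have "psi n G v0 \<in> hom (homotopy_gp n G v0) (homology_gp n G)"
  proof (rule homI)
    fix X Y assume "X \<in> carrier (homotopy_gp n G v0)" "Y \<in> carrier (homotopy_gp n G v0)"
    then obtain f g where fg: "f \<in> based n" "g \<in> based n" "X = hclass n f" "Y = hclass n g"
      by (auto simp: carrier_homotopy_gp)
    then have "bconcat n f g \<in> based n" by (simp add: m concat_based)
    then show "psi n G v0 (X \<otimes>\<^bsub>homotopy_gp n G v0\<^esub> Y) = psi n G v0 X \<otimes>\<^bsub>homology_gp n G\<^esub> psi n G v0 Y"
      using fg hurewicz_chain_concat[of f m g]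
      by (simp add: psi_hclass[OF _ n] mult_homology_gp hurewicz_chain_cycle) (simp add: m mult_hclass psi_hclass)
  qed (auto simp: carrier_homotopy_gp carrier_homology_gp psi_hclass[OF _ n] hurewicz_chain_cycle)
  then show ?thesis
    using group_homotopy_gp comm_group_homology_gp[of n G]
    by (simp add: group_hom_def group_hom_axioms_def comm_group_def m)
qed

end

section \<open>Naturality\<close>

lemma compose_based:
  assumes F: "graph_hom F G G'" and f: "f \<in> based_maps n G v0"
  shows "compose {x. length x = n} F f \<in> based_maps n G' (F v0)"
proof -
  obtain r where "vanishes_beyond n v0 f r" using f by (auto simp: based_maps_iff)
  moreover have "\<And>v. v \<in> verts G \<Longrightarrow> F v \<in> verts G'"
    "\<And>u v. u \<in> verts G \<Longrightarrow> v \<in> verts G \<Longrightarrow> adj_eq G u v \<Longrightarrow> adj_eq G' (F u) (F v)"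
    using F by (auto simp: graph_hom_def)
  ultimately show ?thesis
    unfolding compose_def using f
    by (intro based_mapsI[of _ _ _ r])
      (auto simp: based_maps_iff graph_hom_int_lattice dest: vanishes_beyondD)
qed

lemma homotopy_gp_map_hclass:
  assumes "pointed_graph G v0" "pointed_graph G' (F v0)" and F: "graph_hom F G G'" and f: "f \<in> based_maps n G v0"
  shows "homotopy_gp_map n G' (F v0) F (htpy_class n G v0 f)
    = htpy_class n G' (F v0) (compose {x. length x = n} F f)"
proof -
  interpret G: pointed_graph G v0 by fact
  interpret G': pointed_graph G' "F v0" by fact
  have "G'.htpy n (compose {x. length x = n} F f) (compose {x. length x = n} F g)" if "G.htpy n f g" for g
    using that
  proof (induction rule: G.htpy_induct)
    case (refl f)
    then show ?case using compose_based[OF F] G'.htpy_refl by blast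
  next
    case (step f g h)
    have "based_step n G' (F v0) (compose {x. length x = n} F g) (compose {x. length x = n} F h)"
      unfolding based_step_def
    proof (intro conjI allI impI)
      fix x :: "int list" assume x: "length x = n"
      then have "g x \<in> verts G" "h x \<in> verts G" "adj_eq G (g x) (h x)"
        using step(2) by (auto simp: based_step_def based_maps_iff graph_hom_int_lattice)
      then have "adj_eq G' (F (g x)) (F (h x))" using F by (auto simp: graph_hom_def)
      then show "adj_eq G' (compose {x. length x = n} F g x) (compose {x. length x = n} F h x)"
        using x by (simp add: compose_def)
    qed (use step(2) compose_based[OF F] in \<open>auto simp: based_step_def\<close>)
    then show ?case using step(3) G'.htpy_step G'.htpy_trans by blast
  qed
  then have "htpy_class n G' (F v0) (compose {x. length x = n} F g) =
      htpy_class n G' (F v0) (compose {x. length x = n} F f)" if "g \<in> htpy_class n G v0 f" for g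
    using that G'.hclass_eqI by (metis G.mem_hclass)
  moreover have "f \<in> htpy_class n G v0 f" using f by (simp add: G.mem_hclass G.htpy_refl)
  ultimately show ?thesis unfolding homotopy_gp_map_def verts_int_lattice by blast
qed

text \<open>On representatives both sides come from the same chain, as composing with
  \<open>F\<close> commutes with cutting into cubes.\<close>

lemma psi_natural:
  assumes G: "pointed_graph G v0" "pointed_graph G' (F v0)" and F: "graph_hom F G G'" and n: "1 \<le> n"
    and X: "X \<in> carrier (homotopy_gp n G v0)"
  shows "psi n G' (F v0) (homotopy_gp_map n G' (F v0) F X) = homology_gp_map n G' F (psi n G v0 X)"
proof -
  obtain f where f: "f \<in> based_maps n G v0" "X = htpy_class n G v0 f"
    using X by (auto simp: pointed_graph.carrier_homotopy_gp[OF G(1)])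
  obtain r where r: "vanishes_beyond n v0 f r" using f by (auto simp: based_maps_iff)
  show ?thesis
    unfolding f(2) homotopy_gp_map_hclass[OF G F f(1)] pointed_graph.psi_hclass[OF G(1) f(1) n]
      pointed_graph.psi_hclass[OF G(2) compose_based[OF F f(1)] n]
      homology_gp_map_cycle_class[OF F pointed_graph.hurewicz_chain_cycle[OF G(1) f(1)]]
      push_chain_hurewicz_chain[OF r] ..
qed

section \<open>Suspensions and spheres\<close>

definition restrict_chain :: "('a \<Rightarrow> bool) \<Rightarrow> ('a \<Rightarrow>\<^sub>0 int) \<Rightarrow> ('a \<Rightarrow>\<^sub>0 int)" where
  "restrict_chain P = frag_extend (\<lambda>s. if P s then frag_of s else 0)"

lemma lookup_restrict_chain:
  "Poly_Mapping.lookup (restrict_chain P c) s = (if P s then Poly_Mapping.lookup c s else 0)"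
proof -
  have "restrict_chain P c = (\<Sum>i\<in>Poly_Mapping.keys c. frag_cmul (Poly_Mapping.lookup c i) (if P i then frag_of i else 0))"
    by (simp add: restrict_chain_def frag_extend_def)
  then have "Poly_Mapping.lookup (restrict_chain P c) s = (\<Sum>i\<in>Poly_Mapping.keys c.
      Poly_Mapping.lookup c i * Poly_Mapping.lookup (if P i then frag_of i else 0) s)"
    by (simp only: lookup_sum lookup_frag_cmul)
  also have "\<dots> = (\<Sum>i\<in>Poly_Mapping.keys c. if i = s then (if P s then Poly_Mapping.lookup c s else 0) else 0)"
    by (intro sum.cong refl) auto
  also have "\<dots> = (if P s then Poly_Mapping.lookup c s else 0)"
    by (simp add: in_keys_iff)
  finally show ?thesis .
qed

lemma keys_restrict_chain: "Poly_Mapping.keys (restrict_chain P c) = Poly_Mapping.keys c \<inter> Collect P"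
  by (auto simp: in_keys_iff lookup_restrict_chain split: if_splits)

lemma restrict_chain_diff: "restrict_chain P (c - d) = restrict_chain P c - restrict_chain P d"
  by (simp add: restrict_chain_def frag_extend_diff)

lemma restrict_chain_minus: "restrict_chain P (- c) = - restrict_chain P c"
  by (simp add: restrict_chain_def frag_extend_minus)

lemma restrict_chain_sum: "finite I \<Longrightarrow> restrict_chain P (\<Sum>i\<in>I. c i) = (\<Sum>i\<in>I. restrict_chain P (c i))"
  by (simp add: restrict_chain_def frag_extend_sum o_def)

lemma restrict_chain_of: "restrict_chain P (frag_of s) = (if P s then frag_of s else 0)"
  by (simp add: restrict_chain_def)

lemma restrict_chain_compl: "c - restrict_chain P c = restrict_chain (\<lambda>s. \<not> P s) c"
  by (rule poly_mapping_eqI) (simp add: lookup_minus lookup_restrict_chain)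

lemma restrict_chain_id: "c \<in> frags S \<Longrightarrow> (\<And>s. s \<in> S \<Longrightarrow> P s) \<Longrightarrow> restrict_chain P c = c"
  by (rule poly_mapping_eqI) (auto simp: lookup_restrict_chain frags_def in_keys_iff subset_iff)

lemma frags_restrict_chain: "c \<in> frags S \<Longrightarrow> restrict_chain P c \<in> frags (S \<inter> Collect P)"
  by (auto simp: frags_def keys_restrict_chain)

text \<open>A cube of \<open>a\<close> outside \<open>A \<inter> B\<close> cannot occur in
  \<open>b\<close>, so it is not cancelled in the sum and has to lie in \<open>D\<close>. Taking for
  \<open>D\<close> the degenerate cubes makes the Mayer--Vietoris argument work modulo degenerate
  chains.\<close>

lemma restrict_chain_overlap:
  assumes "a \<in> frags A" "b \<in> frags B" "a + b \<in> frags D"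
  shows "restrict_chain (\<lambda>s. s \<in> A \<inter> B) a \<in> frags (A \<inter> B)"
    and "a - restrict_chain (\<lambda>s. s \<in> A \<inter> B) a \<in> frags D"
proof -
  show "restrict_chain (\<lambda>s. s \<in> A \<inter> B) a \<in> frags (A \<inter> B)"
    by (auto simp: frags_def keys_restrict_chain)
  show "a - restrict_chain (\<lambda>s. s \<in> A \<inter> B) a \<in> frags D"
    unfolding restrict_chain_compl frags_def keys_restrict_chain mem_Collect_eq
  proof
    fix s assume "s \<in> Poly_Mapping.keys a \<inter> {s. s \<notin> A \<inter> B}"
    then have s: "s \<in> Poly_Mapping.keys a" "s \<notin> A \<inter> B" by auto
    then have "s \<notin> Poly_Mapping.keys b" using assms(1,2) by (auto simp: frags_def)
    then have "s \<in> Poly_Mapping.keys (a + b)" using s by (simp add: in_keys_iff lookup_add)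
    then show "s \<in> D" using assms(3) by (auto simp: frags_def)
  qed
qed

text \<open>In degree \<open>0\<close> the second condition says that the augmentation vanishes; in positive degrees it is
  always satisfied.\<close>

definition reduced_cycles :: "nat \<Rightarrow> 'v ugraph \<Rightarrow> 'v cube_chain set" where
  "reduced_cycles n G = {c \<in> cycles n G. push_chain n (\<lambda>_. ()) c \<in> degens n}"

lemma degens_unit: "(c :: unit cube_chain) \<in> degens (Suc n)"
proof -
  have "degenerate (Suc n) s" for s :: "int list \<Rightarrow> unit"
    unfolding degenerate_def by (intro exI[of _ 0]) auto
  then show ?thesis by (auto simp: frags_def)
qed

lemma reduced_cycles_Suc: "reduced_cycles (Suc n) G = cycles (Suc n) G"
  by (simp add: reduced_cycles_def degens_unit)

lemma push_chain_reduced_cycles: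
  assumes "graph_hom F G H" "c \<in> reduced_cycles n G"
  shows "push_chain n F c \<in> reduced_cycles n H"
  using assms by (simp add: reduced_cycles_def push_chain_cycles push_chain_push_chain o_def)

lemma reduced_cycles_boundary:
  assumes "c \<in> cube_chains (Suc n) G"
  shows "free_boundary (Suc n) c \<in> reduced_cycles n G"
  unfolding reduced_cycles_def
  using boundary_cycles[OF assms] free_boundary_degens[OF degens_unit]
  by (simp flip: free_boundary_push_chain)

text \<open>The two graphs may differ: this passes from a boundary in one part of the suspension to
  a congruent chain in the smaller overlap.\<close>

lemma reduced_cycles_cong:
  assumes "c \<in> reduced_cycles n G" "d \<in> cube_chains n H" "c - d \<in> degens n"
  shows "d \<in> reduced_cycles n H"
proof -
  have "free_boundary n d = free_boundary n c - free_boundary n (c - d)"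
    "push_chain n (\<lambda>_. ()) d = push_chain n (\<lambda>_. ()) c - push_chain n (\<lambda>_. ()) (c - d)"
    by (simp_all add: free_boundary_diff push_chain_diff)
  then show ?thesis
    using assms free_boundary_degens'[OF assms(3)] push_chain_degens[OF assms(3), of "\<lambda>_. ()"]
    by (auto simp: reduced_cycles_def cycles_def intro: frags_diff)
qed

text \<open>The homotopy ends in a constant map, which factors through a single point; there the
  image of a reduced cycle is degenerate.\<close>

lemma null_homologous_contractible:
  assumes F: "\<And>i. i \<le> (m::nat) \<Longrightarrow> graph_hom (F i) G G" and sym: "sym (edges G)"
    and step: "\<And>i v. i < m \<Longrightarrow> v \<in> verts G \<Longrightarrow> adj_eq G (F i v) (F (Suc i) v)"
    and "\<And>v. v \<in> verts G \<Longrightarrow> F 0 v = v" "\<And>v. v \<in> verts G \<Longrightarrow> F m v = p"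
    and c: "c \<in> reduced_cycles n G"
  shows "null_homologous n G c"
proof -
  have cyc: "c \<in> cycles n G" using c by (simp add: reduced_cycles_def)
  have "null_homologous n G (push_chain n (F m) c - push_chain n (F 0) c)"
    by (rule null_homologous_homotopy[where F = F and m = m, OF F sym step cyc])
  moreover have "push_chain n (F 0) c = c"
    using assms(4) by (intro push_chain_id[OF cycles_chains[OF cyc]])
  moreover have "push_chain n (F m) c = push_chain n (\<lambda>_. p) (push_chain n (\<lambda>_. ()) c)"
    unfolding push_chain_push_chain o_def using assms(5) by (intro push_chain_cong[OF cycles_chains[OF cyc]])
  moreover have "push_chain n (\<lambda>_. p) (push_chain n (\<lambda>_. ()) c) \<in> degens n"
    using c unfolding reduced_cycles_def by (blast intro: push_chain_degens)
  ultimately show ?thesis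
    using null_homologous_cong null_homologous_degens by metis
qed

section \<open>Induced subgraphs, levels and suspensions\<close>

lemma verts_induced [simp]: "verts (induced G T) = verts G \<inter> T"
  by (simp add: induced_def)

lemma adj_eq_induced: "u \<in> T \<Longrightarrow> v \<in> T \<Longrightarrow> adj_eq (induced G T) u v \<longleftrightarrow> adj_eq G u v"
  by (auto simp: adj_eq_def induced_def)

lemma sym_induced: "sym (edges G) \<Longrightarrow> sym (edges (induced G T))"
  by (auto simp: induced_def sym_def)

lemma cubes_induced: "s \<in> cubes n (induced G T) \<longleftrightarrow> s \<in> cubes n G \<and> (\<forall>a\<in>cube_verts n. s a \<in> T)"
  by (auto simp: cubes_iff adj_eq_induced)

lemma null_homologous_inducedD: "null_homologous n (induced G T) c \<Longrightarrow> null_homologous n G c"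
  by (erule null_homologous_mono[rotated]) (auto simp: cubes_induced)

lemma graph_hom_inducedI:
  assumes "\<And>v. v \<in> verts G \<Longrightarrow> v \<in> T \<Longrightarrow> F v \<in> verts H \<and> F v \<in> U"
    and "\<And>u v. u \<in> verts G \<Longrightarrow> v \<in> verts G \<Longrightarrow> u \<in> T \<Longrightarrow> v \<in> T \<Longrightarrow> adj_eq G u v \<Longrightarrow> adj_eq H (F u) (F v)"
  shows "graph_hom F (induced G T) (induced H U)"
  using assms by (auto simp: graph_hom_def adj_eq_induced)

text \<open>Changing one coordinate of the cube at a time changes \<open>l\<close> by at most
  1.\<close>

lemma cube_level_bound:
  assumes s: "s \<in> cubes n G"
    and l: "\<And>u v. u \<in> verts G \<Longrightarrow> v \<in> verts G \<Longrightarrow> adj_eq G u v \<Longrightarrow> (l v :: nat) \<le> Suc (l u)"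
    and a: "a \<in> cube_verts n" and b: "b \<in> cube_verts n"
  shows "l (s b) \<le> l (s a) + n"
  using assms(1,3,4)
proof (induction n arbitrary: s a b)
  case (Suc n)
  obtain t a' where a: "a = t # a'" "t = 0 \<or> t = 1" "a' \<in> cube_verts n" by (rule cube_verts_SucE[OF Suc.prems(2)])
  obtain u b' where b: "b = u # b'" "u = 0 \<or> u = 1" "b' \<in> cube_verts n" by (rule cube_verts_SucE[OF Suc.prems(3)])
  have "cube_face (Suc n) (Suc 0) t s \<in> cubes n G"
    using Suc.prems(1) a(2) by (intro cube_face_in_cubes) auto
  from Suc.IH[OF this a(3) b(3)] have "l (s (t # b')) \<le> l (s (t # a')) + n"
    using a b by (simp add: cube_face_eq)
  moreover have "l (s (u # b')) \<le> Suc (l (s (t # b')))"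
  proof (cases "t = u")
    case False
    then have "adj_eq G (s (t # b')) (s (u # b'))"
      using Suc.prems(1) a(2) b by (auto simp: cubes_iff)
    moreover have "s (t # b') \<in> verts G" "s (u # b') \<in> verts G"
      using Suc.prems(1) a(2) b by (auto simp: cubes_iff)
    ultimately show ?thesis using l by blast
  qed simp
  ultimately show ?case using a b by simp
qed (use l in simp)

text \<open>Coding pairs as naturals keeps iterated suspensions in one type. On the end levels the
  second component is overwritten by \<open>g0\<close>, which identifies all vertices there.\<close>

definition susp_vertex :: "nat \<Rightarrow> nat \<Rightarrow> nat \<Rightarrow> nat \<Rightarrow> nat" where
  "susp_vertex M g0 t g = prod_encode (t, if t = 0 \<or> t = M then g0 else g)"

text \<open>The cylinder \<open>{0..M} \<times> K\<close> with each of its two end levels collapsed to one pole; \<open>g0\<close> only serves to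
  encode the poles.\<close>

definition suspension :: "nat \<Rightarrow> nat \<Rightarrow> nat ugraph \<Rightarrow> nat ugraph" where
  "suspension M g0 K =
     \<lparr>verts = {susp_vertex M g0 t g | t g. t \<le> M \<and> g \<in> verts K},
      edges = {(u, v). u \<noteq> v \<and> (\<exists>t g t' g'. t \<le> M \<and> t' \<le> M \<and> g \<in> verts K \<and> g' \<in> verts K \<and>
         u = susp_vertex M g0 t g \<and> v = susp_vertex M g0 t' g' \<and>
         (t = t' \<and> (g, g') \<in> edges K \<or> (t' = Suc t \<or> t = Suc t') \<and> g = g'))}\<rparr>"

definition sup_norm :: "int list \<Rightarrow> int" where
  "sup_norm x = foldr (\<lambda>t. max \<bar>t\<bar>) x 0"

lemma sup_norm_Nil [simp]: "sup_norm [] = 0"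
  by (simp add: sup_norm_def)

lemma sup_norm_Cons [simp]: "sup_norm (t # x) = max \<bar>t\<bar> (sup_norm x)"
  by (simp add: sup_norm_def)

lemma sup_norm_nonneg: "0 \<le> sup_norm x"
  by (induction x) auto

lemma sup_norm_le_iff: "0 \<le> k \<Longrightarrow> sup_norm x \<le> k \<longleftrightarrow> (\<forall>t\<in>set x. \<bar>t\<bar> \<le> k)"
  by (induction x) auto

lemma sup_norm_insert_at: "k \<le> length x \<Longrightarrow> sup_norm (insert_at k t x) = max \<bar>t\<bar> (sup_norm x)"
proof (induction k arbitrary: x)
  case (Suc k)
  then show ?case by (cases x) auto
qed simp

lemma sup_norm_lattice_adj: "lattice_adj x y \<Longrightarrow> \<bar>sup_norm x - sup_norm y\<bar> \<le> 1"
  by (induction x y rule: lattice_adj.induct) auto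

text \<open>Connectedness of \<open>K\<close> is not asked for, since the first suspension is taken
  of two isolated points; \<open>2 \<le> M\<close> ensures a level strictly between the
  poles.\<close>

locale graph_suspension =
  fixes K :: "nat ugraph" and g0 M :: nat
  assumes edges_K: "edges K \<subseteq> verts K \<times> verts K" and sym_K: "sym (edges K)"
    and g0: "g0 \<in> verts K" and M: "2 \<le> M"
begin

abbreviation "S \<equiv> suspension M g0 K"
abbreviation "pt \<equiv> susp_vertex M g0"

definition lev :: "nat \<Rightarrow> nat" where "lev v = fst (prod_decode v)"
definition bas :: "nat \<Rightarrow> nat" where "bas v = snd (prod_decode v)"

lemma lev_pt [simp]: "lev (pt t g) = t"
  by (simp add: lev_def susp_vertex_def)

lemma bas_pt: "bas (pt t g) = (if t = 0 \<or> t = M then g0 else g)"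
  by (simp add: bas_def susp_vertex_def)

lemma pt_pole: "t = 0 \<or> t = M \<Longrightarrow> pt t g = pt t h"
  by (auto simp: susp_vertex_def)

lemma verts_S: "v \<in> verts S \<longleftrightarrow> (\<exists>t g. v = pt t g \<and> t \<le> M \<and> g \<in> verts K)"
  by (auto simp: suspension_def)

lemma pt_in_verts: "t \<le> M \<Longrightarrow> g \<in> verts K \<Longrightarrow> pt t g \<in> verts S"
  by (auto simp: verts_S)

lemma adj_eq_pt:
  assumes "t \<le> M" "t' \<le> M" "g \<in> verts K" "g' \<in> verts K"
    and "t = t' \<and> adj_eq K g g' \<or> (t' = Suc t \<or> t = Suc t' \<or> t = t') \<and> g = g'"
  shows "adj_eq S (pt t g) (pt t' g')"
proof (cases "pt t g = pt t' g'")
  case False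
  then have "t = t' \<and> (g, g') \<in> edges K \<or> (t' = Suc t \<or> t = Suc t') \<and> g = g'"
    using assms(5) by (auto simp: adj_eq_def)
  then have "(pt t g, pt t' g') \<in> edges S"
    unfolding suspension_def using assms(1-4) False by auto
  then show ?thesis by (simp add: adj_eq_def)
qed simp

lemma adj_eq_S_E:
  assumes "u \<in> verts S" "adj_eq S u v"
  obtains t g t' g' where "u = pt t g" "v = pt t' g'" "t \<le> M" "t' \<le> M" "g \<in> verts K" "g' \<in> verts K"
    "t = t' \<and> adj_eq K g g' \<or> (t' = Suc t \<or> t = Suc t') \<and> g = g'"
proof (cases "u = v")
  case True
  obtain t g where "u = pt t g" "t \<le> M" "g \<in> verts K" using assms(1) by (auto simp: verts_S)
  then show ?thesis using True that[of t g t g] by simp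
next
  case False
  then have "(u, v) \<in> edges S" using assms(2) by (simp add: adj_eq_def)
  then show ?thesis using that unfolding suspension_def by (auto simp: adj_eq_def)
qed

lemma sym_S: "sym (edges S)"
proof (rule symI)
  fix u v assume "(u, v) \<in> edges S"
  then obtain t g t' g' where *: "u \<noteq> v" "t \<le> M" "t' \<le> M" "g \<in> verts K" "g' \<in> verts K" "u = pt t g" "v = pt t' g'"
    "t = t' \<and> (g, g') \<in> edges K \<or> (t' = Suc t \<or> t = Suc t') \<and> g = g'"
    by (auto simp: suspension_def)
  then have "t' = t \<and> (g', g) \<in> edges K \<or> (t = Suc t' \<or> t' = Suc t) \<and> g' = g"
    using sym_K by (auto dest: symD)
  then have "\<exists>a b c d. a \<le> M \<and> c \<le> M \<and> b \<in> verts K \<and> d \<in> verts K \<and> v = pt a b \<and> u = pt c d \<and>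
      (a = c \<and> (b, d) \<in> edges K \<or> (c = Suc a \<or> a = Suc c) \<and> b = d)"
    using * by (intro exI[of _ t'] exI[of _ g'] exI[of _ t] exI[of _ g]) simp
  then show "(v, u) \<in> edges S" using *(1) by (simp add: suspension_def)
qed

text \<open>Every vertex descends along its own meridian to the south pole.\<close>

lemma is_graph_S: "is_graph S"
proof -
  have south: "(pt t g, pt 0 g0) \<in> (edges S)\<^sup>*" if "t \<le> M" "g \<in> verts K" for t g
    using that(1)
  proof (induction t)
    case 0
    then show ?case using pt_pole[of 0 g g0] by simp
  next
    case (Suc t)
    have "adj_eq S (pt (Suc t) g) (pt t g)" using Suc.prems that(2) by (intro adj_eq_pt) auto
    then have "(pt (Suc t) g, pt t g) \<in> (edges S)\<^sup>*" by (auto simp: adj_eq_def)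
    then show ?case using Suc by (auto intro: rtrancl_trans)
  qed
  have "(u, v) \<in> (edges S)\<^sup>*" if uv: "u \<in> verts S" "v \<in> verts S" for u v
  proof -
    have "(u, pt 0 g0) \<in> (edges S)\<^sup>*" "(v, pt 0 g0) \<in> (edges S)\<^sup>*"
      using uv south by (auto simp: verts_S)
    then show ?thesis using sym_rtrancl[OF sym_S] by (meson rtrancl_trans symD)
  qed
  moreover have "edges S \<subseteq> verts S \<times> verts S" "irrefl (edges S)"
    by (auto simp: suspension_def irrefl_def)
  moreover have "verts S \<noteq> {}" using pt_in_verts[of 0 g0] g0 by auto
  ultimately show ?thesis by (simp add: is_graph_def sym_S)
qed

lemma lev_lipschitz: "u \<in> verts S \<Longrightarrow> v \<in> verts S \<Longrightarrow> adj_eq S u v \<Longrightarrow> lev v \<le> Suc (lev u)"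
  by (erule adj_eq_S_E) auto

abbreviation level_part :: "nat set \<Rightarrow> nat ugraph" where
  "level_part T \<equiv> induced S {v. lev v \<in> T}"

definition shift_levels :: "(nat \<Rightarrow> nat) \<Rightarrow> nat \<Rightarrow> nat" where
  "shift_levels p v = pt (p (lev v)) (bas v)"

lemma shift_levels_pt: "(t = 0 \<or> t = M \<Longrightarrow> p t = 0 \<or> p t = M) \<Longrightarrow> shift_levels p (pt t g) = pt (p t) g"
  unfolding shift_levels_def bas_pt lev_pt using pt_pole[of "p t" g0 g] by auto

lemma shift_levels_pt':
  "(t = 0 \<Longrightarrow> p 0 = 0) \<Longrightarrow> (t = M \<Longrightarrow> p M = M) \<Longrightarrow> shift_levels p (pt t g) = pt (p t) g"
  using shift_levels_pt[of t p g] by blast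

text \<open>A pole has forgotten its coordinate in \<open>K\<close>, so poles in the domain are
  required to go to poles; other levels are free to move onto a pole.\<close>

lemma graph_hom_shift_levels:
  assumes p: "\<And>t. p t \<le> M" "\<And>t. p (Suc t) = p t \<or> p (Suc t) = Suc (p t) \<or> p t = Suc (p (Suc t))"
    and pole: "\<And>t. t \<in> T \<Longrightarrow> t = 0 \<or> t = M \<Longrightarrow> p t = 0 \<or> p t = M" and TU: "\<And>t. t \<in> T \<Longrightarrow> t \<le> M \<Longrightarrow> p t \<in> U"
  shows "graph_hom (shift_levels p) (level_part T) (level_part U)"
proof (rule graph_hom_inducedI)
  fix v assume v: "v \<in> verts S" "v \<in> {v. lev v \<in> T}"
  then obtain t g where "v = pt t g" "t \<le> M" "g \<in> verts K" "t \<in> T" by (auto simp: verts_S)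
  then show "shift_levels p v \<in> verts S \<and> shift_levels p v \<in> {v. lev v \<in> U}"
    using pole p TU by (simp add: shift_levels_pt pt_in_verts)
next
  fix u v assume uv: "u \<in> verts S" "v \<in> verts S" "u \<in> {v. lev v \<in> T}" "v \<in> {v. lev v \<in> T}" "adj_eq S u v"
  obtain t g t' g' where *: "u = pt t g" "v = pt t' g'" "t \<le> M" "t' \<le> M" "g \<in> verts K" "g' \<in> verts K"
    "t = t' \<and> adj_eq K g g' \<or> (t' = Suc t \<or> t = Suc t') \<and> g = g'"
    using adj_eq_S_E[OF uv(1,5)] .
  have "adj_eq S (pt (p t) g) (pt (p t') g')"
    using * p(2)[of t] p(2)[of t'] by (intro adj_eq_pt p(1)) auto
  then show "adj_eq S (shift_levels p u) (shift_levels p v)"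
    using * pole uv(3,4) by (simp add: shift_levels_pt)
qed

lemma adj_eq_shift_levels:
  assumes v: "v \<in> verts (level_part T)"
    and p: "\<And>t. t \<le> M \<Longrightarrow> p t \<le> M" "\<And>t. t \<in> T \<Longrightarrow> t = 0 \<or> t = M \<Longrightarrow> p t = 0 \<or> p t = M" "\<And>t. t \<in> T \<Longrightarrow> t \<le> M \<Longrightarrow> p t \<in> U"
    and q: "\<And>t. t \<le> M \<Longrightarrow> q t \<le> M" "\<And>t. t \<in> T \<Longrightarrow> t = 0 \<or> t = M \<Longrightarrow> q t = 0 \<or> q t = M" "\<And>t. t \<in> T \<Longrightarrow> t \<le> M \<Longrightarrow> q t \<in> U"
    and pq: "\<And>t. q t = p t \<or> q t = Suc (p t) \<or> p t = Suc (q t)"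
  shows "adj_eq (level_part U) (shift_levels p v) (shift_levels q v)"
proof -
  obtain t g where *: "v = pt t g" "t \<le> M" "g \<in> verts K" "t \<in> T" using v by (auto simp: verts_S)
  have "adj_eq S (pt (p t) g) (pt (q t) g)"
    using pq[of t] by (intro adj_eq_pt p(1) q(1) *(2,3)) (elim disjE; simp)
  moreover have "shift_levels p v = pt (p t) g" "shift_levels q v = pt (q t) g"
    using shift_levels_pt[of t p g] shift_levels_pt[of t q g] p(2)[OF *(4)] q(2)[OF *(4)]
    unfolding *(1) by blast+
  moreover have "lev (pt (p t) g) \<in> U" "lev (pt (q t) g) \<in> U"
    using p(3) q(3) *(2,4) by simp_all
  ultimately show ?thesis by (simp add: adj_eq_induced)
qed

section \<open>Mayer--Vietoris for the two cones\<close>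

abbreviation "lower \<equiv> level_part (- {M})"
abbreviation "upper \<equiv> level_part (- {0})"
abbreviation "middle \<equiv> level_part (- {0, M})"

abbreviation "overlap_part n \<equiv> restrict_chain (\<lambda>s. s \<in> cubes n upper \<inter> cubes n lower)"

lemma cubes_middle: "cubes n middle = cubes n upper \<inter> cubes n lower"
  by (auto simp: cubes_induced)

text \<open>The cone is contracted by lowering levels to the south pole. \<open>min t M\<close>
  keeps the level map bounded for arguments above \<open>M\<close>, as level maps are total.\<close>

lemma null_homologous_lower:
  assumes "c \<in> reduced_cycles n lower"
  shows "null_homologous n lower c"
proof (rule null_homologous_contractible[where F = "\<lambda>i. shift_levels (\<lambda>t. min t M - i)" and m = M and p = "pt 0 g0"])
  fix i :: nat
  show "graph_hom (shift_levels (\<lambda>t. min t M - i)) lower lower"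
    by (rule graph_hom_shift_levels) (use M in auto)
  fix v assume v: "v \<in> verts lower"
  show "adj_eq lower (shift_levels (\<lambda>t. min t M - i) v) (shift_levels (\<lambda>t. min t M - Suc i) v)"
    by (rule adj_eq_shift_levels[OF v]) (use M in auto)
  obtain t g where *: "v = pt t g" "t \<le> M" "g \<in> verts K" "t \<noteq> M" using v by (auto simp: verts_S)
  then show "shift_levels (\<lambda>t. min t M - 0) v = v" "shift_levels (\<lambda>t. min t M - M) v = pt 0 g0"
    using pt_pole[of 0 g g0] M by (simp_all add: shift_levels_pt')
qed (use assms sym_S in \<open>auto intro: sym_induced\<close>)

lemma null_homologous_upper:
  assumes "c \<in> reduced_cycles n upper"
  shows "null_homologous n upper c"
proof (rule null_homologous_contractible[where F = "\<lambda>i. shift_levels (\<lambda>t. min (t + i) M)" and m = M and p = "pt M g0"])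
  fix i :: nat
  show "graph_hom (shift_levels (\<lambda>t. min (t + i) M)) upper upper"
    by (rule graph_hom_shift_levels) (use M in auto)
  fix v assume v: "v \<in> verts upper"
  show "adj_eq upper (shift_levels (\<lambda>t. min (t + i) M) v) (shift_levels (\<lambda>t. min (t + Suc i) M) v)"
    by (rule adj_eq_shift_levels[OF v]) (use M in auto)
  obtain t g where *: "v = pt t g" "t \<le> M" "g \<in> verts K" "t \<noteq> 0" using v by (auto simp: verts_S)
  then show "shift_levels (\<lambda>t. min (t + 0) M) v = v" "shift_levels (\<lambda>t. min (t + M) M) v = pt M g0"
    using pt_pole[of M g g0] M by (simp_all add: shift_levels_pt')
qed (use assms sym_S in \<open>auto intro: sym_induced\<close>)

lemma graph_hom_bas: "graph_hom bas middle K"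
  unfolding graph_hom_def
proof (intro conjI ballI impI)
  fix v assume "v \<in> verts middle"
  then show "bas v \<in> verts K" by (auto simp: verts_S bas_pt)
next
  fix u v assume uv: "u \<in> verts middle" "v \<in> verts middle" "adj_eq middle u v"
  then have "u \<in> verts S" "adj_eq S u v" by (auto simp: adj_eq_induced)
  then obtain t g t' g' where "u = pt t g" "v = pt t' g'" "t = t' \<and> adj_eq K g g' \<or> (t' = Suc t \<or> t = Suc t') \<and> g = g'"
    by (rule adj_eq_S_E)
  then show "adj_eq K (bas u) (bas v)" using uv by (auto simp: bas_pt)
qed

lemma graph_hom_pt: "0 < t \<Longrightarrow> t < M \<Longrightarrow> graph_hom (pt t) K middle"
  by (auto simp: graph_hom_def pt_in_verts adj_eq_induced intro!: adj_eq_pt)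

text \<open>Without its poles the suspension is a product of \<open>K\<close> with a path. Raising
  all levels to \<open>M - 1\<close> is a homotopy onto the copy of \<open>K\<close> there, so the
  projection to \<open>K\<close> loses no homology.\<close>

lemma null_homologous_middle_iff:
  assumes c: "c \<in> cycles n middle"
  shows "null_homologous n middle c \<longleftrightarrow> null_homologous n K (push_chain n bas c)"
proof
  assume "null_homologous n middle c"
  then show "null_homologous n K (push_chain n bas c)"
    by (rule null_homologous_push_chain[OF graph_hom_bas])
next
  assume "null_homologous n K (push_chain n bas c)"
  then have "null_homologous n middle (push_chain n (pt (M - 1)) (push_chain n bas c))"
    using M by (intro null_homologous_push_chain[OF graph_hom_pt]) auto
  moreover have "null_homologous n middle (push_chain n (shift_levels (\<lambda>t. min (t + M) (M - 1))) c
      - push_chain n (shift_levels (\<lambda>t. min (t + 0) (M - 1))) c)"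
  proof (rule null_homologous_homotopy[where F = "\<lambda>i. shift_levels (\<lambda>t. min (t + i) (M - 1))" and m = M, OF _ _ _ c])
    fix i :: nat
    show "graph_hom (shift_levels (\<lambda>t. min (t + i) (M - 1))) middle middle"
      by (rule graph_hom_shift_levels) (use M in auto)
    show "adj_eq middle (shift_levels (\<lambda>t. min (t + i) (M - 1)) v) (shift_levels (\<lambda>t. min (t + Suc i) (M - 1)) v)"
      if "v \<in> verts middle" for v
      by (rule adj_eq_shift_levels[OF that]) (use M in auto)
  qed (use sym_S in \<open>auto intro: sym_induced\<close>)
  moreover have "push_chain n (shift_levels (\<lambda>t. min (t + 0) (M - 1))) c = c"
    by (rule push_chain_id[OF cycles_chains[OF c]]) (auto simp: verts_S shift_levels_pt' min_def)
  moreover have "push_chain n (shift_levels (\<lambda>t. min (t + M) (M - 1))) c = push_chain n (pt (M - 1)) (push_chain n bas c)"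
  proof -
    have "min (t + M) (M - 1) = M - 1" for t by simp
    then show ?thesis unfolding push_chain_push_chain o_def shift_levels_def by (simp only:)
  qed
  ultimately show "null_homologous n middle c"
    using null_homologous_cong by metis
qed

definition hits_north :: "nat \<Rightarrow> (int list \<Rightarrow> nat) \<Rightarrow> bool" where
  "hits_north n s \<longleftrightarrow> (\<exists>a\<in>cube_verts n. lev (s a) = M)"

text \<open>The connecting homomorphism of the Mayer--Vietoris sequence, followed by a degree on \<open>K\<close>. As the cubes
  have dimension less than \<open>M\<close>, none of them meets both poles, so no subdivision is needed.\<close>

definition connecting :: "nat \<Rightarrow> nat cube_chain \<Rightarrow> nat cube_chain" where
  "connecting n z = overlap_part n
     (free_boundary (Suc n) (restrict_chain (hits_north (Suc n)) z))"

lemma connecting_diff: "connecting n (a - b) = connecting n a - connecting n b"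
  by (simp add: connecting_def restrict_chain_diff free_boundary_diff)

text \<open>Levels vary by at most \<open>n\<close> on a cube, so one that meets the north pole
  misses the south pole; one that misses the north pole is in the lower cone anyway.\<close>

lemma split_chain:
  assumes z: "z \<in> cube_chains n S" and n: "n < M"
  shows "restrict_chain (hits_north n) z \<in> cube_chains n upper"
    and "z - restrict_chain (hits_north n) z \<in> cube_chains n lower"
proof -
  have up: "s \<in> cubes n upper" if s: "s \<in> cubes n S" "hits_north n s" for s
  proof -
    obtain a where a: "a \<in> cube_verts n" "lev (s a) = M" using s(2) by (auto simp: hits_north_def)
    have "lev (s a) \<le> lev (s b) + n" if "b \<in> cube_verts n" for b
      using cube_level_bound[OF s(1) lev_lipschitz that a(1)] by simp
    then have "lev (s b) \<noteq> 0" if "b \<in> cube_verts n" for b using that n a by fastforce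
    then show ?thesis using s(1) by (simp add: cubes_induced)
  qed
  show "restrict_chain (hits_north n) z \<in> cube_chains n upper"
    by (rule frags_mono[OF _ frags_restrict_chain[OF z]]) (use up in blast)
  have lo: "s \<in> cubes n lower" if "s \<in> cubes n S" "\<not> hits_north n s" for s
    using that by (auto simp: cubes_induced hits_north_def)
  show "z - restrict_chain (hits_north n) z \<in> cube_chains n lower"
    unfolding restrict_chain_compl
    by (rule frags_mono[OF _ frags_restrict_chain[OF z]]) (use lo in blast)
qed

text \<open>\<open>z\<close> splits into an upper part \<open>a\<close> and a lower part whose
  boundaries cancel modulo degenerate cubes. So all cubes in the boundary of \<open>a\<close> that
  lie outside the overlap are degenerate, and discarding them gives a chain of
  \<open>middle\<close>.\<close>

lemma connecting_cycle:
  assumes z: "z \<in> cycles (Suc n) S" and n: "Suc n < M"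
  shows "connecting n z \<in> reduced_cycles n middle"
    and "free_boundary (Suc n) (restrict_chain (hits_north (Suc n)) z) - connecting n z \<in> degens n"
proof -
  define a where "a = restrict_chain (hits_north (Suc n)) z"
  have a: "a \<in> cube_chains (Suc n) upper" and b: "z - a \<in> cube_chains (Suc n) lower"
    using split_chain[OF cycles_chains[OF z] n] by (simp_all add: a_def)
  have "free_boundary (Suc n) a + free_boundary (Suc n) (z - a) \<in> degens n"
    using z by (simp add: free_boundary_diff cycles_def)
  note * = restrict_chain_overlap[OF free_boundary_chains[OF a] free_boundary_chains[OF b] this]
  show d: "free_boundary (Suc n) (restrict_chain (hits_north (Suc n)) z) - connecting n z \<in> degens n"
    unfolding connecting_def a_def[symmetric] by (rule *(2))
  have "connecting n z \<in> cube_chains n middle"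
    unfolding connecting_def a_def[symmetric] cubes_middle by (rule *(1))
  then show "connecting n z \<in> reduced_cycles n middle"
    using reduced_cycles_cong[OF reduced_cycles_boundary[OF a] _ d[folded a_def]] by simp
qed

text \<open>Well-definedness and injectivity of the connecting map, given that cycles bound in both
  cones. The bound on \<open>n\<close> is one stricter than in \<open>connecting_cycle\<close>, as a
  chain of (n + 2)-cubes has to be split.\<close>

lemma null_homologous_connecting:
  assumes z: "z \<in> cycles (Suc n) S" and n: "Suc (Suc n) < M"
  shows "null_homologous (Suc n) S z \<longleftrightarrow> null_homologous n middle (connecting n z)"
proof
  define a where "a = restrict_chain (hits_north (Suc n)) z"
  have a: "a \<in> cube_chains (Suc n) upper" and b: "z - a \<in> cube_chains (Suc n) lower"
    using split_chain[OF cycles_chains[OF z]] n by (simp_all add: a_def)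
  have d: "free_boundary (Suc n) a - connecting n z \<in> degens n"
    using connecting_cycle(2)[OF z] n by (simp add: a_def)
  have zb: "free_boundary (Suc n) z \<in> degens n" using z by (simp add: cycles_def)
  show "null_homologous (Suc n) S z" if null: "null_homologous n middle (connecting n z)"
  proof -
    obtain u where u: "u \<in> cube_chains (Suc n) middle" "connecting n z - free_boundary (Suc n) u \<in> degens n"
      using null by (auto simp: null_homologous_def)
    have uu: "u \<in> cube_chains (Suc n) upper" "u \<in> cube_chains (Suc n) lower"
      using u(1) unfolding cubes_middle by (blast intro: frags_mono)+
    \<comment> \<open>Correcting by \<open>u\<close> turns the upper and the lower part into cycles
      of the two cones, where they bound.\<close>
    have au: "free_boundary (Suc n) (a - u) \<in> degens n"
      using frags_add[OF d u(2)] by (simp add: free_boundary_diff)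
    have "a - u \<in> reduced_cycles (Suc n) upper"
      unfolding reduced_cycles_Suc cycles_def using au frags_diff[OF a uu(1)] by simp
    then have 1: "null_homologous (Suc n) S (a - u)"
      using null_homologous_upper null_homologous_inducedD by blast
    have "free_boundary (Suc n) (z - a + u) \<in> degens n"
      using frags_diff[OF zb au] by (simp add: free_boundary_diff free_boundary_add algebra_simps)
    then have "z - a + u \<in> reduced_cycles (Suc n) lower"
      unfolding reduced_cycles_Suc cycles_def using frags_add[OF b uu(2)] by simp
    then have "null_homologous (Suc n) S (z - a + u)"
      using null_homologous_lower null_homologous_inducedD by blast
    from null_homologous_add[OF 1 this] show ?thesis by simp
  qed
  show "null_homologous n middle (connecting n z)" if null: "null_homologous (Suc n) S z"
  proof -
    obtain y where y: "y \<in> cube_chains (Suc (Suc n)) S" "z - free_boundary (Suc (Suc n)) y \<in> degens (Suc n)"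
      using null by (auto simp: null_homologous_def)
    define ya where "ya = restrict_chain (hits_north (Suc (Suc n))) y"
    have ya: "ya \<in> cube_chains (Suc (Suc n)) upper" and yb: "y - ya \<in> cube_chains (Suc (Suc n)) lower"
      using split_chain[OF y(1) n] by (simp_all add: ya_def)
    \<comment> \<open>\<open>v\<close> is \<open>a\<close> changed by a boundary in the upper cone.
      Modulo degenerate cubes it is the negative of a lower chain, so it lies in the overlap up to
      these, and its boundary is that of \<open>a\<close>.\<close>
    define v where "v = a - free_boundary (Suc (Suc n)) ya"
    have 1: "v \<in> cube_chains (Suc n) upper"
      unfolding v_def by (rule frags_diff[OF a free_boundary_chains[OF ya]])
    have 2: "z - a - free_boundary (Suc (Suc n)) (y - ya) \<in> cube_chains (Suc n) lower"
      by (rule frags_diff[OF b free_boundary_chains[OF yb]])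
    have "v + (z - a - free_boundary (Suc (Suc n)) (y - ya)) \<in> degens (Suc n)"
      using y(2) by (simp add: v_def free_boundary_diff)
    note v' = restrict_chain_overlap[OF 1 2 this]
    define u where "u = overlap_part (Suc n) v"
    have "free_boundary (Suc n) (v - u) \<in> degens n"
      using v'(2) unfolding u_def by (rule free_boundary_degens)
    then have "free_boundary (Suc n) a - free_boundary (Suc n) u \<in> degens n"
      by (simp add: v_def free_boundary_diff free_boundary_boundary)
    from frags_diff[OF this d] have "connecting n z - free_boundary (Suc n) u \<in> degens n"
      by simp
    then show ?thesis
      unfolding null_homologous_def using v'(1) unfolding u_def[symmetric] cubes_middle by (rule bexI)
  qed
qed

end

text \<open>Such a degree embeds the homology of reduced cycles into the integers, and the map of
  degree 1 or -1 shows that a spherical class generates. The degree is additive on all chains so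
  that it can be composed with chain-level maps.\<close>

definition spherical :: "nat \<Rightarrow> 'v ugraph \<Rightarrow> 'v \<Rightarrow> bool" where
  "spherical n G v0 \<longleftrightarrow> (\<exists>deg :: 'v cube_chain \<Rightarrow> int.
     (\<forall>a b. deg (a - b) = deg a - deg b) \<and>
     (\<forall>z\<in>reduced_cycles n G. deg z = 0 \<longleftrightarrow> null_homologous n G z) \<and>
     (\<exists>f\<in>based_maps n G v0. \<bar>deg (hurewicz_chain n v0 f)\<bar> = 1))"

section \<open>Suspending based maps\<close>

context graph_suspension
begin

text \<open>A tent over the interval from \<open>0\<close> to \<open>2 * M\<close> with its peak at
  \<open>M\<close>, capped by a bound that can be active only where the sup norm of \<open>x\<close>
  exceeds \<open>r\<close>. By \<open>nat\<close>, negative values become the level of the south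
  pole.\<close>

definition height :: "nat \<Rightarrow> int \<Rightarrow> int list \<Rightarrow> nat" where
  "height r t x = nat (min (int M - \<bar>t - int M\<bar>) (int M + int r - sup_norm x))"

text \<open>The suspension of \<open>f\<close>: it climbs to the north pole along \<open>f\<close>, returns along the base point, and the
  levels are damped outside the support of \<open>f\<close> so that the result is a based map.\<close>

definition suspend :: "nat \<Rightarrow> nat \<Rightarrow> (int list \<Rightarrow> nat) \<Rightarrow> (int list \<Rightarrow> nat)" where
  "suspend n r f = (\<lambda>x\<in>{x. length x = Suc n}.
     pt (height r (hd x) (tl x)) (if hd x \<le> int M then f (tl x) else g0))"

lemma suspend_Cons: "length x = n \<Longrightarrow>
    suspend n r f (t # x) = pt (height r t x) (if t \<le> int M then f x else g0)"
  by (simp add: suspend_def)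

lemma height_le: "height r t x \<le> M"
  by (auto simp: height_def)

lemma height_top: "height r t x = M \<longleftrightarrow> t = int M \<and> sup_norm x \<le> int r"
  using M by (auto simp: height_def nat_eq_iff)

lemma height_bottom:
  "int (2 * M + r) \<le> \<bar>t\<bar> \<or> int (2 * M + r) \<le> sup_norm x \<Longrightarrow> height r t x = 0"
  by (auto simp: height_def)

context
  fixes n r :: nat and f :: "int list \<Rightarrow> nat"
  assumes f: "f \<in> based_maps n K g0" and r: "vanishes_beyond n g0 f r" "1 \<le> r"
begin

text \<open>\<open>1 \<le> r\<close> matters for the empty list, whose norm 0 comes from no
  coordinate.\<close>

lemma far: "length x = n \<Longrightarrow> int r \<le> sup_norm x \<Longrightarrow> f x = g0"
proof -
  assume x: "length x = n" "int r \<le> sup_norm x"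
  then have "\<not> sup_norm x \<le> int r - 1" by simp
  then obtain t where "t \<in> set x" "int r \<le> \<bar>t\<bar>"
    using sup_norm_le_iff[of "int r - 1" x] r(2) by force
  then show ?thesis using vanishes_beyondD[OF r(1)] x by blast
qed

lemma f_in_verts: "length x = n \<Longrightarrow> f x \<in> verts K"
  using f by (simp add: based_maps_iff graph_hom_int_lattice)

lemma suspend_based: "suspend n r f \<in> based_maps (Suc n) S (pt 0 g0)"
  unfolding suspend_def
proof (rule based_mapsI[of _ _ _ "2 * M + r"])
  fix x :: "int list" assume x: "length x = Suc n"
  then show "pt (height r (hd x) (tl x)) (if hd x \<le> int M then f (tl x) else g0) \<in> verts S"
    using g0 f_in_verts by (intro pt_in_verts height_le) auto
  fix t assume t: "t \<in> set x" "int (2 * M + r) \<le> \<bar>t\<bar>"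
  obtain u z where z: "x = u # z" using x by (cases x) auto
  have "int (2 * M + r) \<le> sup_norm z" if "t \<in> set z"
    using sup_norm_le_iff[of "sup_norm z" z] sup_norm_nonneg[of z] that t(2) by fastforce
  then have "height r u z = 0" using t z by (intro height_bottom) auto
  then show "pt (height r (hd x) (tl x)) (if hd x \<le> int M then f (tl x) else g0) = pt 0 g0"
    using z pt_pole by simp
next
  fix x y assume xy: "length x = Suc n" "length y = Suc n" "lattice_adj x y"
  obtain t z s w where z: "x = t # z" "y = s # w" "length z = n" "length w = n"
    using xy by (metis length_Suc_conv)
  let ?L = "height r"
  have adj: "\<bar>t - s\<bar> = 1 \<and> z = w \<or> t = s \<and> lattice_adj z w" using xy z by simp
  have L: "?L s w = Suc (?L t z) \<or> ?L t z = Suc (?L s w) \<or> ?L t z = ?L s w"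
  proof -
    have "\<bar>(int M - \<bar>t - int M\<bar>) - (int M - \<bar>s - int M\<bar>)\<bar> \<le> 1" using adj by arith
    moreover have "\<bar>(int M + int r - sup_norm z) - (int M + int r - sup_norm w)\<bar> \<le> 1"
      using adj sup_norm_lattice_adj[of z w] by auto
    ultimately have "\<bar>min (int M - \<bar>t - int M\<bar>) (int M + int r - sup_norm z)
        - min (int M - \<bar>s - int M\<bar>) (int M + int r - sup_norm w)\<bar> \<le> 1"
      by (auto simp: min_def)
    moreover have "nat q = Suc (nat p) \<or> nat p = Suc (nat q) \<or> nat p = nat q" if "\<bar>p - q\<bar> \<le> 1" for p q
      using that by arith
    ultimately show ?thesis unfolding height_def by blast
  qed
  have fadj: "adj_eq K (f z) (f w)" if "lattice_adj z w"
    using f that z by (auto simp: based_maps_iff graph_hom_int_lattice)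
  define g where "g = (if t \<le> int M then f z else g0)"
  define h where "h = (if s \<le> int M then f w else g0)"
  have gh: "g \<in> verts K" "h \<in> verts K" using g0 f_in_verts z by (auto simp: g_def h_def)
  have "adj_eq S (pt (?L t z) g) (pt (?L s w) h)"
  proof (cases "g = h")
    case True
    then show ?thesis using L gh by (intro adj_eq_pt height_le) auto
  next
    case False
    show ?thesis
    proof (cases "t = s")
      case True
      then have zw: "t \<le> int M" "f z \<noteq> f w" "lattice_adj z w" using False adj by (auto simp: g_def h_def split: if_splits)
      \<comment> \<open>One of the two points is within radius \<open>r\<close>, so both have norm
        at most \<open>r\<close>; the cap is inactive and the height depends only on the common
        first coordinate.\<close>
      then have "sup_norm z < int r \<or> sup_norm w < int r" using far z by (metis not_le)
      then have "?L t z = ?L s w"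
        using sup_norm_lattice_adj[OF zw(3)] True by (auto simp: height_def)
      then show ?thesis using gh fadj[OF zw(3)] zw(1) True
        by (intro adj_eq_pt height_le) (auto simp: g_def h_def)
    next
      case ts: False
      then have zw: "z = w" "\<bar>t - s\<bar> = 1" using adj by auto
      \<comment> \<open>The base coordinate switches from \<open>f z\<close> to \<open>g0\<close>
        between \<open>int M\<close> and \<open>int M + 1\<close>. If this is a real change, the
        earlier point is the north pole, where the base coordinate is forgotten.\<close>
      then have ts': "t = int M \<or> s = int M" "f z \<noteq> g0" using False by (auto simp: g_def h_def split: if_splits)
      then have "sup_norm z \<le> int r" using far[OF z(3)] by force
      then have "?L t z = M \<or> ?L s w = M" using ts' zw(1) by (auto simp: height_top)
      then show ?thesis
      proof
        assume "?L t z = M"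
        then have "pt (?L t z) g = pt (?L t z) h" by (simp add: pt_pole)
        then show ?thesis using L gh by (simp only:) (intro adj_eq_pt height_le, auto)
      next
        assume "?L s w = M"
        then have "pt (?L s w) h = pt (?L s w) g" by (simp add: pt_pole)
        then show ?thesis using L gh by (simp only:) (intro adj_eq_pt height_le, auto)
      qed
    qed
  qed
  then show "adj_eq S (pt (height r (hd x) (tl x)) (if hd x \<le> int M then f (tl x) else g0))
      (pt (height r (hd y) (tl y)) (if hd y \<le> int M then f (tl y) else g0))"
    unfolding z list.sel g_def h_def .
qed

text \<open>The north pole is attained exactly at first coordinate \<open>int M\<close> and norm at
  most \<open>r\<close>; the box lists the lowest corners of the unit cubes that meet this
  set.\<close>

lemma hits_north_suspend:
  assumes x: "length x = n"
  shows "hits_north (Suc n) (subcube (Suc n) (suspend n r f) (t # x)) \<longleftrightarrow>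
    t # x \<in> lattice_box ((int M - 1, int M + 1) # replicate n (- (int r + 1), int r + 1))"
proof -
  have val: "subcube (Suc n) (suspend n r f) (t # x) (u # a) =
      pt (height r (t + u) (map2 (+) x a)) (if t + u \<le> int M then f (map2 (+) x a) else g0)"
    if "u = 0 \<or> u = 1" "a \<in> cube_verts n" for u a
    using that x by (auto simp: subcube_def suspend_Cons length_cube_verts)
  have "hits_north (Suc n) (subcube (Suc n) (suspend n r f) (t # x)) \<longleftrightarrow>
      (\<exists>u a. (u = 0 \<or> u = 1) \<and> a \<in> cube_verts n \<and> t + u = int M \<and> sup_norm (map2 (+) x a) \<le> int r)"
  proof
    assume "hits_north (Suc n) (subcube (Suc n) (suspend n r f) (t # x))"
    then obtain b where b: "b \<in> cube_verts (Suc n)" "lev (subcube (Suc n) (suspend n r f) (t # x) b) = M"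
      by (auto simp: hits_north_def)
    obtain u a where ua: "b = u # a" "u = 0 \<or> u = 1" "a \<in> cube_verts n" by (rule cube_verts_SucE[OF b(1)])
    show "\<exists>u a. (u = 0 \<or> u = 1) \<and> a \<in> cube_verts n \<and> t + u = int M \<and> sup_norm (map2 (+) x a) \<le> int r"
      using b(2) unfolding ua(1) val[OF ua(2,3)] lev_pt height_top using ua by blast
  next
    assume "\<exists>u a. (u = 0 \<or> u = 1) \<and> a \<in> cube_verts n \<and> t + u = int M \<and> sup_norm (map2 (+) x a) \<le> int r"
    then obtain u a where ua: "u = 0 \<or> u = 1" "a \<in> cube_verts n" "t + u = int M" "sup_norm (map2 (+) x a) \<le> int r"
      by blast
    then have "lev (subcube (Suc n) (suspend n r f) (t # x) (u # a)) = M"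
      unfolding val[OF ua(1,2)] lev_pt height_top by blast
    then show "hits_north (Suc n) (subcube (Suc n) (suspend n r f) (t # x))"
      unfolding hits_north_def using ua by (intro bexI[of _ "u # a"]) auto
  qed
  also have "\<dots> \<longleftrightarrow> (t = int M - 1 \<or> t = int M) \<and> (\<forall>s\<in>set x. - (int r + 1) \<le> s \<and> s < int r + 1)"
  proof
    assume "\<exists>u a. (u = 0 \<or> u = 1) \<and> a \<in> cube_verts n \<and> t + u = int M \<and> sup_norm (map2 (+) x a) \<le> int r"
    then obtain u a where ua: "u = 0 \<or> u = 1" "a \<in> cube_verts n" "t + u = int M" "sup_norm (map2 (+) x a) \<le> int r"
      by blast
    have "- (int r + 1) \<le> s \<and> s < int r + 1" if "s \<in> set x" for s
    proof -
      obtain i where i: "i < n" "s = x ! i" using \<open>s \<in> set x\<close> x by (auto simp: in_set_conv_nth)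
      have "a ! i \<in> {0, 1}" using ua(2) i by (auto simp: cube_verts_eq subset_iff)
      moreover have "map2 (+) x a ! i \<in> set (map2 (+) x a)"
        using i x ua(2) by (intro nth_mem) (simp add: length_cube_verts)
      then have "\<bar>x ! i + a ! i\<bar> \<le> int r"
        using ua(2,4) i x sup_norm_le_iff[of "int r" "map2 (+) x a"] by (auto simp: length_cube_verts)
      ultimately show ?thesis using i by auto
    qed
    then show "(t = int M - 1 \<or> t = int M) \<and> (\<forall>s\<in>set x. - (int r + 1) \<le> s \<and> s < int r + 1)"
      using ua by auto
  next
    assume *: "(t = int M - 1 \<or> t = int M) \<and> (\<forall>s\<in>set x. - (int r + 1) \<le> s \<and> s < int r + 1)"
    \<comment> \<open>The corner of the cube nearest to the origin: step up in precisely the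
      negative coordinates.\<close>
    define a :: "int list" where "a = map (\<lambda>s. if s < 0 then 1 else 0) x"
    have "map2 (+) x a = map (\<lambda>s. if s < 0 then s + 1 else s) x"
      unfolding a_def by (induction x) auto
    then have "sup_norm (map2 (+) x a) \<le> int r" using * by (auto simp: sup_norm_le_iff)
    moreover have "a \<in> cube_verts n" using x by (auto simp: a_def cube_verts_eq)
    moreover have "int M - t = 0 \<or> int M - t = 1" using * by auto
    ultimately show "\<exists>u a. (u = 0 \<or> u = 1) \<and> a \<in> cube_verts n \<and> t + u = int M \<and> sup_norm (map2 (+) x a) \<le> int r"
      by (intro exI[of _ "int M - t"] exI[of _ a]) auto
  qed
  also have "\<dots> \<longleftrightarrow> t # x \<in> lattice_box ((int M - 1, int M + 1) # replicate n (- (int r + 1), int r + 1))"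
    unfolding Cons_in_lattice_box lattice_box_replicate using x by auto
  finally show ?thesis .
qed

text \<open>The cubes meeting the north pole fill a box, and the Stokes formula leaves its faces.
  The lower one shows \<open>f\<close> on level \<open>M - 1\<close>; the upper one shows the
  constant \<open>g0\<close> on the same level, which is just the normalising term; the others
  cancel in pairs. The sign is that of the first direction.\<close>

lemma connecting_hurewicz_chain:
  "connecting n (hurewicz_chain (Suc n) (pt 0 g0) (suspend n r f))
    = - push_chain n (pt (M - 1)) (hurewicz_chain n g0 f)"
proof -
  define F where "F = suspend n r f"
  define B where "B = replicate n (- (int r + 1), int r + 1)"
  define bs where "bs = (int M - 1, int M + 1) # B"
  \<comment> \<open>The summand \<open>2 * M + r\<close> makes the large box contain the one around
    the peak.\<close>
  define R where "R = radius (Suc n) (pt 0 g0) F + 2 * M + r"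
  have van: "vanishes_beyond (Suc n) (pt 0 g0) F (radius (Suc n) (pt 0 g0) F)"
    unfolding F_def by (rule based_maps_vanish[OF suspend_based])
  define A where "A = lattice_box (replicate (Suc n) (- int R, int R))"
  have hits: "hits_north (Suc n) (subcube (Suc n) F x) \<longleftrightarrow> x \<in> lattice_box bs" if x: "length x = Suc n" for x
    using hits_north_suspend[of "tl x" "hd x"] x unfolding F_def bs_def B_def by (cases x) auto
  have "restrict_chain (hits_north (Suc n)) (hurewicz_chain (Suc n) (pt 0 g0) F)
      = (\<Sum>x\<in>A. if x \<in> lattice_box bs then frag_of (subcube (Suc n) F x) else 0)"
  proof -
    \<comment> \<open>The base point is the south pole, so the normalising cube is not among those
      hitting the north pole.\<close>
    have "restrict_chain (hits_north (Suc n)) (frag_of (const_cube (Suc n) (pt 0 g0))) = 0"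
      using M by (auto simp: restrict_chain_of hits_north_def)
    moreover have "hurewicz_chain (Suc n) (pt 0 g0) F
        = (\<Sum>x\<in>A. frag_of (subcube (Suc n) F x) - frag_of (const_cube (Suc n) (pt 0 g0)))"
      unfolding A_def by (rule hurewicz_chain_box[OF van]) (simp add: R_def)
    moreover have "finite A" by (simp only: A_def finite_lattice_box)
    ultimately have "restrict_chain (hits_north (Suc n)) (hurewicz_chain (Suc n) (pt 0 g0) F)
        = (\<Sum>x\<in>A. if hits_north (Suc n) (subcube (Suc n) F x) then frag_of (subcube (Suc n) F x) else 0)"
      by (simp only: restrict_chain_sum restrict_chain_diff restrict_chain_of[of _ "subcube _ _ _"] diff_zero)
    also have "\<dots> = (\<Sum>x\<in>A. if x \<in> lattice_box bs then frag_of (subcube (Suc n) F x) else 0)"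
      by (rule sum.cong[OF refl], subst hits) (auto simp: A_def length_lattice_box simp del: replicate_Suc)
    finally show ?thesis .
  qed
  also have "\<dots> = (\<Sum>x\<in>lattice_box bs. frag_of (subcube (Suc n) F x))"
  proof (rule sum.mono_neutral_cong_right)
    show "lattice_box bs \<subseteq> A"
    proof
      fix x assume "x \<in> lattice_box bs"
      then obtain t z where x: "x = t # z" "int M - 1 \<le> t" "t < int M + 1" "z \<in> lattice_box B"
        unfolding bs_def by auto
      have "z \<in> lattice_box (replicate n (- int R, int R))"
        using x(4) M unfolding B_def lattice_box_replicate R_def by fastforce
      then show "x \<in> A" unfolding A_def x(1) replicate_Suc Cons_in_lattice_box using x M by (simp add: R_def)
    qed
  qed (simp_all only: A_def finite_lattice_box DiffD2 if_True if_False ball_simps, auto)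
  finally have top: "restrict_chain (hits_north (Suc n)) (hurewicz_chain (Suc n) (pt 0 g0) F)
      = (\<Sum>x\<in>lattice_box bs. frag_of (subcube (Suc n) F x))" .
  have "free_boundary (Suc n) (\<Sum>x\<in>lattice_box bs. frag_of (subcube (Suc n) F x))
    = (\<Sum>k<Suc n. frag_cmul ((-1) ^ Suc k) (box_face n F bs k))"
    by (rule free_boundary_lattice_box) (auto simp: bs_def B_def nth_Cons split: nat.splits)
  also have "\<dots> = - (\<Sum>y\<in>lattice_box B. frag_of (subcube n (F \<circ> insert_at 0 (int M - 1)) y)
      - frag_of (subcube n (F \<circ> insert_at 0 (int M + 1)) y))"
  proof -
    have "box_face n F bs (Suc k) = 0" if k: "k < n" for k
    proof (rule box_face_eq_0)
      fix z :: "int list" assume "length z = n"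
      then obtain t w where z: "z = t # w" "length w = n - 1" using k by (cases z) auto
      have "f (insert_at k s w) = g0" if "\<bar>s\<bar> = int r + 1" for s
        using that z k by (intro far) (auto simp: sup_norm_insert_at)
      \<comment> \<open>The height sees only the norm, and \<open>f\<close> is \<open>g0\<close> on
        both sides, so the two values agree although they vary along the side.\<close>
      then have "F (insert_at (Suc k) (- (int r + 1)) z) = F (insert_at (Suc k) (int r + 1) z)"
        using z k by (simp add: F_def suspend_Cons height_def sup_norm_insert_at add.commute)
      then show "F (insert_at (Suc k) (fst (bs ! Suc k)) z) = F (insert_at (Suc k) (snd (bs ! Suc k)) z)"
        using k by (simp add: bs_def B_def)
    qed (use k in \<open>auto simp: bs_def B_def\<close>)
    then show ?thesis unfolding sum.lessThan_Suc_shift by (simp add: box_face_def[of _ _ _ 0] bs_def)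
  qed
  also have "\<dots> = - push_chain n (pt (M - 1)) (hurewicz_chain n g0 f)"
  proof -
    have "subcube n (F \<circ> insert_at 0 (int M - 1)) y = compose (cube_verts n) (pt (M - 1)) (subcube n f y)"
      "subcube n (F \<circ> insert_at 0 (int M + 1)) y = compose (cube_verts n) (pt (M - 1)) (const_cube n g0)"
      if y: "y \<in> lattice_box B" for y
    proof -
      have "F ((int M - 1) # map2 (+) y a) = pt (M - 1) (f (map2 (+) y a)) \<and>
          F ((int M + 1) # map2 (+) y a) = pt (M - 1) g0" if a: "a \<in> cube_verts n" for a
      proof -
        have len: "length y = n" using y by (simp add: B_def lattice_box_replicate)
        have "\<bar>s\<bar> \<le> int r + 1" if s: "s \<in> set (map2 (+) y a)" for s
        proof -
          obtain i where i: "i < n" "s = y ! i + a ! i"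
            using s len a by (auto simp: in_set_conv_nth length_cube_verts)
          have "a ! i \<in> {0, 1}" using a i by (auto simp: cube_verts_eq subset_iff)
          moreover have "- (int r + 1) \<le> y ! i" "y ! i < int r + 1"
            using y i len unfolding B_def lattice_box_replicate by auto
          ultimately show ?thesis using i by auto
        qed
        \<comment> \<open>Up to norm \<open>r + 1\<close> the cap is at least \<open>M - 1\<close>,
          so one step before and one step after the peak the height is exactly
          \<open>M - 1\<close>.\<close>
        then have "sup_norm (map2 (+) y a) \<le> int r + 1" by (subst sup_norm_le_iff) auto
        then have "height r (int M - 1) (map2 (+) y a) = M - 1"
          "height r (int M + 1) (map2 (+) y a) = M - 1"
          by (auto simp: height_def)
        then show ?thesis using len a by (simp add: F_def suspend_Cons length_cube_verts)
      qed
      then show "subcube n (F \<circ> insert_at 0 (int M - 1)) y = compose (cube_verts n) (pt (M - 1)) (subcube n f y)"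
        "subcube n (F \<circ> insert_at 0 (int M + 1)) y = compose (cube_verts n) (pt (M - 1)) (const_cube n g0)"
        by (auto simp: subcube_def compose_def)
    qed
    moreover have "hurewicz_chain n g0 f = (\<Sum>y\<in>lattice_box B. frag_of (subcube n f y) - frag_of (const_cube n g0))"
      using hurewicz_chain_box[OF r(1), of "Suc r"] by (simp add: B_def add.commute)
    ultimately show ?thesis
      by (simp add: push_chain_sum push_chain_diff push_chain_of)
  qed
  finally have bd: "free_boundary (Suc n) (\<Sum>x\<in>lattice_box bs. frag_of (subcube (Suc n) F x))
      = - push_chain n (pt (M - 1)) (hurewicz_chain n g0 f)" .
  have "hurewicz_chain n g0 f \<in> cube_chains n K"
    using f g0 by (intro hurewicz_chain_chains) (auto simp: based_maps_iff)
  then have "push_chain n (pt (M - 1)) (hurewicz_chain n g0 f) \<in> cube_chains n middle"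
    using M by (intro push_chain_chains[OF graph_hom_pt]) auto
  \<comment> \<open>\<open>overlap_part\<close> changes nothing: the boundary already lives on the
    single inner level \<open>M - 1\<close>.\<close>
  then have "overlap_part n (push_chain n (pt (M - 1)) (hurewicz_chain n g0 f))
      = push_chain n (pt (M - 1)) (hurewicz_chain n g0 f)"
    by (rule restrict_chain_id) (simp only: cubes_middle)
  then show ?thesis
    unfolding connecting_def F_def[symmetric] top bd restrict_chain_minus by (rule arg_cong)
qed

end

text \<open>The new degree of \<open>z\<close> is the old degree of its connecting chain, projected
  to \<open>K\<close>. On the suspended map it is minus the old degree of \<open>f\<close>, so
  absolute value 1 is kept.\<close>

lemma spherical_suspension:
  assumes "spherical n K g0" and n: "Suc (Suc n) < M"
  shows "spherical (Suc n) S (pt 0 g0)"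
proof -
  obtain deg :: "nat cube_chain \<Rightarrow> int" and f
    where add: "\<And>a b. deg (a - b) = deg a - deg b"
      and null: "\<And>z. z \<in> reduced_cycles n K \<Longrightarrow> deg z = 0 \<longleftrightarrow> null_homologous n K z"
      and f: "f \<in> based_maps n K g0" "\<bar>deg (hurewicz_chain n g0 f)\<bar> = 1"
    using assms(1) unfolding spherical_def by blast
  define r where "r = max 1 (radius n g0 f)"
  have r: "vanishes_beyond n g0 f r" "1 \<le> r"
    by (auto simp: r_def intro: vanishes_beyond_mono[OF based_maps_vanish[OF f(1)]])
  define deg' where "deg' z = deg (push_chain n bas (connecting n z))" for z
  show ?thesis
    unfolding spherical_def
  proof (intro exI[of _ deg'] conjI allI ballI)
    show "deg' (a - b) = deg' a - deg' b" for a b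
      by (simp add: deg'_def connecting_diff push_chain_diff add)
  next
    fix z assume "z \<in> reduced_cycles (Suc n) S"
    then have z: "z \<in> cycles (Suc n) S" by (simp add: reduced_cycles_Suc)
    have c: "connecting n z \<in> reduced_cycles n middle" using connecting_cycle(1)[OF z] n by simp
    then have "deg' z = 0 \<longleftrightarrow> null_homologous n K (push_chain n bas (connecting n z))"
      unfolding deg'_def by (intro null push_chain_reduced_cycles[OF graph_hom_bas])
    also have "\<dots> \<longleftrightarrow> null_homologous n middle (connecting n z)"
      using c by (intro null_homologous_middle_iff[symmetric]) (simp add: reduced_cycles_def)
    also have "\<dots> \<longleftrightarrow> null_homologous (Suc n) S z"
      by (rule null_homologous_connecting[OF z n, symmetric])
    finally show "deg' z = 0 \<longleftrightarrow> null_homologous (Suc n) S z" .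
  next
    have h: "hurewicz_chain n g0 f \<in> cube_chains n K"
      using f(1) g0 by (intro hurewicz_chain_chains) (auto simp: based_maps_iff)
    have "push_chain n bas (push_chain n (pt (M - 1)) (hurewicz_chain n g0 f)) = hurewicz_chain n g0 f"
    proof -
      \<comment> \<open>Level \<open>M - 1\<close> is strictly between the poles, so
        \<open>bas\<close> recovers the coordinate in \<open>K\<close>.\<close>
      have "M - 1 \<noteq> 0" "M - 1 \<noteq> M" using M by auto
      then show ?thesis
        unfolding push_chain_push_chain by (intro push_chain_id[OF h]) (simp add: bas_pt)
    qed
    then have "deg' (hurewicz_chain (Suc n) (pt 0 g0) (suspend n r f)) = deg (0 - hurewicz_chain n g0 f)"
      unfolding deg'_def connecting_hurewicz_chain[OF f(1) r] by (simp add: push_chain_minus)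
    also have "\<dots> = - deg (hurewicz_chain n g0 f)"
      using add[of 0 0] add[of 0 "hurewicz_chain n g0 f"] by simp
    finally show "\<exists>f\<in>based_maps (Suc n) S (pt 0 g0). \<bar>deg' (hurewicz_chain (Suc n) (pt 0 g0) f)\<bar> = 1"
      using f(2) suspend_based[OF f(1) r] by (intro bexI[of _ "suspend n r f"]) auto
  qed
qed

text \<open>Finiteness is passed on to the next suspension; the count tells suspensions of different
  lengths apart.\<close>

lemma card_verts_suspension:
  assumes "finite (verts K)"
  shows "finite (verts S)" "card (verts S) = 2 + (M - 1) * card (verts K)"
proof -
  have "verts S = {pt 0 g0, pt M g0} \<union> prod_encode ` ({0<..<M} \<times> verts K)"
  proof (intro equalityI subsetI)
    fix v assume "v \<in> verts S"
    then obtain t g where v: "v = pt t g" "t \<le> M" "g \<in> verts K" by (auto simp: verts_S)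
    then show "v \<in> {pt 0 g0, pt M g0} \<union> prod_encode ` ({0<..<M} \<times> verts K)"
      by (cases "t = 0 \<or> t = M") (auto simp: susp_vertex_def)
  next
    fix v assume "v \<in> {pt 0 g0, pt M g0} \<union> prod_encode ` ({0<..<M} \<times> verts K)"
    moreover have "prod_encode (t, g) = pt t g" if "0 < t" "t < M" for t g
      using that by (simp add: susp_vertex_def)
    ultimately show "v \<in> verts S" using pt_in_verts g0 by auto
  qed
  moreover have disj: "{pt 0 g0, pt M g0} \<inter> prod_encode ` ({0<..<M} \<times> verts K) = {}"
    by (auto simp: susp_vertex_def)
  moreover have "card {pt 0 g0, pt M g0} = 2" using M by (auto simp: susp_vertex_def)
  moreover have "card (prod_encode ` ({0<..<M} \<times> verts K)) = (M - 1) * card (verts K)"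
    using card_image[OF inj_prod_encode] by (simp add: card_cartesian_product)
  moreover have "finite {pt 0 g0, pt M g0}" "finite (prod_encode ` ({0<..<M} \<times> verts K))"
    using assms by auto
  ultimately show "finite (verts S)" "card (verts S) = 2 + (M - 1) * card (verts K)"
    using card_Un_disjoint[OF _ _ disj] by (simp_all only: finite_Un)
qed

end

section \<open>Spheres of all dimensions and the infinite family\<close>

lemma spherical_two_points: "spherical 0 \<lparr>verts = {0, 1}, edges = {}\<rparr> (0 :: nat)"
proof -
  define K :: "nat ugraph" where "K = \<lparr>verts = {0, 1}, edges = {}\<rparr>"
  \<comment> \<open>A reduced 0-cycle is a multiple of the difference of the two points, so its
    coefficient at the vertex other than the base point serves as degree.\<close>
  define deg where "deg c = Poly_Mapping.lookup c (const_cube 0 (1 :: nat))" for c :: "nat cube_chain"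
  have cubes: "cubes 0 K = {const_cube 0 0, const_cube 0 1}"
  proof -
    have "s = const_cube 0 (s [])" if "s \<in> cubes 0 K" for s
      using that by (intro extensionalityI[of _ "cube_verts 0"]) (auto simp: cubes_iff)
    moreover have "s [] = 0 \<or> s [] = 1" if "s \<in> cubes 0 K" for s
      using that by (auto simp: cubes_iff K_def)
    ultimately have "cubes 0 K \<subseteq> {const_cube 0 0, const_cube 0 1}" by (metis insertCI subsetI)
    moreover have "0 \<in> verts K" "1 \<in> verts K" by (simp_all add: K_def)
    ultimately show ?thesis by (blast intro: const_cube_in_cubes)
  qed
  have neq: "const_cube 0 (0 :: nat) \<noteq> const_cube 0 1"
    by (metis cube_verts_0 insertI1 restrict_apply' zero_neq_one)
  have null: "null_homologous 0 K c \<longleftrightarrow> c = 0" for c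
  proof
    assume "null_homologous 0 K c"
    then obtain u where u: "u \<in> cube_chains (Suc 0) K" "c - free_boundary (Suc 0) u \<in> degens 0"
      by (auto simp: null_homologous_def)
    \<comment> \<open>Without edges every 1-cube is constant, so boundaries in degree 0
      vanish.\<close>
    have "degenerate (Suc 0) s" if s: "s \<in> cubes (Suc 0) K" for s
    proof -
      have "s [0] = s [1]"
        using s by (auto simp: cubes_iff adj_eq_def K_def)
      then have "cube_face (Suc 0) (Suc 0) 0 s = cube_face (Suc 0) (Suc 0) 1 s"
        by (auto simp: cube_face_eq)
      then show ?thesis by (auto simp: degenerate_def)
    qed
    then have "u \<in> degens (Suc 0)" using u(1) by (auto simp: frags_def)
    then have "free_boundary (Suc 0) u = 0" using free_boundary_degens degens_0 by blast
    then show "c = 0" using u(2) by (simp add: degens_0)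
  qed simp
  define f where "f = const_cube 0 (1 :: nat)"
  have f: "f \<in> based_maps 0 K 0"
    by (auto simp: f_def based_maps_iff graph_hom_int_lattice K_def intro!: vanishes_beyondI)
  have "subcube 0 f [] = const_cube 0 1"
    by (auto simp: f_def subcube_def)
  then have "cube_support 0 0 f = {[]}" using neq by (auto simp: cube_support_def)
  then have "hurewicz_chain 0 0 f = frag_of (const_cube 0 1) - frag_of (const_cube 0 0)"
    using \<open>subcube 0 f [] = const_cube 0 1\<close> by (simp add: hurewicz_chain_def)
  then have degf: "deg (hurewicz_chain 0 0 f) = 1"
    using neq by (simp add: deg_def lookup_minus)
  have "deg z = 0 \<longleftrightarrow> null_homologous 0 K z" if z: "z \<in> reduced_cycles 0 K" for z
    unfolding null
  proof
    assume 0: "deg z = 0"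
    have "Poly_Mapping.keys z \<subseteq> {const_cube 0 0, const_cube 0 1}"
      using z by (simp add: reduced_cycles_def cycles_0 cubes frags_def)
    moreover have "const_cube 0 1 \<notin> Poly_Mapping.keys z" using 0 by (simp add: deg_def in_keys_iff)
    ultimately have sub: "Poly_Mapping.keys z \<subseteq> {const_cube 0 0}" by blast
    define b where "b = Poly_Mapping.lookup z (const_cube 0 0)"
    have zb: "z = frag_cmul b (frag_of (const_cube 0 0))"
      using sub by (intro poly_mapping_eqI) (auto simp: b_def in_keys_iff)
    \<comment> \<open>The vanishing augmentation leaves no multiple of the base point.\<close>
    have "push_chain 0 (\<lambda>_. ()) z = 0" using z by (simp add: reduced_cycles_def degens_0)
    then have "b = 0" unfolding zb push_chain_cmul push_chain_of by simp
    then show "z = 0" using zb by simp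
  qed (simp add: deg_def)
  then show ?thesis
    unfolding spherical_def K_def[symmetric] using f degf
    by (intro exI[of _ deg] conjI allI ballI bexI[of _ f]) (simp_all only: abs_one, simp_all add: deg_def lookup_minus)
qed

lemma spherical_exists:
  "\<exists>(K :: nat ugraph) g0. edges K \<subseteq> verts K \<times> verts K \<and> sym (edges K) \<and> g0 \<in> verts K \<and> finite (verts K) \<and>
     spherical n K g0"
proof (induction n)
  case 0
  show ?case
    using spherical_two_points by (intro exI[of _ "\<lparr>verts = {0, 1}, edges = {}\<rparr>"] exI[of _ 0]) (auto simp: sym_def)
next
  case (Suc n)
  then obtain K :: "nat ugraph" and g0 where K: "edges K \<subseteq> verts K \<times> verts K" "sym (edges K)" "g0 \<in> verts K"
    "finite (verts K)" "spherical n K g0" by blast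
  \<comment> \<open>The least length above \<open>n + 2\<close>.\<close>
  interpret graph_suspension K g0 "n + 3"
    using K by unfold_locales auto
  show ?case
    using spherical_suspension[OF K(5)] is_graph_S card_verts_suspension(1)[OF K(4)] pt_in_verts[of 0 g0] g0
    by (intro exI[of _ S] exI[of _ "pt 0 g0"]) (auto simp: is_graph_def)
qed

text \<open>As \<open>psi\<close> is a homomorphism, its image contains all multiples of the class
  of \<open>h\<close>. Subtracting a suitable multiple of \<open>h\<close> from a cycle makes the
  degree \<open>0\<close>, and the difference is then null homologous. The degree of
  \<open>h\<close> itself is nonzero, so its class is nontrivial.\<close>

lemma (in pointed_graph) spherical_psi:
  assumes "spherical n G v0" and n: "1 \<le> n"
  shows "psi n G v0 ` carrier (homotopy_gp n G v0) = carrier (homology_gp n G)"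
    and "carrier (homology_gp n G) \<noteq> {\<one>\<^bsub>homology_gp n G\<^esub>}"
proof -
  obtain deg :: "'v cube_chain \<Rightarrow> int" and f
    where add: "\<And>a b. deg (a - b) = deg a - deg b"
      and null: "\<And>z. z \<in> reduced_cycles n G \<Longrightarrow> deg z = 0 \<longleftrightarrow> null_homologous n G z"
      and f: "f \<in> based n" "\<bar>deg (hurewicz_chain n v0 f)\<bar> = 1"
    using assms(1) unfolding spherical_def by blast
  obtain m where m: "n = Suc m" using n by (cases n) auto
  have rc: "reduced_cycles n G = cycles n G" by (simp add: m reduced_cycles_Suc)
  define h where "h = hurewicz_chain n v0 f"
  have h: "h \<in> cycles n G" unfolding h_def by (rule hurewicz_chain_cycle[OF f(1)])
  interpret psi: group_hom "homotopy_gp n G v0" "homology_gp n G" "psi n G v0"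
    by (rule group_hom_psi[OF n])
  let ?I = "psi n G v0 ` carrier (homotopy_gp n G v0)"
  have I: "subgroup ?I (homology_gp n G)" by (rule psi.img_is_subgroup)
  have deg0: "deg 0 = 0" using add[of 0 0] by simp
  have hI: "cycle_class n G h \<in> ?I"
    using f(1) psi_hclass[OF f(1) n] by (force simp: carrier_homotopy_gp h_def)
  have cmul: "frag_cmul k h \<in> cycles n G \<and> cycle_class n G (frag_cmul k h) \<in> ?I \<and> deg (frag_cmul k h) = k * deg h" for k
  proof -
    have nat: "frag_cmul (int j) h \<in> cycles n G \<and> cycle_class n G (frag_cmul (int j) h) \<in> ?I
        \<and> deg (frag_cmul (int j) h) = int j * deg h" for j
    proof (induction j)
      case 0
      have "0 \<in> cycles n G" by (simp add: cycles_def)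
      then show ?case using subgroup.one_closed[OF I] by (simp add: one_homology_gp deg0)
    next
      case (Suc j)
      have eq: "frag_cmul (int (Suc j)) h = frag_cmul (int j) h + h"
        by (simp add: frag_cmul_distrib add.commute)
      have "deg (a + b) = deg a + deg b" for a b using add[of a "- b"] add[of 0 b] deg0 by simp
      then show ?case
        unfolding eq using Suc.IH h hI subgroup.m_closed[OF I]
        by (auto simp: cycles_add algebra_simps simp flip: mult_homology_gp)
    qed
    show ?thesis
    proof (cases "0 \<le> k")
      case True
      then show ?thesis using nat[of "nat k"] by simp
    next
      case False
      define j where "j = nat (- k)"
      define c where "c = frag_cmul (int j) h"
      have c: "c \<in> cycles n G" "cycle_class n G c \<in> ?I" "deg c = int j * deg h"
        using nat[of j] by (auto simp: c_def)
      have k: "frag_cmul k h = - c" using False by (simp add: c_def j_def)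
      have c': "- c \<in> cycles n G" using cycles_diff[OF _ c(1), of 0] by (simp add: cycles_def)
      have "cycle_class n G (- c) \<otimes>\<^bsub>homology_gp n G\<^esub> cycle_class n G c = \<one>\<^bsub>homology_gp n G\<^esub>"
        by (simp add: mult_homology_gp[OF c' c(1)] one_homology_gp)
      then have "inv\<^bsub>homology_gp n G\<^esub> cycle_class n G c = cycle_class n G (- c)"
        using c(1) c' by (intro psi.H.inv_equality) (auto simp: carrier_homology_gp)
      then have "cycle_class n G (- c) \<in> ?I" using subgroup.m_inv_closed[OF I c(2)] by simp
      moreover have "deg (- c) = k * deg h" using add[of 0 c] deg0 c(3) False by (simp add: j_def)
      ultimately show ?thesis using c' by (simp add: k)
    qed
  qed
  have "cycle_class n G c \<in> ?I" if c: "c \<in> cycles n G" for c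
  proof -
    \<comment> \<open>\<open>deg h\<close> is 1 or -1, hence its own inverse.\<close>
    define k where "k = deg c * deg h"
    have "k * deg h = deg c" using f(2) by (auto simp: k_def h_def abs_if split: if_splits)
    then have "deg (c - frag_cmul k h) = 0" using cmul[of k] by (simp add: add)
    then have "null_homologous n G (c - frag_cmul k h)"
      using null[of "c - frag_cmul k h"] cycles_diff[OF c] cmul[of k] by (simp add: rc)
    then have "cycle_class n G c = cycle_class n G (frag_cmul k h)"
      using cycle_class_eq_iff[OF c] cmul[of k] by blast
    then show ?thesis using cmul[of k] by simp
  qed
  then show "?I = carrier (homology_gp n G)"
    using subgroup.subset[OF I] by (auto simp: carrier_homology_gp)
  have "\<not> null_homologous n G h" using null[of h] h f(2) by (auto simp: rc h_def)
  then have "cycle_class n G h \<noteq> \<one>\<^bsub>homology_gp n G\<^esub>"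
    using cycle_class_eq_iff[OF h, of 0] by (simp add: one_homology_gp cycles_def)
  moreover have "cycle_class n G h \<in> carrier (homology_gp n G)" using h by (simp add: carrier_homology_gp)
  ultimately show "carrier (homology_gp n G) \<noteq> {\<one>\<^bsub>homology_gp n G\<^esub>}" by blast
qed

text \<open>Only the length of the last suspension varies, over a fixed \<open>K\<close> of
  dimension one less; the number of vertices grows with it.\<close>

lemma hurewicz_family:
  assumes n: "1 \<le> n"
  shows "\<exists>(G :: nat \<Rightarrow> nat ugraph) (b :: nat \<Rightarrow> nat).
     (\<forall>k. is_pointed_graph (G k) (b k) \<and>
        psi n (G k) (b k) ` carrier (homotopy_gp n (G k) (b k)) = carrier (homology_gp n (G k)) \<and>
        carrier (homology_gp n (G k)) \<noteq> {\<one>\<^bsub>homology_gp n (G k)\<^esub>}) \<and>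
     (\<forall>j k. j \<noteq> k \<longrightarrow> \<not> graph_isomorphic (G j) (G k))"
proof -
  obtain m where m: "n = Suc m" using n by (cases n) auto
  obtain K :: "nat ugraph" and g0 where K: "edges K \<subseteq> verts K \<times> verts K" "sym (edges K)" "g0 \<in> verts K"
    "finite (verts K)" "spherical m K g0" using spherical_exists by blast
  define G where "G k = suspension (m + 3 + k) g0 K" for k
  define b where "b k = susp_vertex (m + 3 + k) g0 0 g0" for k
  have susp: "graph_suspension K g0 (m + 3 + k)" for k
    using K by unfold_locales auto
  have "is_pointed_graph (G k) (b k) \<and>
      psi n (G k) (b k) ` carrier (homotopy_gp n (G k) (b k)) = carrier (homology_gp n (G k)) \<and>
      carrier (homology_gp n (G k)) \<noteq> {\<one>\<^bsub>homology_gp n (G k)\<^esub>}" for k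
  proof -
    interpret graph_suspension K g0 "m + 3 + k" by (rule susp)
    have pointed: "is_pointed_graph (G k) (b k)"
      using is_graph_S pt_in_verts[of 0 g0] g0 by (simp add: is_pointed_graph_def G_def b_def)
    then interpret pointed_graph "G k" "b k" by unfold_locales
    have "spherical n (G k) (b k)"
      unfolding m G_def b_def by (rule spherical_suspension[OF K(5)]) simp
    then show ?thesis using spherical_psi n pointed by blast
  qed
  moreover have "\<not> graph_isomorphic (G j) (G k)" if "j \<noteq> k" for j k
  proof
    assume "graph_isomorphic (G j) (G k)"
    then have "card (verts (G j)) = card (verts (G k))"
      by (auto simp: graph_isomorphic_def dest: bij_betw_same_card)
    \<comment> \<open>There are \<open>M - 1\<close> inner levels with \<open>M = m + 3 + j\<close>,
      and the two poles on either side cancel.\<close>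
    then have "(m + 2 + j) * card (verts K) = (m + 2 + k) * card (verts K)"
      using graph_suspension.card_verts_suspension(2)[OF susp K(4)] by (simp add: G_def)
    moreover have "card (verts K) \<noteq> 0" using K by auto
    ultimately show False using \<open>j \<noteq> k\<close> by simp
  qed
  ultimately show ?thesis by blast
qed

text \<open>As the value of \<open>psi\<close> is a definite description, well-definedness has to be
  said explicitly: each class has a box representative, and every box representative yields the
  value.\<close>

theorem theorem1p2:
  fixes n :: nat
  assumes "n \<ge> 1"
  shows
    "(\<forall>(G :: 'a ugraph) v0. is_pointed_graph G v0 \<longrightarrow>
        (\<forall>X\<in>carrier (homotopy_gp n G v0).
           \<exists>m\<ge>1. \<exists>f\<in>cube_based_maps n m G v0. X = htpy_class n G v0 (extend_const n m v0 f)) \<and>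
        (\<forall>m\<ge>1. \<forall>f\<in>cube_based_maps n m G v0.
           htpy_class n G v0 (extend_const n m v0 f) \<in> carrier (homotopy_gp n G v0) \<and>
           phi (replicate n m) G f \<in> carrier (cycle_gp n G) \<and>
           psi n G v0 (htpy_class n G v0 (extend_const n m v0 f)) =
             homology_class n G (phi (replicate n m) G f)) \<and>
        group_hom (homotopy_gp n G v0) (homology_gp n G) (psi n G v0)) \<and>
     (\<forall>(G :: 'a ugraph) v0 (G' :: 'b ugraph) v0' F.
        is_pointed_graph G v0 \<and> is_pointed_graph G' v0' \<and> F \<in> graph_maps G G' \<and> F v0 = v0' \<longrightarrow>
        (\<forall>X\<in>carrier (homotopy_gp n G v0).
           psi n G' v0' (homotopy_gp_map n G' v0' F X) = homology_gp_map n G' F (psi n G v0 X))) \<and>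
     (\<exists>(G :: nat \<Rightarrow> nat ugraph) (b :: nat \<Rightarrow> nat).
        (\<forall>k. is_pointed_graph (G k) (b k) \<and>
             psi n (G k) (b k) ` carrier (homotopy_gp n (G k) (b k)) = carrier (homology_gp n (G k)) \<and>
             carrier (homology_gp n (G k)) \<noteq> {\<one>\<^bsub>homology_gp n (G k)\<^esub>}) \<and>
        (\<forall>j k. j \<noteq> k \<longrightarrow> \<not> graph_isomorphic (G j) (G k)))"
proof (intro conjI allI impI)
  fix G :: "'a ugraph" and v0
  assume "is_pointed_graph G v0"
  then interpret pointed_graph G v0 by unfold_locales
  show "\<forall>X\<in>carrier (homotopy_gp n G v0).
      \<exists>m\<ge>1. \<exists>f\<in>cube_based_maps n m G v0. X = htpy_class n G v0 (extend_const n m v0 f)"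
    using hclass_box_representative by blast
  show "\<forall>f\<in>cube_based_maps n m G v0.
      htpy_class n G v0 (extend_const n m v0 f) \<in> carrier (homotopy_gp n G v0) \<and>
      phi (replicate n m) G f \<in> carrier (cycle_gp n G) \<and>
      psi n G v0 (htpy_class n G v0 (extend_const n m v0 f)) =
        homology_class n G (phi (replicate n m) G f)" if "m \<ge> 1" for m
    using extend_const_based phi_cycle(1) psi_box assms that by (auto simp: carrier_homotopy_gp)
  show "group_hom (homotopy_gp n G v0) (homology_gp n G) (psi n G v0)"
    by (rule group_hom_psi[OF assms])
next
  fix G :: "'a ugraph" and v0 and G' :: "'b ugraph" and v0' F
  assume "is_pointed_graph G v0 \<and> is_pointed_graph G' v0' \<and> F \<in> graph_maps G G' \<and> F v0 = v0'"
  then show "\<forall>X\<in>carrier (homotopy_gp n G v0).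
      psi n G' v0' (homotopy_gp_map n G' v0' F X) = homology_gp_map n G' F (psi n G v0 X)"
    using psi_natural[of G v0 G' F n] graph_hom_graph_maps assms by (auto simp: pointed_graph_def)
qed (rule hurewicz_family[OF assms])

end
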